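(* Consider the model $Y_{i,j}=\mu(x_{i,j})+s(x_{i,j})e_{i,j}$, $1\le j\le m_i$, $1\le i\le n$, with $N_n=m_1+\cdots+m_n$, the errors $e_{i,j}$, kernel $K$, and conditions (D), (X), (K), (S) as described in the context, and let $\hat\mu(x)$ be the kernel least-absolute-deviation estimator $$\hat\mu(x)=\operatorname{argmin}_{\theta}\sum_{i=1}^n\sum_{j=1}^{m_i}|Y_{i,j}-\theta|\,K_{b_n}(x_{i,j}-x),\qquad K_{b_n}(u)=K(u/b_n).$$ Assume that (D), (X), (K), (S) hold, and that the bandwidth satisfies $b_n\to0$ and $(\log N_n)^3/(N_nb_n)\to0$. Let $\epsilon>0$ be an arbitrary fixed (small) number and $\mathcal S_\epsilon([a,b])=[a+\epsilon,b-\epsilon]$. Then: (i) $$\sup_{x\in\mathcal S_\epsilon([a,b])}|\hat\mu(x)-\mu(x)|=O_{\mathrm p}\left\{b_n^2+\frac{(\log N_n)^{3/2}}{(N_nb_n)^{1/2}}\right\}.$$ (ii) The representation $$\hat\mu(x)-\mu(x)=\psi_K\,\rho_\mu(x)\,b_n^2+\frac{(b-a)s(x)}{f_e(0)}\,\frac{Q_{b_n}(x)}{N_nb_n}+O_{\mathrm p}(r_n)$$ holds uniformly over $x\in\mathcal S_\epsilon([a,b])$ (i.e. the supremum over $x$ of the absolute value of the remainder is $O_{\mathrm p}(r_n)$), where $$\rho_\mu(x)=\mu''(x)-\left[\frac{\mu'(x)f_e'(0)}{f_e(0)}+2s'(x)\right]\frac{\mu'(x)}{s(x)},$$ $$Q_{b_n}(x)=-\sum_{i=1}^n\sum_{j=1}^{m_i}\left\{\mathbf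 1_{Y_{i,j}\le\mu(x)}-\mathbb E[\mathbf 1_{Y_{i,j}\le\mu(x)}]\right\}K_{b_n}(x_{i,j}-x),$$ $$r_n=b_n^4+\frac{b_n^{1/2}(\log N_n)^{3/2}}{N_n^{1/2}}+\frac{(\log N_n)^{9/4}}{(N_nb_n)^{3/4}}.$$
   Context: Asymptotics: all limits are taken along a sequence of designs $(n;m_1,\dots,m_n;x_{i,j})$, indexed by $n$, with $N_n=m_1+\cdots+m_n\to\infty$; the $m_i$ and the nonrandom points $x_{i,j}$ may change along the sequence. $\mathbf 1$ is the indicator function and $\|Z\|_q=[\mathbb E|Z|^q]^{1/q}$. The argmin denotes any minimizer. Errors: $\varepsilon_{i,j}$ ($i,j\in\mathbb Z$) are i.i.d. random variables, $G$ is a measurable function, and $e_{i,j}=G(\varepsilon_{i,j},\varepsilon_{i,j\pm1},\varepsilon_{i,j\pm2},\ldots)$ (a function of the whole two-sided sequence centred at $j$). Thus for each $i$, $\{e_{i,j}\}_j$ is an independent copy of the stationary process $e_j=G(\varepsilon_j,\varepsilon_{j\pm1},\varepsilon_{j\pm2},\ldots)$ with i.i.d. $\varepsilon_j$. $F_e$ and $f_e=F_e'$ are the distribution and density functions of $e_0$. For identifiability, $e_0$ has median $0$ and $|e_0|$ has median $1$, i.e. $F_e(0)=1/2$ and $F_e(1)-F_e(-1)=1/2$. (D) There are constants $q>0$, $\rho\in(0,1)$ with $\|e_0-e_0(k)\|_q=O(\rho^k)$ (as a function of $k\in\mathbb N$), where $e_0(k)=G(\varepsilon_0,\varepsilon_{\pm1},\ldots,\varepsilon_{\pm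 k},\varepsilon'_{\pm(k+1)},\varepsilon'_{\pm(k+2)},\ldots)$ and $\{\varepsilon'_j\}$ is an i.i.d. copy of $\{\varepsilon_j\}$. (X) All $x_{i,j}$ lie in $[a,b]$ and, ordered as $a=\tilde x_0<\tilde x_1<\cdots<\tilde x_{N_n}<\tilde x_{N_n+1}=b$, satisfy $\max_{0\le k\le N_n}|\tilde x_{k+1}-\tilde x_k-(b-a)/N_n|=O(N_n^{-2})$. (K) $K\ge0$, $\int_{\mathbb R}K(u)\,du=1$, and $K$ is symmetric with bounded support and bounded derivative. Write $\varphi_K=\int K^2(u)\,du$ and $\psi_K=\frac12\int u^2K(u)\,du$. (S) $\mu,s\in\mathcal C^4([a,b])$, $\inf_{x\in[a,b]}s(x)>0$, $f_e\in\mathcal C^4(\mathbb R)$, $f_e(0)>0$, $f_e(1)+f_e(-1)>0$, where $\mathcal C^r(S)$ is the set of functions with bounded derivatives up to order $r$ on $S$ (including order $0$). *)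

theory Defs
  imports "HOL-Probability.Probability" "HOL-Library.Landau_Symbols"
begin

text \<open>A positive-order \<open>L\<^sup>q\<close> norm. The Bochner integral is 0 on non-integrable functions, so every
  use below is accompanied by an integrability condition.\<close>

definition Lq_norm :: "'a measure \<Rightarrow> real \<Rightarrow> ('a \<Rightarrow> real) \<Rightarrow> real" where
  "Lq_norm P q Z = (\<integral>\<omega>. \<bar>Z \<omega>\<bar> powr q \<partial>P) powr (1 / q)"

text \<open>\<open>Z\<^sub>n = O\<^sub>p(r\<^sub>n)\<close> for nonnegative extended real-valued \<open>Z\<^sub>n\<close>. A supremum over uncountably many
  points, or one involving an arbitrary choice of minimizers, need not be measurable, hence the
  exceptional event is required to be covered by a measurable set of small probability (outer
  probability). For measurable \<open>Z\<^sub>n\<close> this is the usual definition.\<close>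

definition bigOp :: "'a measure \<Rightarrow> (nat \<Rightarrow> 'a \<Rightarrow> ennreal) \<Rightarrow> (nat \<Rightarrow> real) \<Rightarrow> bool" where
  "bigOp M Z r \<longleftrightarrow>
     (\<forall>\<eta>>0. \<exists>C>0. \<forall>\<^sub>F n in sequentially. \<exists>A\<in>sets M.
        {\<omega>\<in>space M. Z n \<omega> > ennreal (C * r n)} \<subseteq> A \<and> measure M A \<le> \<eta>)"

text \<open>\<open>\<C>\<^sup>r(S)\<close>: the derivatives of order \<open>0, \<dots>, r\<close> exist and are bounded on \<open>S\<close>; at
  the endpoints of an interval they are one-sided.\<close>

definition bounded_derivs :: "nat \<Rightarrow> real set \<Rightarrow> (real \<Rightarrow> real) \<Rightarrow> bool" where
  "bounded_derivs r S f \<longleftrightarrow>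
     (\<exists>D :: nat \<Rightarrow> real \<Rightarrow> real.
        (\<forall>x\<in>S. D 0 x = f x) \<and>
        (\<forall>k<r. \<forall>x\<in>S. (D k has_real_derivative D (Suc k) x) (at x within S)) \<and>
        (\<forall>k\<le>r. bounded (D k ` S)))"

definition iid_array :: "'a measure \<Rightarrow> (int \<Rightarrow> int \<Rightarrow> 'a \<Rightarrow> real) \<Rightarrow> bool" where
  "iid_array M \<epsilon> \<longleftrightarrow>
     prob_space.indep_vars M (\<lambda>_. borel) (\<lambda>(i, j). \<epsilon> i j) UNIV \<and>
     (\<forall>i j. distr M borel (\<epsilon> i j) = distr M borel (\<epsilon> 0 0))"

text \<open>The argument of \<open>G\<close> is the whole two-sided innovation sequence, re-centred so that
  coordinate \<open>k\<close> is \<open>\<epsilon>\<^bsub>i,j+k\<^esub>\<close>.\<close>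

definition err :: "((int \<Rightarrow> real) \<Rightarrow> real) \<Rightarrow> (int \<Rightarrow> int \<Rightarrow> 'a \<Rightarrow> real) \<Rightarrow> int \<Rightarrow> int \<Rightarrow> 'a \<Rightarrow> real" where
  "err G \<epsilon> i j \<omega> = G (\<lambda>k. \<epsilon> i (j + k) \<omega>)"

definition coupled :: "nat \<Rightarrow> (int \<Rightarrow> real) \<Rightarrow> (int \<Rightarrow> real) \<Rightarrow> int \<Rightarrow> real" where
  "coupled k u u' = (\<lambda>j. if \<bar>j\<bar> \<le> int k then u j else u' j)"

text \<open>Condition (D), where \<open>\<nu>\<close> is the law of a single innovation. The generic i.i.d. sequence
  \<open>(\<epsilon>\<^sub>j)\<close> and its independent copy \<open>(\<epsilon>'\<^sub>j)\<close> are the two components of a point of the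
  canonical product space, so that no copy has to exist on the space carrying the model.\<close>

definition cond_D :: "real measure \<Rightarrow> ((int \<Rightarrow> real) \<Rightarrow> real) \<Rightarrow> bool" where
  "cond_D \<nu> G \<longleftrightarrow>
     (let P = PiM (UNIV :: int set) (\<lambda>_. \<nu>) \<Otimes>\<^sub>M PiM (UNIV :: int set) (\<lambda>_. \<nu>);
          \<Delta> = (\<lambda>k (u, u'). G u - G (coupled k u u'))
      in \<exists>q>0. \<exists>\<rho>\<in>{0<..<1}.
           (\<forall>\<^sub>F k in sequentially. integrable P (\<lambda>z. \<bar>\<Delta> k z\<bar> powr q)) \<and>
           (\<lambda>k. Lq_norm P q (\<Delta> k)) \<in> O(\<lambda>k. \<rho> ^ k))"

text \<open>In the \<open>n\<close>-th design, \<open>m n i\<close> is the number of observations on subject \<open>i\<close> and \<open>x n i j\<close> is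
  the \<open>j\<close>-th design point of subject \<open>i\<close>, where \<open>1 \<le> i \<le> n\<close> and \<open>1 \<le> j \<le> m n i\<close>.\<close>

definition sample_size :: "(nat \<Rightarrow> nat \<Rightarrow> nat) \<Rightarrow> nat \<Rightarrow> nat" where
  "sample_size m n = (\<Sum>i=1..n. m n i)"

text \<open>In condition (X) the ordered points are distinct; as there are as many of them as index pairs
  \<open>(i, j)\<close>, equality of the sets of points makes the enumeration one-to-one.\<close>

definition cond_X ::
  "real \<Rightarrow> real \<Rightarrow> (nat \<Rightarrow> nat \<Rightarrow> nat) \<Rightarrow> (nat \<Rightarrow> nat \<Rightarrow> nat \<Rightarrow> real) \<Rightarrow> bool" where
  "cond_X a b m x \<longleftrightarrow>
     (let N = sample_size m in
      \<exists>xt :: nat \<Rightarrow> nat \<Rightarrow> real.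
        (\<forall>n. xt n 0 = a \<and> xt n (N n + 1) = b \<and> strict_mono_on {0..N n + 1} (xt n) \<and>
             xt n ` {1..N n} = {x n i j | i j. i \<in> {1..n} \<and> j \<in> {1..m n i}}) \<and>
        (\<lambda>n. MAX k\<in>{0..N n}. \<bar>xt n (k + 1) - xt n k - (b - a) / real (N n)\<bar>)
          \<in> O(\<lambda>n. 1 / real (N n) ^ 2))"

definition cond_K :: "(real \<Rightarrow> real) \<Rightarrow> bool" where
  "cond_K K \<longleftrightarrow>
     (\<forall>u. 0 \<le> K u) \<and> integrable lborel K \<and> (\<integral>u. K u \<partial>lborel) = 1 \<and>
     (\<forall>u. K (- u) = K u) \<and> bounded {u. K u \<noteq> 0} \<and>
     (\<forall>u. K differentiable (at u)) \<and> bounded (range (deriv K))"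

definition psi_K :: "(real \<Rightarrow> real) \<Rightarrow> real" where
  "psi_K K = (\<integral>u. u ^ 2 * K u \<partial>lborel) / 2"

definition cond_S ::
  "real \<Rightarrow> real \<Rightarrow> (real \<Rightarrow> real) \<Rightarrow> (real \<Rightarrow> real) \<Rightarrow> (real \<Rightarrow> real) \<Rightarrow> bool" where
  "cond_S a b \<mu> s f \<longleftrightarrow>
     bounded_derivs 4 {a..b} \<mu> \<and> bounded_derivs 4 {a..b} s \<and> (INF x\<in>{a..b}. s x) > 0 \<and>
     bounded_derivs 4 UNIV f \<and> f 0 > 0 \<and> f 1 + f (-1) > 0"

definition lad_objective ::
  "(nat \<Rightarrow> nat \<Rightarrow> nat) \<Rightarrow> (nat \<Rightarrow> nat \<Rightarrow> nat \<Rightarrow> real) \<Rightarrow> (nat \<Rightarrow> nat \<Rightarrow> nat \<Rightarrow> 'a \<Rightarrow> real) \<Rightarrow>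
   (real \<Rightarrow> real) \<Rightarrow> (nat \<Rightarrow> real) \<Rightarrow> nat \<Rightarrow> real \<Rightarrow> 'a \<Rightarrow> real \<Rightarrow> real" where
  "lad_objective m x Y K bw n t \<omega> \<theta> =
     (\<Sum>i=1..n. \<Sum>j=1..m n i. \<bar>Y n i j \<omega> - \<theta>\<bar> * K ((x n i j - t) / bw n))"

definition Q_process ::
  "'a measure \<Rightarrow> (nat \<Rightarrow> nat \<Rightarrow> nat) \<Rightarrow> (nat \<Rightarrow> nat \<Rightarrow> nat \<Rightarrow> real) \<Rightarrow>
   (nat \<Rightarrow> nat \<Rightarrow> nat \<Rightarrow> 'a \<Rightarrow> real) \<Rightarrow> (real \<Rightarrow> real) \<Rightarrow> (real \<Rightarrow> real) \<Rightarrow> (nat \<Rightarrow> real) \<Rightarrow>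
   nat \<Rightarrow> real \<Rightarrow> 'a \<Rightarrow> real" where
  "Q_process M m x Y \<mu> K bw n t \<omega> =
     - (\<Sum>i=1..n. \<Sum>j=1..m n i.
          (of_bool (Y n i j \<omega> \<le> \<mu> t) - (\<integral>\<omega>'. of_bool (Y n i j \<omega>' \<le> \<mu> t) \<partial>M))
          * K ((x n i j - t) / bw n))"

text \<open>The ordinary two-sided derivatives in \<open>rho_mu\<close> are only evaluated at interior points of
  \<open>[a, b]\<close>.\<close>

definition rho_mu ::
  "(real \<Rightarrow> real) \<Rightarrow> (real \<Rightarrow> real) \<Rightarrow> (real \<Rightarrow> real) \<Rightarrow> real \<Rightarrow> real" where
  "rho_mu \<mu> s f t =
     deriv (deriv \<mu>) t - (deriv \<mu> t * deriv f 0 / f 0 + 2 * deriv s t) * (deriv \<mu> t / s t)"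

end

theory Submission
  imports Defs
begin

text \<open>The argument rests on monotonicity. With weights \<open>w\<^sub>p = K((x\<^sub>p - t)/b\<^sub>n)\<close>, a minimizer lies below a level
  \<open>\<theta>\<close> as soon as \<open>H(\<theta>) = \<Sum>\<^sub>p w\<^sub>p (\<one>{Y\<^sub>p \<le> \<theta>} - 1/2) > 0\<close>, and above it if \<open>H(\<theta>) < 0\<close>. Hence it suffices to determine
  the sign of \<open>H\<close> at the two levels \<open>\<mu>(t) + \<psi>\<^sub>K \<rho>\<^sub>\<mu>(t) b\<^sub>n\<^sup>2 + (b - a) s(t) Q(t) / (f\<^sub>e(0) N\<^sub>n b\<^sub>n) \<plusminus> C r\<^sub>n\<close>. The expectation of \<open>H\<close> is a
  Riemann sum, expanded by Taylor's formula, where the symmetry of \<open>K\<close> removes the odd orders. Its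
  fluctuations are compared with \<open>- Q(t)\<close> by Bernstein's inequality over a polynomially fine grid
  of points and levels, monotonicity in the level filling the gaps. Independence is obtained by
  replacing the errors with \<open>k\<close>-dependent ones, \<open>k\<close> of order \<open>log N\<^sub>n\<close>, and splitting the sum according to
  \<open>j mod (2k + 1)\<close>; the union bound over these classes is the source of the power \<open>3/2\<close> of the logarithm.\<close>

section \<open>Uniformly smooth families, Riemann sums and weighted medians\<close>

text \<open>Both rates come from one Bernstein bound. Write \<open>NB n = N n * bw n\<close>. If a
  weighted sum of centred indicators has variance of order \<open>NB n * g\<^sup>2\<close>, its
  deviations are of order \<open>NB n * g * (y n)\<^sup>2\<close>, where \<open>y\<close> solves
  \<open>NB n * y n ^ 4 = l n ^ 3\<close>: one factor \<open>l n\<close> pays for the union bound,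
  two pay for the residue classes. At the levels \<mu>(t) only \<open>g = 1\<close> is available,
  which gives the stochastic part of the first rate. Between levels at distance of order
  \<open>(bw n)\<^sup>2 + (y n)\<^sup>2\<close> the indicators live on short intervals, so
  \<open>g = bw n + y n\<close>; this gives the last two terms of \<open>r\<^sub>n\<close>, while
  \<open>bw n ^ 4\<close> is the bias left after the second order. The truncated errors need not
  have a continuous distribution, so only the smoothness of the original one is used, after moving
  levels by multiples of \<open>1 / N n\<close>. Errors of Riemann sums and of rounding stay bounded
  and vanish against \<open>NB n * y n ^ 3\<close>, which is at least 1. Minimizers may fail to be
  measurable; therefore all estimates hold for every \<open>t\<close> at once off a measurable event
  of probability \<open>O(1 / N n)\<close>.\<close>

primrec unif_diff :: "nat \<Rightarrow> 't set \<Rightarrow> real set \<Rightarrow> ('t \<Rightarrow> real \<Rightarrow> real) \<Rightarrow> bool" where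
  "unif_diff 0 T V \<phi> \<longleftrightarrow> (\<exists>C. \<forall>t\<in>T. \<forall>v\<in>V. \<bar>\<phi> t v\<bar> \<le> C)"
| "unif_diff (Suc r) T V \<phi> \<longleftrightarrow> (\<exists>C. \<forall>t\<in>T. \<forall>v\<in>V. \<bar>\<phi> t v\<bar> \<le> C) \<and>
     (\<exists>\<phi>'. (\<forall>t\<in>T. \<forall>v\<in>V. (\<phi> t has_real_derivative \<phi>' t v) (at v)) \<and> unif_diff r T V \<phi>')"

lemma unif_diff_bounded: "unif_diff r T V \<phi> \<Longrightarrow> \<exists>C. \<forall>t\<in>T. \<forall>v\<in>V. \<bar>\<phi> t v\<bar> \<le> C"
  by (cases r) auto

lemma unif_diff_SucI:
  assumes "unif_diff r T V \<phi>'" "\<exists>C. \<forall>t\<in>T. \<forall>v\<in>V. \<bar>\<phi> t v\<bar> \<le> C"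
    and "\<And>t v. t \<in> T \<Longrightarrow> v \<in> V \<Longrightarrow> (\<phi> t has_real_derivative \<phi>' t v) (at v)"
  shows "unif_diff (Suc r) T V \<phi>"
  unfolding unif_diff.simps using assms by blast

lemma unif_diff_Suc_imp: "unif_diff (Suc r) T V \<phi> \<Longrightarrow> unif_diff r T V \<phi>"
proof (induction r arbitrary: \<phi>)
  case (Suc r)
  then obtain \<phi>' where "\<forall>t\<in>T. \<forall>v\<in>V. (\<phi> t has_real_derivative \<phi>' t v) (at v)"
    "unif_diff (Suc r) T V \<phi>'" by auto
  with Suc show ?case by (auto intro: unif_diff_bounded)
qed auto

lemma unif_diff_mono: "unif_diff r T V \<phi> \<Longrightarrow> q \<le> r \<Longrightarrow> unif_diff q T V \<phi>"
  by (induction r) (auto simp: le_Suc_eq simp del: unif_diff.simps dest: unif_diff_Suc_imp)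

lemma uniformly_bounded_add:
  fixes \<phi> \<psi> :: "'t \<Rightarrow> real \<Rightarrow> real"
  assumes "\<exists>C. \<forall>t\<in>T. \<forall>v\<in>V. \<bar>\<phi> t v\<bar> \<le> C" "\<exists>C. \<forall>t\<in>T. \<forall>v\<in>V. \<bar>\<psi> t v\<bar> \<le> C"
  shows "\<exists>C. \<forall>t\<in>T. \<forall>v\<in>V. \<bar>\<phi> t v + \<psi> t v\<bar> \<le> C"
proof -
  obtain C C' where C: "\<And>t v. t\<in>T \<Longrightarrow> v\<in>V \<Longrightarrow> \<bar>\<phi> t v\<bar> \<le> C" "\<And>t v. t\<in>T \<Longrightarrow> v\<in>V \<Longrightarrow> \<bar>\<psi> t v\<bar> \<le> C'"
    using assms by blast
  show ?thesis
    by (intro exI[of _ "C + C'"] ballI abs_triangle_ineq[THEN order_trans] add_mono C)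
qed

lemma uniformly_bounded_mult:
  fixes \<phi> \<psi> :: "'t \<Rightarrow> real \<Rightarrow> real"
  assumes "\<exists>C. \<forall>t\<in>T. \<forall>v\<in>V. \<bar>\<phi> t v\<bar> \<le> C" "\<exists>C. \<forall>t\<in>T. \<forall>v\<in>V. \<bar>\<psi> t v\<bar> \<le> C"
  shows "\<exists>C. \<forall>t\<in>T. \<forall>v\<in>V. \<bar>\<phi> t v * \<psi> t v\<bar> \<le> C"
proof -
  obtain C C' where C: "\<And>t v. t\<in>T \<Longrightarrow> v\<in>V \<Longrightarrow> \<bar>\<phi> t v\<bar> \<le> C" "\<And>t v. t\<in>T \<Longrightarrow> v\<in>V \<Longrightarrow> \<bar>\<psi> t v\<bar> \<le> C'"
    using assms by blast
  show ?thesis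
    by (intro exI[of _ "C * C'"] ballI) (auto simp: abs_mult intro!: mult_mono C intro: order_trans[OF abs_ge_zero C(1)])
qed

lemma unif_diff_add:
  "unif_diff r T V \<phi> \<Longrightarrow> unif_diff r T V \<psi> \<Longrightarrow> unif_diff r T V (\<lambda>t v. \<phi> t v + \<psi> t v)"
proof (induction r arbitrary: \<phi> \<psi>)
  case 0 then show ?case unfolding unif_diff.simps by (rule uniformly_bounded_add)
next
  case (Suc r)
  from Suc.prems obtain \<phi>' \<psi>' where
    d: "\<And>t v. t\<in>T \<Longrightarrow> v\<in>V \<Longrightarrow> (\<phi> t has_real_derivative \<phi>' t v) (at v)"
       "\<And>t v. t\<in>T \<Longrightarrow> v\<in>V \<Longrightarrow> (\<psi> t has_real_derivative \<psi>' t v) (at v)"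
      and u: "unif_diff r T V \<phi>'" "unif_diff r T V \<psi>'"
    unfolding unif_diff.simps by blast
  from Suc.prems[THEN unif_diff_bounded] have "\<exists>C. \<forall>t\<in>T. \<forall>v\<in>V. \<bar>\<phi> t v + \<psi> t v\<bar> \<le> C"
    by (rule uniformly_bounded_add)
  with Suc.IH[OF u] d show ?case
    by (auto intro!: exI[of _ "\<lambda>t v. \<phi>' t v + \<psi>' t v"] derivative_intros)
qed

text \<open>The derivative of a product is a sum of products of functions already known to be of
  order \<open>r\<close>. The predicate is recursive in the order precisely so that such closure
  properties are one-step inductions, without Leibniz or Faa di Bruno formulas.\<close>

lemma unif_diff_mult:
  "unif_diff r T V \<phi> \<Longrightarrow> unif_diff r T V \<psi> \<Longrightarrow> unif_diff r T V (\<lambda>t v. \<phi> t v * \<psi> t v)"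
proof (induction r arbitrary: \<phi> \<psi>)
  case 0 then show ?case unfolding unif_diff.simps by (rule uniformly_bounded_mult)
next
  case (Suc r)
  from Suc.prems obtain \<phi>' \<psi>' where
    d: "\<And>t v. t\<in>T \<Longrightarrow> v\<in>V \<Longrightarrow> (\<phi> t has_real_derivative \<phi>' t v) (at v)"
       "\<And>t v. t\<in>T \<Longrightarrow> v\<in>V \<Longrightarrow> (\<psi> t has_real_derivative \<psi>' t v) (at v)"
      and u: "unif_diff r T V \<phi>'" "unif_diff r T V \<psi>'"
    unfolding unif_diff.simps by blast
  from Suc.prems[THEN unif_diff_bounded] have b: "\<exists>C. \<forall>t\<in>T. \<forall>v\<in>V. \<bar>\<phi> t v * \<psi> t v\<bar> \<le> C"
    by (rule uniformly_bounded_mult)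
  have "unif_diff r T V (\<lambda>t v. \<phi>' t v * \<psi> t v + \<psi>' t v * \<phi> t v)"
    by (intro unif_diff_add Suc.IH u Suc.prems[THEN unif_diff_Suc_imp])
  with d b show ?case
    by (auto intro!: exI[of _ "\<lambda>t v. \<phi>' t v * \<psi> t v + \<psi>' t v * \<phi> t v"] derivative_intros)
qed

lemma unif_diff_const: "(\<And>t. t \<in> T \<Longrightarrow> \<bar>c t\<bar> \<le> C) \<Longrightarrow> unif_diff r T V (\<lambda>t v. c t)"
proof (induction r arbitrary: c C)
  case (Suc r)
  have "unif_diff r T V (\<lambda>t v. 0)" by (rule Suc.IH[where C=0]) auto
  with Suc.prems show ?case by (auto intro!: exI[of _ "\<lambda>t v. 0"])
qed auto

lemma unif_diff_uminus: "unif_diff r T V \<phi> \<Longrightarrow> unif_diff r T V (\<lambda>t v. - \<phi> t v)"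
  using unif_diff_mult[OF unif_diff_const[of T "\<lambda>_. -1" 1]] by fastforce

lemma unif_diff_inverse:
  assumes "unif_diff r T V \<phi>" and "0 < c" and "\<And>t v. t \<in> T \<Longrightarrow> v \<in> V \<Longrightarrow> c \<le> \<phi> t v"
  shows "unif_diff r T V (\<lambda>t v. inverse (\<phi> t v))"
  using assms(1)
proof (induction r)
  case 0
  have "\<bar>inverse (\<phi> t v)\<bar> \<le> inverse c" if "t \<in> T" "v \<in> V" for t v
    using assms(2) assms(3)[OF that] by (simp add: le_imp_inverse_le)
  then show ?case by auto
next
  case (Suc r)
  from Suc.prems obtain \<phi>' where
    d: "\<And>t v. t\<in>T \<Longrightarrow> v\<in>V \<Longrightarrow> (\<phi> t has_real_derivative \<phi>' t v) (at v)" and u: "unif_diff r T V \<phi>'"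
    unfolding unif_diff.simps by blast
  have i: "unif_diff r T V (\<lambda>t v. inverse (\<phi> t v))"
    using Suc by (simp add: unif_diff_Suc_imp del: unif_diff.simps)
  have "unif_diff r T V (\<lambda>t v. - (inverse (\<phi> t v) * \<phi>' t v * inverse (\<phi> t v)))"
    by (intro unif_diff_uminus unif_diff_mult i u)
  moreover have "((\<lambda>v. inverse (\<phi> t v)) has_real_derivative - (inverse (\<phi> t v) * \<phi>' t v * inverse (\<phi> t v))) (at v)"
    if "t \<in> T" "v \<in> V" for t v
    using assms(2) assms(3)[OF that] by (intro DERIV_inverse' d that) auto
  ultimately show ?case using unif_diff_bounded[OF i] by (intro unif_diff_SucI)
qed

text \<open>The outer function carries no parameter; indexing it by the one-element type lets the
  same predicate express its bounded derivatives. The chain rule leads from \<open>F\<close> to its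
  derivative, hence the generalization over \<open>F\<close> in the induction.\<close>

lemma unif_diff_compose:
  assumes "unif_diff r UNIV UNIV (\<lambda>_::unit. F)" and "unif_diff r T V \<phi>"
  shows "unif_diff r T V (\<lambda>t v. F (\<phi> t v))"
  using assms
proof (induction r arbitrary: F)
  case 0 then show ?case by auto
next
  case (Suc r)
  from Suc.prems obtain f \<phi>' where
    d: "\<And>v. (F has_real_derivative f () v) (at v)"
       "\<And>t v. t\<in>T \<Longrightarrow> v\<in>V \<Longrightarrow> (\<phi> t has_real_derivative \<phi>' t v) (at v)"
      and u: "unif_diff r UNIV UNIV f" "unif_diff r T V \<phi>'"
    unfolding unif_diff.simps by blast
  have f: "unif_diff r UNIV UNIV (\<lambda>_::unit. f ())" using u(1) by (simp add: unit_abs_eta_conv)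
  have "unif_diff r T V (\<lambda>t v. f () (\<phi> t v) * \<phi>' t v)"
    by (rule unif_diff_mult[OF Suc.IH[OF f Suc.prems(2)[THEN unif_diff_Suc_imp]] u(2)])
  moreover have "\<exists>C. \<forall>t\<in>T. \<forall>v\<in>V. \<bar>F (\<phi> t v)\<bar> \<le> C"
    using unif_diff_bounded[OF Suc.prems(1)] by auto
  moreover have "((\<lambda>v. F (\<phi> t v)) has_real_derivative f () (\<phi> t v) * \<phi>' t v) (at v)"
    if "t \<in> T" "v \<in> V" for t v
    using d(1) d(2)[OF that] by (rule DERIV_chain2)
  ultimately show ?case by (rule unif_diff_SucI)
qed

text \<open>Maclaurin's formula wants the derivatives as one sequence with a common bound; the
  nested existential quantifiers of the predicate are unrolled into it.\<close>

lemma unif_diff_derivs: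
  assumes "unif_diff r T V \<phi>"
  obtains D C where "D 0 = \<phi>"
    "\<And>k t v. k < r \<Longrightarrow> t \<in> T \<Longrightarrow> v \<in> V \<Longrightarrow> (D k t has_real_derivative D (Suc k) t v) (at v)"
    "\<And>k t v. k \<le> r \<Longrightarrow> t \<in> T \<Longrightarrow> v \<in> V \<Longrightarrow> \<bar>D k t v\<bar> \<le> C"
  using assms
proof (induction r arbitrary: \<phi> thesis)
  case 0
  from 0(2) obtain C where "\<forall>t\<in>T. \<forall>v\<in>V. \<bar>\<phi> t v\<bar> \<le> C" by auto
  then show ?case by (intro 0(1)[of "\<lambda>_. \<phi>" C]) auto
next
  case (Suc r)
  from Suc.prems(2) obtain \<phi>' C where d: "\<forall>t\<in>T. \<forall>v\<in>V. \<bar>\<phi> t v\<bar> \<le> C" "unif_diff r T V \<phi>'"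
      "\<And>t v. t\<in>T \<Longrightarrow> v\<in>V \<Longrightarrow> (\<phi> t has_real_derivative \<phi>' t v) (at v)" by auto
  from Suc.IH[OF _ d(2)] obtain D C' where D: "D 0 = \<phi>'"
    "\<And>k t v. k < r \<Longrightarrow> t \<in> T \<Longrightarrow> v \<in> V \<Longrightarrow> (D k t has_real_derivative D (Suc k) t v) (at v)"
    "\<And>k t v. k \<le> r \<Longrightarrow> t \<in> T \<Longrightarrow> v \<in> V \<Longrightarrow> \<bar>D k t v\<bar> \<le> C'" by metis
  show ?case
  proof (rule Suc.prems(1)[of "case_nat \<phi> D" "max C C'"])
    show "((case k of 0 \<Rightarrow> \<phi> | Suc k \<Rightarrow> D k) t has_real_derivative (case Suc k of 0 \<Rightarrow> \<phi> | Suc k \<Rightarrow> D k) t v) (at v)"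
      if "k < Suc r" "t \<in> T" "v \<in> V" for k t v
      using that D d by (cases k) auto
    show "\<bar>(case k of 0 \<Rightarrow> \<phi> | Suc k \<Rightarrow> D k) t v\<bar> \<le> max C C'"
      if "k \<le> Suc r" "t \<in> T" "v \<in> V" for k t v
      using that D(3)[of "k - 1" t v] d(1) by (cases k) (auto simp: max.coboundedI1 max.coboundedI2)
  qed auto
qed

text \<open>The coefficients up to order 2 are identified by uniqueness of derivatives. The cubic
  one stays anonymous, because the symmetric kernel will annihilate it. What matters is that
  \<open>C\<close> does not depend on \<open>t\<close>.\<close>

lemma unif_diff_4_expansion:
  assumes "unif_diff 4 T {-d<..<d} \<phi>" and "0 < d"
    and d1: "\<And>t v. t \<in> T \<Longrightarrow> \<bar>v\<bar> < d \<Longrightarrow> (\<phi> t has_real_derivative \<phi>1 t v) (at v)"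
    and d2: "\<And>t. t \<in> T \<Longrightarrow> (\<phi>1 t has_real_derivative c2 t) (at 0)"
  obtains C c3 where "\<And>t v. t \<in> T \<Longrightarrow> \<bar>v\<bar> < d \<Longrightarrow>
     \<bar>\<phi> t v - (\<phi> t 0 + \<phi>1 t 0 * v + c2 t / 2 * v ^ 2 + c3 t * v ^ 3)\<bar> \<le> C * v ^ 4"
proof -
  from unif_diff_derivs[OF assms(1)] obtain D C where D: "D 0 = \<phi>"
    "\<And>k t v. k < 4 \<Longrightarrow> t \<in> T \<Longrightarrow> v \<in> {-d<..<d} \<Longrightarrow> (D k t has_real_derivative D (Suc k) t v) (at v)"
    "\<And>k t v. k \<le> 4 \<Longrightarrow> t \<in> T \<Longrightarrow> v \<in> {-d<..<d} \<Longrightarrow> \<bar>D k t v\<bar> \<le> C" by metis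
  have D1: "D 1 t v = \<phi>1 t v" if "t \<in> T" "\<bar>v\<bar> < d" for t v
  proof -
    have "(\<phi> t has_real_derivative D 1 t v) (at v)" using D(2)[of 0 t v] that D(1) by (auto simp: abs_less_iff)
    from DERIV_unique[OF this d1[OF that]] show ?thesis .
  qed
  have D2: "D 2 t 0 = c2 t" if "t \<in> T" for t
  proof -
    have "(D 1 t has_real_derivative D 2 t 0) (at 0)"
      using D(2)[of 1 t 0] that \<open>0 < d\<close> by (simp add: numeral_2_eq_2)
    then have "(\<phi>1 t has_real_derivative D 2 t 0) (at 0)"
      by (rule has_field_derivative_transform_within[where d=d]) (use D1 that \<open>0 < d\<close> in auto)
    with d2[OF that] show ?thesis by (auto dest: DERIV_unique)
  qed
  show thesis
  proof (rule that[of "\<lambda>t. D 3 t 0 / 6" "C"])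
    fix t v assume t: "t \<in> T" and v: "\<bar>v\<bar> < d"
    have "\<forall>m w. m < 4 \<and> \<bar>w\<bar> \<le> \<bar>v\<bar> \<longrightarrow> DERIV (D m t) w :> D (Suc m) t w"
      using t v by (auto intro!: D(2))
    from Maclaurin_bi_le[of "\<lambda>m. D m t", OF refl this] obtain w where w: "\<bar>w\<bar> \<le> \<bar>v\<bar>"
      "\<phi> t v = (\<Sum>m<4. D m t 0 / fact m * v ^ m) + D 4 t w / fact 4 * v ^ 4"
      using D(1) by auto
    have "\<bar>D 4 t w\<bar> \<le> C" by (rule D(3)) (use t v w(1) in auto)
    then have "\<bar>D 4 t w\<bar> * v ^ 4 \<le> C * v ^ 4" by (rule mult_right_mono) simp
    moreover have "0 \<le> \<bar>D 4 t w\<bar> * v ^ 4" by simp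
    moreover have "\<bar>D 4 t w / fact 4 * v ^ 4\<bar> = \<bar>D 4 t w\<bar> * v ^ 4 / 24"
      by (simp add: abs_mult fact_numeral)
    ultimately have "\<bar>D 4 t w / fact 4 * v ^ 4\<bar> \<le> C * v ^ 4" by linarith
    moreover have "(\<Sum>m<4. D m t 0 / fact m * v ^ m) = \<phi> t 0 + \<phi>1 t 0 * v + c2 t / 2 * v ^ 2 + D 3 t 0 / 6 * v ^ 3"
      using D(1) D1[OF t, of 0] D2[OF t] \<open>0 < d\<close>
      by (simp add: eval_nat_numeral fact_reduce)
    ultimately show "\<bar>\<phi> t v - (\<phi> t 0 + \<phi>1 t 0 * v + c2 t / 2 * v ^ 2 + D 3 t 0 / 6 * v ^ 3)\<bar> \<le> C * v ^ 4"
      using w by simp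
  qed
qed

text \<open>Meant for the factor that multiplies the offset \<Delta> of a level; its linear
  coefficient is of odd order, so its value is again irrelevant.\<close>

lemma unif_diff_2_expansion:
  assumes "unif_diff 2 T {-d<..<d} \<phi>" and "0 < d"
  obtains C c1 where "\<And>t v. t \<in> T \<Longrightarrow> \<bar>v\<bar> < d \<Longrightarrow> \<bar>\<phi> t v - (\<phi> t 0 + c1 t * v)\<bar> \<le> C * v ^ 2"
proof -
  from unif_diff_derivs[OF assms(1)] obtain D C where D: "D 0 = \<phi>"
    "\<And>k t v. k < 2 \<Longrightarrow> t \<in> T \<Longrightarrow> v \<in> {-d<..<d} \<Longrightarrow> (D k t has_real_derivative D (Suc k) t v) (at v)"
    "\<And>k t v. k \<le> 2 \<Longrightarrow> t \<in> T \<Longrightarrow> v \<in> {-d<..<d} \<Longrightarrow> \<bar>D k t v\<bar> \<le> C" by metis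
  show thesis
  proof (rule that[of "\<lambda>t. D 1 t 0" "C"])
    fix t v assume t: "t \<in> T" and v: "\<bar>v\<bar> < d"
    have "\<forall>m w. m < 2 \<and> \<bar>w\<bar> \<le> \<bar>v\<bar> \<longrightarrow> DERIV (D m t) w :> D (Suc m) t w"
      using t v by (auto intro!: D(2))
    from Maclaurin_bi_le[of "\<lambda>m. D m t", OF refl this] obtain w where w: "\<bar>w\<bar> \<le> \<bar>v\<bar>"
      "\<phi> t v = (\<Sum>m<2. D m t 0 / fact m * v ^ m) + D 2 t w / fact 2 * v ^ 2"
      using D(1) by auto
    have "\<bar>D 2 t w\<bar> \<le> C" by (rule D(3)) (use t v w(1) in auto)
    then have "\<bar>D 2 t w\<bar> * v ^ 2 \<le> C * v ^ 2" by (rule mult_right_mono) simp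
    moreover have "0 \<le> \<bar>D 2 t w\<bar> * v ^ 2" by simp
    moreover have "\<bar>D 2 t w / fact 2 * v ^ 2\<bar> = \<bar>D 2 t w\<bar> * v ^ 2 / 2"
      by (simp add: abs_mult fact_numeral)
    ultimately have "\<bar>D 2 t w / fact 2 * v ^ 2\<bar> \<le> C * v ^ 2" by linarith
    moreover have "(\<Sum>m<2. D m t 0 / fact m * v ^ m) = \<phi> t 0 + D 1 t 0 * v"
      using D(1) by (simp add: eval_nat_numeral fact_reduce)
    ultimately show "\<bar>\<phi> t v - (\<phi> t 0 + D 1 t 0 * v)\<bar> \<le> C * v ^ 2"
      using w by simp
  qed
qed

section \<open>Nearly equidistant points and Riemann sums\<close>

lemma increasing_points_distance:
  fixes x :: "nat \<Rightarrow> real"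
  assumes "\<And>k. k < M \<Longrightarrow> g \<le> x (Suc k) - x k" and "i \<le> j" "j \<le> M"
  shows "g * real (j - i) \<le> x j - x i"
  using assms(2,3)
proof (induction j rule: dec_induct)
  case (step j)
  then show ?case using assms(1)[of j] by (simp add: Suc_diff_le algebra_simps)
qed auto

text \<open>The first and the last index falling into the interval are at most
  \<open>(d - c) / g\<close> apart; the \<open>+ 1\<close> counts both ends.\<close>

lemma card_points_in_interval:
  fixes x :: "nat \<Rightarrow> real"
  assumes "\<And>k. k < M \<Longrightarrow> g \<le> x (Suc k) - x k" and "0 < g" and "c \<le> d"
  shows "real (card {k. k \<le> M \<and> x k \<in> {c..d}}) \<le> (d - c) / g + 1"
proof -
  let ?A = "{k. k \<le> M \<and> x k \<in> {c..d}}"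
  show ?thesis
  proof (cases "?A = {}")
    case True
    then show ?thesis unfolding True using assms(2,3) by simp
  next
    case False
    have fin: "finite ?A" by (rule finite_subset[of _ "{..M}"]) auto
    let ?i = "Min ?A" and ?j = "Max ?A"
    have ij0: "?i \<in> ?A" "?j \<in> ?A" using Min_in[OF fin False] Max_in[OF fin False] .
    have ij: "?i \<in> ?A" "?j \<in> ?A" "?i \<le> ?j" using ij0 Min_le[OF fin ij0(2)] .
    have "?A \<subseteq> {?i..?j}" using Min_le[OF fin] Max_ge[OF fin] by (auto simp del: Min_le Max_ge)
    then have "card ?A \<le> ?j - ?i + 1" using card_mono[of "{?i..?j}" ?A] ij(3) by (simp add: Suc_diff_le)
    moreover have "g * real (?j - ?i) \<le> x ?j - x ?i"
      by (rule increasing_points_distance[of M g x, OF assms(1)]) (use ij in auto)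
    moreover have "x ?j - x ?i \<le> d - c" using ij by auto
    moreover have "g * (real (card ?A) - 1) \<le> g * real (?j - ?i)"
      using \<open>card ?A \<le> ?j - ?i + 1\<close> assms(2) by (intro mult_left_mono) linarith+
    ultimately have "g * (real (card ?A) - 1) \<le> d - c" by linarith
    then show ?thesis using assms(2) by (simp add: field_simps)
  qed
qed

text \<open>The points stand for rescaled design points with step about \<Gamma>. Each term
  \<open>h (x k) * \<Gamma>\<close> is compared with an increment of a primitive of
  \<open>h\<close>, at a cost of order \<open>\<Gamma>\<^sup>2\<close>. Only about
  \<open>R / \<Gamma>\<close> steps meet the support, so after division by \<Gamma> the error is
  bounded, however many points there are.\<close>

lemma riemann_sum_error:
  fixes x :: "nat \<Rightarrow> real" and h :: "real \<Rightarrow> real"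
  assumes \<Gamma>: "0 < \<Gamma>" "\<kappa> * \<Gamma> \<le> 1/2" "0 \<le> \<kappa>"
    and gap: "\<And>k. k \<le> M \<Longrightarrow> \<bar>x (Suc k) - x k - \<Gamma>\<bar> \<le> \<kappa> * \<Gamma>\<^sup>2"
    and ends: "x 0 < - R" "R < x (Suc M)" "0 < R"
    and lip: "\<And>u v. \<bar>h u - h v\<bar> \<le> L * \<bar>u - v\<bar>"
    and bd: "\<And>u. \<bar>h u\<bar> \<le> B" and supp: "\<And>u. R < \<bar>u\<bar> \<Longrightarrow> h u = 0"
  shows "\<bar>(\<Sum>k=1..M. h (x k)) - integral {-R..R} h / \<Gamma>\<bar> \<le> (B * \<kappa> + 4 * L) * (4 * R + 5 * \<Gamma>)"
proof -
  have L0: "0 \<le> L" using lip[of 0 1] by simp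
  have B0: "0 \<le> B" using bd[of 0] by simp
  have \<kappa>\<Gamma>: "\<kappa> * \<Gamma>\<^sup>2 \<le> \<Gamma> / 2" using \<Gamma> mult_right_mono[OF \<Gamma>(2), of \<Gamma>] by (simp add: power2_eq_square mult.assoc)
  have g1: "\<Gamma> / 2 \<le> x (Suc k) - x k" "x (Suc k) - x k \<le> 2 * \<Gamma>" if "k \<le> M" for k
    using gap[OF that] \<kappa>\<Gamma> \<Gamma>(1) by (auto simp: abs_le_iff)
  have cont: "continuous_on S h" for S
    by (rule continuous_on_subset[OF lipschitz_on_continuous_on[of L UNIV]])
       (auto simp: lipschitz_on_def L0 dist_real_def lip)
  define a b where "a = x 0" and "b = x (Suc M)"
  have xmono: "x i \<le> x j" if "i \<le> j" "j \<le> Suc M" for i j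
  proof -
    have "0 \<le> x (Suc k) - x k" if "k < Suc M" for k using g1[of k] \<Gamma> that by simp
    from increasing_points_distance[of "Suc M" 0 x i j, OF this that] show ?thesis by simp
  qed
  have xab: "x k \<in> {a..b}" if "k \<le> Suc M" for k using that by (auto simp: a_def b_def intro: xmono)
  \<comment> \<open>The primitive starts at \<open>a - 1\<close>, so that it is differentiable from
    both sides on all of \<open>{a..b}\<close>.\<close>
  define H where "H y = integral {a - 1..y} h" for y
  have Hd: "(H has_real_derivative h y) (at y)" if "y \<in> {a..b}" for y
  proof -
    have "(H has_real_derivative h y) (at y within {a - 1..b + 1})"
      unfolding H_def using integral_has_real_derivative[OF cont, of y "a - 1" "b + 1"] that by simp
    then show ?thesis using that by (simp add: at_within_Icc_at)
  qed
  have "integral {a..b} h = integral {-R..R} h"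
    by (rule integral_spike_set)
       (use supp ends in \<open>auto simp: a_def b_def intro!: negligible_subset[OF negligible_empty]\<close>)
  moreover have "integral {a - 1..a} h + integral {a..b} h = integral {a - 1..b} h"
    using xab[of 0] by (intro Henstock_Kurzweil_Integration.integral_combine integrable_continuous_interval cont) (auto simp: a_def)
  ultimately have Hab: "H b - H a = integral {-R..R} h" by (simp add: H_def)
  \<comment> \<open>A step that starts left of \<open>- R\<close> can still reach the support; as
    steps are no longer than \<open>2 * \<Gamma>\<close>, extending the interval by that much to the
    left is enough.\<close>
  define J where "J = {k. k \<le> Suc M \<and> x k \<in> {-R - 2 * \<Gamma>..R}}"
  have finJ: "finite J" by (rule finite_subset[of _ "{..Suc M}"]) (auto simp: J_def)
  have cardJ: "real (card J) \<le> (2 * R + 2 * \<Gamma>) / (\<Gamma> / 2) + 1"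
    unfolding J_def
    using card_points_in_interval[of "Suc M" "\<Gamma>/2" x "- R - 2 * \<Gamma>" R] g1 \<Gamma> ends by auto
  \<comment> \<open>First summand: deviation of the step length from \<Gamma>. Second: variation of
    \<open>h\<close> over a step of length at most \<open>2 * \<Gamma>\<close>, times that
    length.\<close>
  define E where "E = B * \<kappa> * \<Gamma>\<^sup>2 + 4 * L * \<Gamma>\<^sup>2"
  have E0: "0 \<le> E" using B0 L0 \<Gamma> by (simp add: E_def)
  have step: "\<bar>h (x k) * \<Gamma> - (H (x (Suc k)) - H (x k))\<bar> \<le> (if k \<in> J then E else 0)" if k: "k \<le> M" for k
  proof -
    have lt: "x k < x (Suc k)" using g1[OF k] \<Gamma> by auto
    have "\<exists>z>x k. z < x (Suc k) \<and> H (x (Suc k)) - H (x k) = (x (Suc k) - x k) * h z"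
    proof (rule MVT2[OF lt])
      fix y assume y: "x k \<le> y" "y \<le> x (Suc k)"
      have yab: "y \<in> {a..b}" using y xab[of k] xab[of "Suc k"] k by auto
      show "(H has_real_derivative h y) (at y)" by (rule Hd[OF yab])
    qed
    then obtain z where z: "x k < z" "z < x (Suc k)" "H (x (Suc k)) - H (x k) = (x (Suc k) - x k) * h z" by auto
    show ?thesis
    proof (cases "k \<in> J")
      case True
      have "\<bar>h (x k) * \<Gamma> - (x (Suc k) - x k) * h z\<bar>
          = \<bar>h (x k) * (\<Gamma> - (x (Suc k) - x k)) + (x (Suc k) - x k) * (h (x k) - h z)\<bar>"
        by (simp add: algebra_simps)
      also have "\<dots> \<le> \<bar>h (x k)\<bar> * \<bar>\<Gamma> - (x (Suc k) - x k)\<bar> + \<bar>x (Suc k) - x k\<bar> * \<bar>h (x k) - h z\<bar>"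
        by (metis abs_mult abs_triangle_ineq)
      also have "\<dots> \<le> B * (\<kappa> * \<Gamma>\<^sup>2) + (2 * \<Gamma>) * (L * (2 * \<Gamma>))"
      proof (intro add_mono mult_mono bd)
        show "\<bar>\<Gamma> - (x (Suc k) - x k)\<bar> \<le> \<kappa> * \<Gamma>\<^sup>2" using gap[OF k] by (simp add: abs_minus_commute)
        show "\<bar>x (Suc k) - x k\<bar> \<le> 2 * \<Gamma>" using g1[OF k] \<Gamma> by simp
        have "\<bar>h (x k) - h z\<bar> \<le> L * \<bar>x k - z\<bar>" by (rule lip)
        also have "\<dots> \<le> L * (2 * \<Gamma>)" using z g1[OF k] L0 by (intro mult_left_mono) auto
        finally show "\<bar>h (x k) - h z\<bar> \<le> L * (2 * \<Gamma>)" .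
      qed (use B0 \<Gamma> in auto)
      also have "\<dots> = E" by (simp add: E_def power2_eq_square)
      finally show ?thesis using True z by simp
    next
      case False
      then have "x k < - R - 2 * \<Gamma> \<or> R < x k" using k by (auto simp: J_def)
      then have "R < \<bar>x k\<bar>" "R < \<bar>z\<bar>" using z g1[OF k] ends \<Gamma> by auto
      then show ?thesis using z supp False by simp
    qed
  qed
  have "(\<Sum>k\<le>M. H (x (Suc k)) - H (x k)) = H b - H a"
    unfolding a_def b_def lessThan_Suc_atMost[symmetric] by (rule sum_lessThan_telescope)
  then have "(\<Sum>k\<le>M. h (x k)) * \<Gamma> - integral {-R..R} h = (\<Sum>k\<le>M. h (x k) * \<Gamma> - (H (x (Suc k)) - H (x k)))"
    using Hab by (simp add: sum_subtractf sum_distrib_right)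
  also have "\<bar>\<dots>\<bar> \<le> (\<Sum>k\<le>M. if k \<in> J then E else 0)"
    by (rule order_trans[OF sum_abs sum_mono]) (use step in auto)
  also have "\<dots> = real (card ({..M} \<inter> J)) * E"
    by (simp add: sum.If_cases)
  also have "\<dots> \<le> real (card J) * E"
    using E0 finJ by (intro mult_right_mono) (auto intro!: card_mono)
  also have "\<dots> \<le> ((2 * R + 2 * \<Gamma>) / (\<Gamma> / 2) + 1) * E" using cardJ E0 by (rule mult_right_mono)
  also have "\<dots> = (B * \<kappa> + 4 * L) * (4 * R + 5 * \<Gamma>) * \<Gamma>"
    using \<Gamma> by (simp add: E_def field_simps power2_eq_square)
  finally have "\<bar>(\<Sum>k\<le>M. h (x k)) - integral {-R..R} h / \<Gamma>\<bar> * \<Gamma> \<le> (B * \<kappa> + 4 * L) * (4 * R + 5 * \<Gamma>) * \<Gamma>"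
    using \<Gamma> by (simp add: abs_mult_pos left_diff_distrib)
  then have "\<bar>(\<Sum>k\<le>M. h (x k)) - integral {-R..R} h / \<Gamma>\<bar> \<le> (B * \<kappa> + 4 * L) * (4 * R + 5 * \<Gamma>)"
    using \<Gamma> by simp
  moreover have "(\<Sum>k\<le>M. h (x k)) = h (x 0) + (\<Sum>k=1..M. h (x k))"
    by (simp add: atMost_atLeast0 sum.atLeast_Suc_atMost)
  moreover have "h (x 0) = 0" using supp ends by auto
  ultimately show ?thesis by simp
qed

section \<open>Minimizers of weighted absolute deviations\<close>

lemma weighted_median_le:
  fixes w y :: "'i \<Rightarrow> real"
  assumes "is_arg_min (\<lambda>\<theta>. \<Sum>p\<in>I. \<bar>y p - \<theta>\<bar> * w p) (\<lambda>_. True) \<theta>'"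
    and w: "\<And>p. p \<in> I \<Longrightarrow> 0 \<le> w p" and pos: "0 < (\<Sum>p\<in>I. (of_bool (y p \<le> \<theta>) - 1/2) * w p)"
  shows "\<theta>' \<le> \<theta>"
proof (rule ccontr)
  assume "\<not> \<theta>' \<le> \<theta>"
  then have lt: "\<theta> < \<theta>'" by simp
  have "0 < 2 * (\<theta>' - \<theta>) * (\<Sum>p\<in>I. (of_bool (y p \<le> \<theta>) - 1/2) * w p)" using lt pos by simp
  also have "\<dots> = (\<Sum>p\<in>I. 2 * (\<theta>' - \<theta>) * (of_bool (y p \<le> \<theta>) - 1/2) * w p)"
    by (simp add: sum_distrib_left mult.assoc)
  \<comment> \<open>\<open>2 * (of_bool (y p \<le> \<theta>) - 1/2)\<close> is a subgradient at
    \<theta> of the convex function \<open>\<lambda>\<theta>. \<bar>y p - \<theta>\<bar>\<close>, so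
    this is the subgradient inequality in each summand. It makes \<theta> strictly better than
    \<theta>'.\<close>
  also have "\<dots> \<le> (\<Sum>p\<in>I. (\<bar>y p - \<theta>'\<bar> - \<bar>y p - \<theta>\<bar>) * w p)"
    by (intro sum_mono mult_right_mono w) (use lt in \<open>auto simp: abs_if field_simps\<close>)
  finally have "(\<Sum>p\<in>I. \<bar>y p - \<theta>\<bar> * w p) < (\<Sum>p\<in>I. \<bar>y p - \<theta>'\<bar> * w p)"
    by (simp add: left_diff_distrib sum_subtractf)
  with assms(1) show False by (auto simp: is_arg_min_def)
qed

text \<open>The same subgradient inequality, now to the left of \<theta>. At a tie
  \<open>y p = \<theta>\<close> the value 1 is still a subgradient, so one and the same indicator
  serves both directions.\<close>

lemma weighted_median_ge:
  fixes w y :: "'i \<Rightarrow> real"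
  assumes "is_arg_min (\<lambda>\<theta>. \<Sum>p\<in>I. \<bar>y p - \<theta>\<bar> * w p) (\<lambda>_. True) \<theta>'"
    and w: "\<And>p. p \<in> I \<Longrightarrow> 0 \<le> w p" and neg: "(\<Sum>p\<in>I. (of_bool (y p \<le> \<theta>) - 1/2) * w p) < 0"
  shows "\<theta> \<le> \<theta>'"
proof (rule ccontr)
  assume "\<not> \<theta> \<le> \<theta>'"
  then have lt: "\<theta>' < \<theta>" by simp
  have "0 < 2 * (\<theta>' - \<theta>) * (\<Sum>p\<in>I. (of_bool (y p \<le> \<theta>) - 1/2) * w p)"
    using lt neg by (simp add: mult_neg_neg)
  also have "\<dots> = (\<Sum>p\<in>I. 2 * (\<theta>' - \<theta>) * (of_bool (y p \<le> \<theta>) - 1/2) * w p)"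
    by (simp add: sum_distrib_left mult.assoc)
  also have "\<dots> \<le> (\<Sum>p\<in>I. (\<bar>y p - \<theta>'\<bar> - \<bar>y p - \<theta>\<bar>) * w p)"
    by (intro sum_mono mult_right_mono w) (use lt in \<open>auto simp: abs_if field_simps\<close>)
  finally have "(\<Sum>p\<in>I. \<bar>y p - \<theta>\<bar> * w p) < (\<Sum>p\<in>I. \<bar>y p - \<theta>'\<bar> * w p)"
    by (simp add: left_diff_distrib sum_subtractf)
  with assms(1) show False by (auto simp: is_arg_min_def)
qed

section \<open>Expansion of the smoothed distribution function\<close>

text \<open>Agreement on \<open>V\<close> passes to derivatives because an open \<open>V\<close> is
  a neighbourhood of each of its points.\<close>

lemma unif_diff_cong:
  assumes "unif_diff r T V \<phi>" and "open V" and eq: "\<And>t v. t \<in> T \<Longrightarrow> v \<in> V \<Longrightarrow> \<phi> t v = \<psi> t v"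
  shows "unif_diff r T V \<psi>"
proof (cases r)
  case 0
  then show ?thesis using assms by auto
next
  case (Suc k)
  with assms(1) obtain \<phi>' where 1: "\<And>t v. t \<in> T \<Longrightarrow> v \<in> V \<Longrightarrow> (\<phi> t has_real_derivative \<phi>' t v) (at v)"
    and 2: "unif_diff k T V \<phi>'" unfolding Suc unif_diff.simps by blast
  have "\<exists>C. \<forall>t\<in>T. \<forall>v\<in>V. \<bar>\<psi> t v\<bar> \<le> C" using unif_diff_bounded[OF assms(1)] eq by auto
  moreover have "(\<psi> t has_real_derivative \<phi>' t v) (at v)" if "t \<in> T" "v \<in> V" for t v
    using 1[OF that] assms(2) that(2) by (rule has_field_derivative_transform_within_open) (use eq that in auto)
  ultimately show ?thesis unfolding Suc by (rule unif_diff_SucI[OF 2])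
qed

text \<open>If \<open>t\<close> keeps the distance \<open>d\<close> from both ends, then
  \<open>t + v\<close> with \<open>\<bar>v\<bar> < d\<close> is an interior point, and the one-sided
  derivatives on \<open>{a..b}\<close> become two-sided. The induction runs down the derivatives:
  order \<open>k\<close> is proved for \<open>D (r - k)\<close>.\<close>

lemma unif_diff_shift:
  assumes "bounded_derivs r {a..b} g" "0 < d"
  shows "unif_diff r {a + d..b - d} {-d<..<d} (\<lambda>t v. g (t + v))"
proof -
  from assms(1) obtain D where D0: "\<And>x. x \<in> {a..b} \<Longrightarrow> D 0 x = g x"
    and D: "\<And>k x. k < r \<Longrightarrow> x \<in> {a..b} \<Longrightarrow> (D k has_real_derivative D (Suc k) x) (at x within {a..b})"
    and bd: "\<And>k. k \<le> r \<Longrightarrow> bounded (D k ` {a..b})"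
    unfolding bounded_derivs_def by blast
  have bd': "\<exists>C. \<forall>t\<in>{a + d..b - d}. \<forall>v\<in>{-d<..<d}. \<bar>D k (t + v)\<bar> \<le> C" if k: "k \<le> r" for k
  proof -
    from bd[OF k] obtain C where C: "\<And>x. x \<in> {a..b} \<Longrightarrow> \<bar>D k x\<bar> \<le> C" by (metis bounded_real imageI)
    show ?thesis by (intro exI[of _ C] ballI C) auto
  qed
  have "unif_diff k {a + d..b - d} {-d<..<d} (\<lambda>t v. D (r - k) (t + v))" if "k \<le> r" for k
    using that
  proof (induction k)
    case 0
    then show ?case using bd'[of r] by simp
  next
    case (Suc k)
    show ?case
    proof (rule unif_diff_SucI)
      show "unif_diff k {a + d..b - d} {-d<..<d} (\<lambda>t v. D (Suc (r - Suc k)) (t + v))"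
        using Suc by (simp add: Suc_diff_Suc)
      show "\<exists>C. \<forall>t\<in>{a + d..b - d}. \<forall>v\<in>{-d<..<d}. \<bar>D (r - Suc k) (t + v)\<bar> \<le> C" by (rule bd') simp
      fix t v assume tv: "t \<in> {a + d..b - d}" "v \<in> {-d<..<d}"
      then have in_ab: "t + v \<in> {a<..<b}" by auto
      then have "(D (r - Suc k) has_real_derivative D (Suc (r - Suc k)) (t + v)) (at (t + v))"
        using D[of "r - Suc k" "t + v"] Suc.prems by (simp add: at_within_Icc_at)
      then show "((\<lambda>v. D (r - Suc k) (t + v)) has_real_derivative D (Suc (r - Suc k)) (t + v)) (at v)"
        by (simp add: DERIV_shift add.commute[of t])
    qed
  qed
  from this[of r] have "unif_diff r {a + d..b - d} {-d<..<d} (\<lambda>t v. D 0 (t + v))" by simp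
  then show ?thesis by (rule unif_diff_cong) (auto intro: D0)
qed

text \<open>Links the anonymous derivative sequence inside \<open>bounded_derivs\<close> to
  \<open>deriv\<close>, in terms of which \<open>rho_mu\<close> is written.\<close>

lemma bounded_derivs_interior:
  assumes "bounded_derivs r {a..b} g" "2 \<le> r" "x \<in> {a<..<b}"
  shows "(g has_real_derivative deriv g x) (at x)"
    and "(deriv g has_real_derivative deriv (deriv g) x) (at x)"
proof -
  from assms(1) obtain D where D0: "\<And>x. x \<in> {a..b} \<Longrightarrow> D 0 x = g x"
    and D: "\<And>k x. k < r \<Longrightarrow> x \<in> {a..b} \<Longrightarrow> (D k has_real_derivative D (Suc k) x) (at x within {a..b})"
    unfolding bounded_derivs_def by blast
  have D': "(D k has_real_derivative D (Suc k) z) (at z)" if "k < 2" "z \<in> {a<..<b}" for k z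
    using D[of k z] that assms(2) by (simp add: at_within_Icc_at)
  have g: "(g has_real_derivative D 1 z) (at z)" if "z \<in> {a<..<b}" for z
  proof (rule has_field_derivative_transform_within_open[of "D 0" _ z "{a<..<b}"])
    show "(D 0 has_real_derivative D 1 z) (at z)" using D'[of 0 z] that by simp
  qed (use that D0 in auto)
  from g[OF assms(3)] DERIV_imp_deriv[OF g[OF assms(3)]]
  show "(g has_real_derivative deriv g x) (at x)" by simp
  have "deriv g z = D 1 z" if "z \<in> {a<..<b}" for z using g[OF that] by (rule DERIV_imp_deriv)
  note dg = this
  have D2: "(deriv g has_real_derivative D 2 x) (at x)"
  proof (rule has_field_derivative_transform_within_open[where f="D 1" and S="{a<..<b}"])
    show "(D 1 has_real_derivative D 2 x) (at x)" using D'[of 1 x] assms(3) by (simp add: numeral_2_eq_2)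
  qed (use assms(3) dg in auto)
  from D2 DERIV_imp_deriv[OF D2] show "(deriv g has_real_derivative deriv (deriv g) x) (at x)" by simp
qed

lemma bounded_derivs_lipschitz:
  assumes "bounded_derivs r {a..b} g" "1 \<le> r"
  obtains B where "0 \<le> B" "\<And>x. x \<in> {a..b} \<Longrightarrow> \<bar>g x\<bar> \<le> B"
    "\<And>x y. x \<in> {a..b} \<Longrightarrow> y \<in> {a..b} \<Longrightarrow> \<bar>g x - g y\<bar> \<le> B * \<bar>x - y\<bar>"
proof -
  obtain D :: "nat \<Rightarrow> real \<Rightarrow> real" where D0: "\<And>x. x \<in> {a..b} \<Longrightarrow> D 0 x = g x"
    and D: "\<And>x. x \<in> {a..b} \<Longrightarrow> (D 0 has_real_derivative D 1 x) (at x within {a..b})"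
    and bd: "bounded (D 0 ` {a..b})" "bounded (D 1 ` {a..b})"
  proof -
    from assms(1) obtain D where D: "\<forall>x\<in>{a..b}. D 0 x = g x"
      "\<forall>k<r. \<forall>x\<in>{a..b}. (D k has_real_derivative D (Suc k) x) (at x within {a..b})"
      "\<forall>k\<le>r. bounded (D k ` {a..b})"
      unfolding bounded_derivs_def by blast
    show thesis using D assms(2) by (intro that[of D]) auto
  qed
  obtain B0 where B0: "\<And>x. x \<in> {a..b} \<Longrightarrow> \<bar>D 0 x\<bar> \<le> B0"
    using bd(1) by (metis bounded_real imageI)
  obtain B1 where B1: "\<And>x. x \<in> {a..b} \<Longrightarrow> \<bar>D 1 x\<bar> \<le> B1"
    using bd(2) by (metis bounded_real imageI)
  note B = B0 B1
  define B where "B = max 0 (max B0 B1)"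
  show thesis
  proof (rule that[of B])
    show "\<bar>g x\<bar> \<le> B" if "x \<in> {a..b}" for x using B(1)[OF that] D0[OF that] by (simp add: B_def)
    show "\<bar>g x - g y\<bar> \<le> B * \<bar>x - y\<bar>" if "x \<in> {a..b}" "y \<in> {a..b}" for x y
    proof -
      have "norm (D 0 x - D 0 y) \<le> B * norm (x - y)"
        by (rule field_differentiable_bound[OF _ D]) (use that B(2) in \<open>auto simp: B_def le_max_iff_disj\<close>)
      then show ?thesis using D0 that by simp
    qed
  qed (simp add: B_def)
qed

lemma bounded_derivs_continuous_on: "bounded_derivs r {a..b} g \<Longrightarrow> 1 \<le> r \<Longrightarrow> continuous_on {a..b} g"
  by (erule (1) bounded_derivs_lipschitz, rule lipschitz_on_continuous_on) (auto simp: lipschitz_on_def dist_real_def)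

lemma taylor_1_bound:
  fixes F f :: "real \<Rightarrow> real"
  assumes F: "\<And>u. (F has_real_derivative f u) (at u)" and f: "\<And>u. (f has_real_derivative f' u) (at u)"
    and B: "\<And>u. \<bar>f' u\<bar> \<le> B"
  shows "\<bar>F (y + h) - F y - f y * h\<bar> \<le> B * h\<^sup>2"
proof -
  define D where "D k = (if k = 0 then (\<lambda>h. F (y + h)) else if k = 1 then (\<lambda>h. f (y + h)) else (\<lambda>h. f' (y + h)))" for k :: nat
  have "\<forall>k h. k < 2 \<and> \<bar>h\<bar> \<le> \<bar>h\<bar> \<longrightarrow> DERIV (D k) h :> D (Suc k) h"
    using F f by (auto simp: D_def less_Suc_eq numeral_2_eq_2 add.commute[of y] simp flip: DERIV_shift)
  then obtain z where "F (y + h) = (\<Sum>k<2. D k 0 / fact k * h ^ k) + D 2 z / fact 2 * h\<^sup>2"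
    using Maclaurin_bi_le[of D "\<lambda>h. F (y + h)" 2 h] by (auto simp: D_def)
  then have "F (y + h) - F y - f y * h = f' (y + z) / 2 * h\<^sup>2"
    by (simp add: D_def eval_nat_numeral)
  then have eq: "\<bar>F (y + h) - F y - f y * h\<bar> = \<bar>f' (y + z)\<bar> * h\<^sup>2 / 2" by (simp only: abs_mult abs_divide) simp
  have "\<bar>f' (y + z)\<bar> * h\<^sup>2 \<le> B * h\<^sup>2" using B by (intro mult_right_mono) auto
  moreover have "0 \<le> \<bar>f' (y + z)\<bar> * h\<^sup>2" by simp
  ultimately show ?thesis using eq by linarith
qed

text \<open>A single \<open>B\<close> serves as bound and as Lipschitz constant of the kernel. The
  integrals are moved from the line to \<open>{-R..R}\<close>, where the gauge integral replaces the
  Lebesgue integral from here on.\<close>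

lemma kernel_facts:
  assumes "cond_K K"
  obtains R B where "0 < R" "0 < B" "\<And>u. 0 \<le> K u" "\<And>u. K (- u) = K u" "\<And>u. K u \<le> B"
    "\<And>u v. \<bar>K u - K v\<bar> \<le> B * \<bar>u - v\<bar>" "\<And>u. R < \<bar>u\<bar> \<Longrightarrow> K u = 0"
    "integral {-R..R} K = 1" "integral {-R..R} (\<lambda>u. K u * u\<^sup>2) = 2 * psi_K K"
proof -
  have K0: "\<And>u. 0 \<le> K u" and sym: "\<And>u. K (- u) = K u" and int: "integrable lborel K" "(\<integral>u. K u \<partial>lborel) = 1"
    and bs: "bounded {u. K u \<noteq> 0}" and diff: "\<And>u. K differentiable (at u)" and bd: "bounded (range (deriv K))"
    using assms by (auto simp: cond_K_def)
  from bs obtain R0 where R0: "0 < R0" "\<And>u. K u \<noteq> 0 \<Longrightarrow> \<bar>u\<bar> \<le> R0"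
    unfolding bounded_pos by auto
  from bd obtain B0 where B0: "0 < B0" "\<And>u. \<bar>deriv K u\<bar> \<le> B0" unfolding bounded_pos by auto
  have der: "(K has_real_derivative deriv K u) (at u)" for u
    using diff[of u] by (simp add: DERIV_deriv_iff_real_differentiable)
  have lip: "\<bar>K u - K v\<bar> \<le> B0 * \<bar>u - v\<bar>" for u v
    using field_differentiable_bound[of UNIV K "deriv K" B0 u v] der B0(2) by auto
  have zero: "K u = 0" if "R0 < \<bar>u\<bar>" for u using R0(2)[of u] that by fastforce
  \<comment> \<open>Boundedness comes from the Lipschitz property and the zero at
    \<open>R0 + 1\<close>, whose distance from any point of the support is at most
    \<open>2 * R0 + 1\<close>.\<close>
  have Kb: "K u \<le> B0 * (2 * R0 + 1)" for u
  proof (cases "K u = 0")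
    case False
    have "K u = \<bar>K u - K (R0 + 1)\<bar>" using zero[of "R0 + 1"] R0(1) K0[of u] by simp
    also have "\<dots> \<le> B0 * \<bar>u - (R0 + 1)\<bar>" by (rule lip)
    also have "\<dots> \<le> B0 * (2 * R0 + 1)" using R0(2)[OF False] B0(1) by (intro mult_left_mono) auto
    finally show ?thesis .
  qed (use B0 R0 in auto)
  have cont: "continuous_on S K" for S
    using der by (meson DERIV_isCont continuous_at_imp_continuous_on)
  have leb: "integral {-R0..R0} g = (\<integral>u. g u \<partial>lborel)" if "continuous_on {-R0..R0} g" "\<And>u. R0 < \<bar>u\<bar> \<Longrightarrow> g u = 0" for g :: "real \<Rightarrow> real"
  proof -
    have eq: "(\<lambda>u. indicator {-R0..R0} u *\<^sub>R g u) = g"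
    proof
      fix u show "indicator {-R0..R0} u *\<^sub>R g u = g u"
        using that(2)[of u] by (cases "R0 < \<bar>u\<bar>") (auto simp: indicator_def)
    qed
    have i: "set_integrable lborel {-R0..R0} g" by (rule borel_integrable_atLeastAtMost') (rule that)
    from set_borel_integral_eq_integral(2)[OF i] show ?thesis
      unfolding set_lebesgue_integral_def eq by simp
  qed
  show thesis
  proof (rule that[of R0 "B0 * (2 * R0 + 1)"])
    show "\<bar>K u - K v\<bar> \<le> B0 * (2 * R0 + 1) * \<bar>u - v\<bar>" for u v
      by (rule order_trans[OF lip[of u v] mult_right_mono]) (use R0(1) B0(1) in auto)
    show "integral {-R0..R0} K = 1" using leb[of K] cont zero int by simp
    show "integral {-R0..R0} (\<lambda>u. K u * u\<^sup>2) = 2 * psi_K K"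
      unfolding psi_K_def by (subst leb) (auto intro!: continuous_intros cont simp: zero mult.commute)
  qed (use K0 sym R0 B0 Kb zero in auto)
qed

lemma integral_odd:
  fixes g :: "real \<Rightarrow> real"
  assumes "\<And>u. g (- u) = - g u"
  shows "integral {-R..R} g = 0"
  using Henstock_Kurzweil_Integration.integral_reflect_real[of R "-R" g] assms by simp

text \<open>The symmetry of the kernel removes the terms of odd order in the bandwidth.\<close>

lemma smoothed_level_expansion:
  fixes \<mu> s F f K :: "real \<Rightarrow> real"
  assumes K: "\<And>u. 0 \<le> K u" "\<And>u. K (- u) = K u" "continuous_on UNIV K"
      "integral {-R..R} K = 1" "integral {-R..R} (\<lambda>u. K u * u\<^sup>2) = 2 * psi_K K"
    and S: "cond_S a b \<mu> s f" and F: "\<And>u. (F has_real_derivative f u) (at u)"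
    and F01: "\<And>u. 0 \<le> F u" "\<And>u. F u \<le> 1" and F0: "F 0 = 1/2" and d: "0 < d" and R: "0 < R"
  obtains C where "0 \<le> C" "\<And>t \<beta> \<Delta>. t \<in> {a + d..b - d} \<Longrightarrow> 0 < \<beta> \<Longrightarrow> R * \<beta> < d \<Longrightarrow>
    \<bar>integral {-R..R} (\<lambda>u. K u * (F ((\<mu> t + \<Delta> - \<mu> (t + \<beta> * u)) / s (t + \<beta> * u)) - 1/2))
      - f 0 / s t * (\<Delta> - psi_K K * rho_mu \<mu> s f t * \<beta>\<^sup>2)\<bar> \<le> C * (\<beta> ^ 4 + \<bar>\<Delta>\<bar> * \<beta>\<^sup>2 + \<Delta>\<^sup>2)"
proof -
  define T V where "T = {a + d..b - d}" and "V = {-d<..<d}"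
  have b\<mu>: "bounded_derivs 4 {a..b} \<mu>" and bs: "bounded_derivs 4 {a..b} s" and inf: "(INF x\<in>{a..b}. s x) > 0"
    and bf: "bounded_derivs 4 UNIV f" and f0: "0 < f 0" using S by (auto simp: cond_S_def)
  define s0 where "s0 = (INF x\<in>{a..b}. s x)"
  have s0: "0 < s0" using inf by (simp add: s0_def)
  have s_ge: "s0 \<le> s x" if "x \<in> {a..b}" for x
  proof -
    from bounded_derivs_lipschitz[OF bs] obtain B where "\<And>x. x \<in> {a..b} \<Longrightarrow> \<bar>s x\<bar> \<le> B"
      by (metis one_le_numeral)
    then have "bdd_below (s ` {a..b})" by (intro bdd_belowI2[of _ "-B"]) (meson abs_le_D2 minus_le_iff)
    then show ?thesis unfolding s0_def using that by (intro cINF_lower)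
  qed
  have tv: "t + v \<in> {a<..<b}" if "t \<in> T" "v \<in> V" for t v using that by (auto simp: T_def V_def)
  from bf obtain D where D0: "\<And>x. D 0 x = f x"
    and D: "\<And>k x. k < 4 \<Longrightarrow> (D k has_real_derivative D (Suc k) x) (at x)"
    and bd: "\<And>k. k \<le> 4 \<Longrightarrow> bounded (range (D k))"
    unfolding bounded_derivs_def by auto
  have D0': "D 0 = f" using D0 by auto
  have uf: "unif_diff 4 UNIV UNIV (\<lambda>_::unit. f)"
  proof -
    have "unif_diff k UNIV UNIV (\<lambda>_::unit. D (4 - k))" if "k \<le> 4" for k
      using that
    proof (induction k)
      case 0
      then show ?case using bd[of 4] by (auto simp: bounded_iff)
    next
      case (Suc k)
      show ?case
      proof (rule unif_diff_SucI)
        have "Suc (4 - Suc k) = 4 - k" using Suc.prems by simp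
        then show "unif_diff k UNIV UNIV (\<lambda>_::unit. D (Suc (4 - Suc k)))"
          using Suc by simp
        show "\<exists>C. \<forall>t\<in>UNIV. \<forall>v\<in>UNIV. \<bar>D (4 - Suc k) v\<bar> \<le> C"
          using bd[of "4 - Suc k"] by (auto simp: bounded_iff)
        show "(D (4 - Suc k) has_real_derivative D (Suc (4 - Suc k)) v) (at v)" for v
          using D[of "4 - Suc k"] Suc.prems by simp
      qed
    qed
    from this[of 4] show ?thesis by (simp add: D0')
  qed
  have "\<exists>C. \<forall>t\<in>UNIV. \<forall>v\<in>UNIV. \<bar>F v\<bar> \<le> C" using F01 by (auto intro!: exI[of _ 1] simp: abs_le_iff intro: order_trans[of _ 0])
  then have uF: "unif_diff 4 UNIV UNIV (\<lambda>_::unit. F)"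
    using unif_diff_SucI[OF uf, where \<phi>="\<lambda>_. F"] F unif_diff_Suc_imp[where r=4] by auto
  have df: "(f has_real_derivative D 1 u) (at u)" for u using D[of 0] by (simp add: D0')
  have df0: "deriv f 0 = D 1 0" using df by (rule DERIV_imp_deriv)
  obtain B1 where B1: "\<And>u. \<bar>D 1 u\<bar> \<le> B1" using bd[of 1] by (auto simp: bounded_iff)
  \<comment> \<open>The standardized level \<open>(\<mu> t - \<mu> (t + v)) / s (t + v)\<close> is
    written as a product so that the closure rules apply; the offset \<Delta> adds
    \<open>r t v * \<Delta>\<close> to it.\<close>
  define m r where "m t v = \<mu> t - \<mu> (t + v)" and "r t v = inverse (s (t + v))" for t v
  have um: "unif_diff 4 T V m"
  proof -
    from bounded_derivs_lipschitz[OF b\<mu>] obtain B where B: "\<And>x. x \<in> {a..b} \<Longrightarrow> \<bar>\<mu> x\<bar> \<le> B"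
      by (metis one_le_numeral)
    have "unif_diff 4 T V (\<lambda>t v. \<mu> t + - \<mu> (t + v))"
      by (intro unif_diff_add unif_diff_uminus unif_diff_const[where C=B])
         (use B d unif_diff_shift[OF b\<mu> d] in \<open>auto simp: T_def V_def\<close>)
    then show ?thesis by (simp add: m_def[abs_def])
  qed
  have ur: "unif_diff 4 T V r"
    unfolding r_def[abs_def]
  proof (rule unif_diff_inverse[OF _ s0])
    show "unif_diff 4 T V (\<lambda>t v. s (t + v))" unfolding T_def V_def by (rule unif_diff_shift[OF bs d])
    show "s0 \<le> s (t + v)" if "t \<in> T" "v \<in> V" for t v using tv[OF that] by (intro s_ge) auto
  qed
  define g where "g t v = m t v * r t v" for t v
  have ug: "unif_diff 4 T V g" unfolding g_def[abs_def] by (rule unif_diff_mult[OF um ur])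
  have uFg: "unif_diff 4 T {-d<..<d} (\<lambda>t v. F (g t v))" using unif_diff_compose[OF uF ug] by (simp add: V_def)
  have ufr: "unif_diff 2 T {-d<..<d} (\<lambda>t v. f (g t v) * r t v)"
    using unif_diff_mult[OF unif_diff_compose[OF uf ug] ur] unfolding V_def by (rule unif_diff_mono) simp
  define g1 where "g1 t v = - deriv \<mu> (t + v) * r t v + m t v * (- deriv s (t + v) * (r t v)\<^sup>2)" for t v
  have dm: "(m t has_real_derivative - deriv \<mu> (t + v)) (at v)" if "t \<in> T" "v \<in> V" for t v
    using bounded_derivs_interior(1)[OF b\<mu> _ tv[OF that]]
    unfolding m_def[abs_def] by (auto intro!: derivative_eq_intros simp: DERIV_shift add.commute[of t])
  have dr: "(r t has_real_derivative - deriv s (t + v) * (r t v)\<^sup>2) (at v)" if "t \<in> T" "v \<in> V" for t v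
  proof -
    have "((\<lambda>v. s (t + v)) has_real_derivative deriv s (t + v)) (at v)"
      using bounded_derivs_interior(1)[OF bs _ tv[OF that]] by (simp add: DERIV_shift add.commute[of t])
    moreover have "s (t + v) \<noteq> 0" using s_ge[of "t + v"] tv[OF that] s0 by auto
    ultimately show ?thesis
      unfolding r_def[abs_def] by (auto intro!: derivative_eq_intros simp: power2_eq_square)
  qed
  have dg: "(g t has_real_derivative g1 t v) (at v)" if "t \<in> T" "v \<in> V" for t v
    unfolding g_def[abs_def] g1_def using dm[OF that] dr[OF that]
    by (auto intro!: derivative_eq_intros simp: algebra_simps)
  have V0: "0 \<in> V" using d by (simp add: V_def)
  have m0: "m t 0 = 0" for t by (simp add: m_def)
  have g0: "g t 0 = 0" for t by (simp add: g_def m0)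
  define g2 where "g2 t = - deriv (deriv \<mu>) t * r t 0 + 2 * deriv \<mu> t * deriv s t * (r t 0)\<^sup>2" for t
  have dg1: "(g1 t has_real_derivative g2 t) (at 0)" if t: "t \<in> T" for t
  proof -
    have "((\<lambda>v. deriv \<mu> (t + v)) has_real_derivative deriv (deriv \<mu>) t) (at 0)"
         "((\<lambda>v. deriv s (t + v)) has_real_derivative deriv (deriv s) t) (at 0)"
      using bounded_derivs_interior(2)[OF b\<mu> _ tv[OF t V0]] bounded_derivs_interior(2)[OF bs _ tv[OF t V0]]
      by (simp_all add: add.commute[of t] DERIV_shift[symmetric])
    note [derivative_intros] = this and this2 = dm[OF t V0] dr[OF t V0]
    show ?thesis
      unfolding g1_def[abs_def] g2_def
      by (rule derivative_eq_intros this2 refl)+ (simp add: m0 power2_eq_square algebra_simps)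
  qed
  \<comment> \<open>The second derivative of \<open>F (g t v)\<close> in \<open>v\<close> at 0. Its
    explicit value, computed below, is \<open>- (f 0 / s t) * rho_mu \<mu> s f t\<close>; this is
    where the bias function originates.\<close>
  define c2 where "c2 t = D 1 0 * (g1 t 0)\<^sup>2 + f 0 * g2 t" for t
  have d1: "((\<lambda>v. F (g t v)) has_real_derivative f (g t v) * g1 t v) (at v)" if "t \<in> T" "v \<in> V" for t v
    by (rule DERIV_chain2[OF F dg[OF that]])
  have d2: "((\<lambda>v. f (g t v) * g1 t v) has_real_derivative c2 t) (at 0)" if "t \<in> T" for t
  proof -
    have "((\<lambda>v. f (g t v)) has_real_derivative D 1 (g t 0) * g1 t 0) (at 0)"
      by (rule DERIV_chain2[OF df dg[OF that V0]])
    from DERIV_mult[OF this dg1[OF that]] show ?thesis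
      by (simp add: c2_def g0 power2_eq_square algebra_simps)
  qed
  have c2: "c2 t = - (f 0 / s t) * rho_mu \<mu> s f t" if "t \<in> T" for t
  proof -
    have "s t \<noteq> 0" using s_ge[of t] tv[OF that V0] s0 by auto
    then show ?thesis using f0
      by (simp add: c2_def g1_def g2_def rho_mu_def m0 r_def df0 field_simps power2_eq_square)
  qed
  have d1': "((\<lambda>v. F (g t v)) has_real_derivative f (g t v) * g1 t v) (at v)" if "t \<in> T" "\<bar>v\<bar> < d" for t v
    using that by (intro d1) (auto simp: V_def abs_less_iff)
  obtain C4 c3 where C4: "\<And>t v. t \<in> T \<Longrightarrow> \<bar>v\<bar> < d \<Longrightarrow>
     \<bar>F (g t v) - (F (g t 0) + f (g t 0) * g1 t 0 * v + c2 t / 2 * v ^ 2 + c3 t * v ^ 3)\<bar> \<le> C4 * v ^ 4"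
  proof (rule unif_diff_4_expansion[OF uFg d])
    fix C c3 assume "\<And>t v. t \<in> T \<Longrightarrow> \<bar>v\<bar> < d \<Longrightarrow>
       \<bar>F (g t v) - (F (g t 0) + f (g t 0) * g1 t 0 * v + c2 t / 2 * v ^ 2 + c3 t * v ^ 3)\<bar> \<le> C * v ^ 4"
    then show thesis by (rule that)
  qed (erule (1) d1', erule d2)
  obtain C2 c1 where C2: "\<And>t v. t \<in> T \<Longrightarrow> \<bar>v\<bar> < d \<Longrightarrow>
     \<bar>f (g t v) * r t v - (f (g t 0) * r t 0 + c1 t * v)\<bar> \<le> C2 * v ^ 2"
  proof (rule unif_diff_2_expansion[OF ufr d])
    fix C c1 assume "\<And>t v. t \<in> T \<Longrightarrow> \<bar>v\<bar> < d \<Longrightarrow>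
       \<bar>f (g t v) * r t v - (f (g t 0) * r t 0 + c1 t * v)\<bar> \<le> C * v ^ 2"
    then show thesis by (rule that)
  qed
  \<comment> \<open>One entry for each remainder: \<open>C4\<close> for the fourth-order Taylor
    remainder in the point, \<open>C2\<close> for the mixed term linear in \<Delta>, and
    \<open>B1 / s0\<^sup>2\<close> for the quadratic term in \<Delta>.\<close>
  define C where "C = max 0 (max (C4 * R ^ 4) (max (C2 * R\<^sup>2) (B1 / s0\<^sup>2)))"
  show thesis
  proof (rule that[of C])
    show "0 \<le> C" by (simp add: C_def)
    fix t \<beta> \<Delta> :: real
    assume "t \<in> {a + d..b - d}" and \<beta>: "0 < \<beta>" "R * \<beta> < d"
    then have t: "t \<in> T" by (simp add: T_def)
    have v: "\<bar>\<beta> * u\<bar> < d" if "u \<in> {-R..R}" for u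
    proof -
      have "\<bar>\<beta> * u\<bar> \<le> \<beta> * R" using that \<beta> by (auto simp: abs_mult intro!: mult_left_mono)
      then show ?thesis using \<beta> by (simp add: mult.commute)
    qed
    have vV: "\<beta> * u \<in> V" if "u \<in> {-R..R}" for u using v[OF that] by (auto simp: V_def abs_less_iff)
    \<comment> \<open>The polynomial part of \<open>H\<close>, sorted by parity in \<open>u\<close>:
      the even bracket produces the main term through the second moment of \<open>K\<close>, and the
      odd remainder integrates to zero.\<close>
    define P where "P u = (f 0 / s t * \<Delta> + c2 t / 2 * \<beta>\<^sup>2 * u\<^sup>2) + (f 0 * g1 t 0 * \<beta> + \<Delta> * c1 t * \<beta>) * u + c3 t * \<beta> ^ 3 * u ^ 3" for u
    define H where "H u = F ((\<mu> t + \<Delta> - \<mu> (t + \<beta> * u)) / s (t + \<beta> * u)) - 1/2" for u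
    have HP: "\<bar>H u - P u\<bar> \<le> C * (\<beta> ^ 4 + \<bar>\<Delta>\<bar> * \<beta>\<^sup>2 + \<Delta>\<^sup>2)" if u: "u \<in> {-R..R}" for u
    proof -
      define w where "w = \<beta> * u"
      have w: "\<bar>w\<bar> < d" "w \<in> V" using v[OF u] vV[OF u] by (auto simp: w_def)
      have uR: "\<bar>u\<bar> \<le> R" using u by auto
      have Hw: "H u = F (g t w + r t w * \<Delta>) - 1/2"
      proof -
        have "(A + \<Delta> - B) / S = (A - B) * inverse S + inverse S * \<Delta>" for A B S :: real
          by (simp add: divide_inverse algebra_simps)
        then show ?thesis unfolding H_def g_def m_def r_def w_def by simp
      qed
      have Pw: "P u = f 0 / s t * \<Delta> + f 0 * g1 t 0 * w + c2 t / 2 * w\<^sup>2 + c3 t * w ^ 3 + \<Delta> * c1 t * w"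
        by (simp add: P_def w_def power_mult_distrib algebra_simps)
      \<comment> \<open>Three separate errors: linearizing \<open>F\<close> in \<Delta>, expanding
        in the point at offset 0, and expanding the coefficient of \<Delta> in the point.\<close>
      define X where "X = F (g t w + r t w * \<Delta>) - F (g t w) - f (g t w) * (r t w * \<Delta>)"
      define Y where "Y = F (g t w) - (F (g t 0) + f (g t 0) * g1 t 0 * w + c2 t / 2 * w ^ 2 + c3 t * w ^ 3)"
      define Z where "Z = f (g t w) * r t w - (f (g t 0) * r t 0 + c1 t * w)"
      have "H u - P u = X + Y + \<Delta> * Z"
      proof -
        have r0: "f 0 / s t = f 0 * r t 0" by (simp add: r_def divide_inverse)
        show ?thesis unfolding Hw Pw X_def Y_def Z_def r0 g0 F0 by algebra
      qed
      moreover have "\<bar>X + Y + \<Delta> * Z\<bar> \<le> \<bar>X\<bar> + \<bar>Y\<bar> + \<bar>\<Delta>\<bar> * \<bar>Z\<bar>"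
        unfolding abs_mult[symmetric] by linarith
      moreover have "\<bar>X\<bar> \<le> C * \<Delta>\<^sup>2"
      proof -
        have "\<bar>X\<bar> \<le> B1 * (r t w * \<Delta>)\<^sup>2" unfolding X_def by (rule taylor_1_bound[OF F df B1])
        also have "\<dots> = B1 * (r t w)\<^sup>2 * \<Delta>\<^sup>2" by (simp add: power_mult_distrib)
        also have "\<dots> \<le> B1 * (inverse s0)\<^sup>2 * \<Delta>\<^sup>2"
        proof (intro mult_right_mono mult_left_mono power_mono)
          show "r t w \<le> inverse s0" "0 \<le> r t w" using s_ge[of "t + w"] tv[OF t w(2)] s0
            by (auto simp: r_def intro!: le_imp_inverse_le)
          show "0 \<le> B1" using B1[of 0] by simp
        qed auto
        also have "\<dots> \<le> C * \<Delta>\<^sup>2" by (intro mult_right_mono) (auto simp: C_def field_simps le_max_iff_disj)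
        finally show ?thesis .
      qed
      moreover have "\<bar>Y\<bar> \<le> C * \<beta> ^ 4"
      proof -
        have "\<bar>Y\<bar> \<le> C4 * w ^ 4" unfolding Y_def by (rule C4[OF t w(1)])
        also have "\<dots> = C4 * \<bar>u\<bar> ^ 4 * \<beta> ^ 4" by (simp add: w_def power_mult_distrib)
        also have "\<dots> \<le> \<bar>C4\<bar> * R ^ 4 * \<beta> ^ 4"
          using uR by (intro mult_right_mono mult_mono power_mono) auto
        also have "\<dots> \<le> C * \<beta> ^ 4"
        proof -
          \<comment> \<open>The expansion at a nonzero argument, here \<open>d/2\<close>, bounds an
            absolute value by a positive multiple of \<open>C4\<close>.\<close>
          have "0 \<le> C4"
            using C4[OF t, of "d/2"] d abs_ge_zero[of "F (g t (d/2)) - (F (g t 0) + f (g t 0) * g1 t 0 * (d/2) + c2 t / 2 * (d/2) ^ 2 + c3 t * (d/2) ^ 3)"]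
            by (smt (verit) field_sum_of_halves mult_neg_pos zero_less_power)
          then show ?thesis by (intro mult_right_mono) (auto simp: C_def le_max_iff_disj)
        qed
        finally show ?thesis .
      qed
      moreover have "\<bar>\<Delta>\<bar> * \<bar>Z\<bar> \<le> C * (\<bar>\<Delta>\<bar> * \<beta>\<^sup>2)"
      proof -
        have "\<bar>Z\<bar> \<le> C2 * w ^ 2" unfolding Z_def by (rule C2[OF t w(1)])
        also have "\<dots> = C2 * \<bar>u\<bar> ^ 2 * \<beta> ^ 2" by (simp add: w_def power_mult_distrib)
        also have "\<dots> \<le> \<bar>C2\<bar> * R ^ 2 * \<beta> ^ 2"
          using uR by (intro mult_right_mono mult_mono power_mono) auto
        also have "\<dots> \<le> C * \<beta> ^ 2"
        proof -
          have "0 \<le> C2"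
            using C2[OF t, of "d/2"] d abs_ge_zero[of "f (g t (d/2)) * r t (d/2) - (f (g t 0) * r t 0 + c1 t * (d/2))"]
            by (smt (verit) field_sum_of_halves mult_neg_pos zero_less_power)
          then show ?thesis by (intro mult_right_mono) (auto simp: C_def le_max_iff_disj)
        qed
        finally have "\<bar>Z\<bar> \<le> C * \<beta>\<^sup>2" .
        from mult_left_mono[OF this, of "\<bar>\<Delta>\<bar>"] show ?thesis by (simp add: mult_ac)
      qed
      ultimately show ?thesis by (simp add: algebra_simps)
    qed
    have Kc: "continuous_on A K" for A using K(3) by (rule continuous_on_subset) simp
    have Hc: "continuous_on {-R..R} H"
    proof -
      have c: "continuous_on {-R..R} (\<lambda>u. h (t + \<beta> * u))" if "bounded_derivs 4 {a..b} h" for h :: "real \<Rightarrow> real"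
        by (rule continuous_on_compose2[OF bounded_derivs_continuous_on[OF that]])
           (use tv[OF t vV] in \<open>auto intro!: continuous_intros simp: less_imp_le\<close>)
      have l: "continuous_on {-R..R} (\<lambda>u. (\<mu> t + \<Delta> - \<mu> (t + \<beta> * u)) / s (t + \<beta> * u))"
      proof (intro continuous_intros c b\<mu> bs ballI)
        fix u assume "u \<in> {-R..R}"
        then show "s (t + \<beta> * u) \<noteq> 0" using s_ge[of "t + \<beta> * u"] tv[OF t vV[of u]] s0 by auto
      qed
      have "continuous_on UNIV F" by (intro continuous_at_imp_continuous_on ballI DERIV_isCont[OF F])
      from continuous_on_compose2[OF this l] show ?thesis unfolding H_def[abs_def]
        by (intro continuous_on_diff continuous_on_const) auto
    qed
    have int: "h integrable_on {-R..R}" if "continuous_on {-R..R} h" for h :: "real \<Rightarrow> real"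
      using that by (rule integrable_continuous_interval)
    have IP: "integral {-R..R} (\<lambda>u. K u * P u) = f 0 / s t * (\<Delta> - psi_K K * rho_mu \<mu> s f t * \<beta>\<^sup>2)"
    proof -
      let ?e = "\<lambda>u. (f 0 / s t * \<Delta>) * K u + (c2 t / 2 * \<beta>\<^sup>2) * (K u * u\<^sup>2)"
      let ?o = "\<lambda>u. K u * ((f 0 * g1 t 0 * \<beta> + \<Delta> * c1 t * \<beta>) * u + c3 t * \<beta> ^ 3 * u ^ 3)"
      have "integral {-R..R} (\<lambda>u. K u * P u) = integral {-R..R} (\<lambda>u. ?e u + ?o u)"
        by (simp add: P_def algebra_simps)
      also have "\<dots> = integral {-R..R} ?e + integral {-R..R} ?o"
        by (intro integral_add int continuous_intros Kc)
      also have "integral {-R..R} ?o = 0" by (rule integral_odd) (simp add: K(2) algebra_simps)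
      also have "integral {-R..R} ?e = integral {-R..R} (\<lambda>u. (f 0 / s t * \<Delta>) * K u) + integral {-R..R} (\<lambda>u. (c2 t / 2 * \<beta>\<^sup>2) * (K u * u\<^sup>2))"
        by (intro integral_add int continuous_intros Kc)
      also have "\<dots> = f 0 / s t * \<Delta> + c2 t / 2 * \<beta>\<^sup>2 * (2 * psi_K K)"
        by (simp only: integral_mult_right K(4,5))
      finally show ?thesis by (simp add: c2[OF t] algebra_simps)
    qed
    have "\<bar>integral {-R..R} (\<lambda>u. K u * H u) - integral {-R..R} (\<lambda>u. K u * P u)\<bar> = \<bar>integral {-R..R} (\<lambda>u. K u * (H u - P u))\<bar>"
      unfolding P_def
      by (subst integral_diff[symmetric]) (auto intro!: int continuous_intros Kc Hc simp: right_diff_distrib)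
    also have "\<dots> \<le> integral {-R..R} (\<lambda>u. K u * (C * (\<beta> ^ 4 + \<bar>\<Delta>\<bar> * \<beta>\<^sup>2 + \<Delta>\<^sup>2)))"
    proof -
      have "norm (integral {-R..R} (\<lambda>u. K u * (H u - P u))) \<le> integral {-R..R} (\<lambda>u. K u * (C * (\<beta> ^ 4 + \<bar>\<Delta>\<bar> * \<beta>\<^sup>2 + \<Delta>\<^sup>2)))"
      proof (rule integral_norm_bound_integral)
        show "(\<lambda>u. K u * (H u - P u)) integrable_on {-R..R}"
          unfolding P_def by (intro int continuous_intros Kc Hc)
        show "norm (K u * (H u - P u)) \<le> K u * (C * (\<beta> ^ 4 + \<bar>\<Delta>\<bar> * \<beta>\<^sup>2 + \<Delta>\<^sup>2))" if "u \<in> {-R..R}" for u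
          using HP[OF that] K(1)[of u] by (simp add: abs_mult mult_left_mono)
      qed (intro int continuous_intros Kc)
      then show ?thesis by simp
    qed
    also have "\<dots> = C * (\<beta> ^ 4 + \<bar>\<Delta>\<bar> * \<beta>\<^sup>2 + \<Delta>\<^sup>2)" by (simp only: integral_mult_left K(4) mult_1)
    finally show "\<bar>integral {-R..R} (\<lambda>u. K u * (F ((\<mu> t + \<Delta> - \<mu> (t + \<beta> * u)) / s (t + \<beta> * u)) - 1/2))
      - f 0 / s t * (\<Delta> - psi_K K * rho_mu \<mu> s f t * \<beta>\<^sup>2)\<bar> \<le> C * (\<beta> ^ 4 + \<bar>\<Delta>\<bar> * \<beta>\<^sup>2 + \<Delta>\<^sup>2)"
      unfolding IP H_def .
  qed
qed

section \<open>Design points as an ordered sequence\<close>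

definition obs :: "(nat \<Rightarrow> nat \<Rightarrow> nat) \<Rightarrow> nat \<Rightarrow> (nat \<times> nat) set" where
  "obs m n = Sigma {1..n} (\<lambda>i. {1..m n i})"

definition pt :: "(nat \<Rightarrow> nat \<Rightarrow> nat \<Rightarrow> real) \<Rightarrow> nat \<Rightarrow> nat \<times> nat \<Rightarrow> real" where
  "pt x n p = x n (fst p) (snd p)"

lemma finite_obs[simp, intro]: "finite (obs m n)" by (simp add: obs_def)

lemma card_obs: "card (obs m n) = sample_size m n"
  by (simp add: obs_def sample_size_def)

lemma sum_obs: "(\<Sum>i=1..n. \<Sum>j=1..m n i. g i j) = (\<Sum>p\<in>obs m n. g (fst p) (snd p))"
  unfolding obs_def by (subst sum.Sigma) (auto simp: case_prod_beta)

abbreviation even_spacing :: "(nat \<Rightarrow> nat \<Rightarrow> nat) \<Rightarrow> (nat \<Rightarrow> nat \<Rightarrow> real) \<Rightarrow>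
    real \<Rightarrow> real \<Rightarrow> real \<Rightarrow> nat \<Rightarrow> bool" where
  "even_spacing m xt a b c n \<equiv> \<forall>k\<le>sample_size m n. \<bar>xt n (Suc k) - xt n k - (b - a) / sample_size m n\<bar> \<le> c / (sample_size m n)\<^sup>2"

text \<open>There are as many ordered points as index pairs, so the map from pairs to points has an
  image of full cardinality and is injective. Sums over pairs thus become sums over the ordered
  sequence.\<close>

lemma cond_X_enumeration:
  assumes "cond_X a b m x" and "filterlim (sample_size m) at_top sequentially"
  obtains xt c where "0 \<le> c" "\<And>n. xt n 0 = a" "\<And>n. xt n (Suc (sample_size m n)) = b"
    "\<And>n p. p \<in> obs m n \<Longrightarrow> pt x n p \<in> {a..b}"
    "\<And>n h. (\<Sum>p\<in>obs m n. h (pt x n p)) = (\<Sum>k=1..sample_size m n. h (xt n k) :: real)"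
    "\<forall>\<^sub>F n in sequentially. even_spacing m xt a b c n"
proof -
  define N where "N = sample_size m"
  obtain xt where xt0: "\<forall>n. xt n 0 = a \<and> xt n (N n + 1) = b \<and> strict_mono_on {0..N n + 1} (xt n) \<and>
             xt n ` {1..N n} = {x n i j | i j. i \<in> {1..n} \<and> j \<in> {1..m n i}}"
     and O: "(\<lambda>n. MAX k\<in>{0..N n}. \<bar>xt n (k + 1) - xt n k - (b - a) / real (N n)\<bar>) \<in> O(\<lambda>n. 1 / real (N n) ^ 2)"
    using assms(1) unfolding cond_X_def Let_def N_def[symmetric] by (elim exE conjE) (rule that)
  have xt: "xt n 0 = a" "xt n (N n + 1) = b" "strict_mono_on {0..N n + 1} (xt n)"
     "xt n ` {1..N n} = {x n i j | i j. i \<in> {1..n} \<and> j \<in> {1..m n i}}" for n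
    using spec[OF xt0, of n] by simp_all
  have im: "pt x n ` obs m n = xt n ` {1..N n}" for n
    unfolding xt(4) by (force simp: pt_def obs_def image_iff)
  have inj: "inj_on (xt n) {0..N n + 1}" for n using xt(3) by (rule strict_mono_on_imp_inj_on)
  have inj1: "inj_on (xt n) {1..N n}" for n by (rule inj_on_subset[OF inj]) auto
  have "card (pt x n ` obs m n) = card (obs m n)" for n
    using card_image[OF inj1, of n] im[of n] by (simp add: card_obs N_def)
  then have inj2: "inj_on (pt x n) (obs m n)" for n by (simp add: eq_card_imp_inj_on)
  have sums: "(\<Sum>p\<in>obs m n. h (pt x n p)) = (\<Sum>k=1..N n. h (xt n k))" for n and h :: "real \<Rightarrow> real"
    using sum.reindex[OF inj2, of h] sum.reindex[OF inj1, of h] by (simp add: im)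
  from O obtain c where c: "0 < c" and ev: "\<forall>\<^sub>F n in sequentially.
     norm (MAX k\<in>{0..N n}. \<bar>xt n (k + 1) - xt n k - (b - a) / real (N n)\<bar>) \<le> c * norm (1 / real (N n) ^ 2)"
    by (elim landau_o.bigE)
  show thesis
  proof (rule that[of c xt])
    show "xt n (Suc (sample_size m n)) = b" for n using xt(2)[of n] by (simp add: N_def)
    show "pt x n p \<in> {a..b}" if p: "p \<in> obs m n" for n p
    proof -
      have "pt x n p \<in> xt n ` {1..N n}" using p im by blast
      then obtain k where k: "k \<in> {1..N n}" "pt x n p = xt n k" by auto
      have "xt n 0 < xt n k" "xt n k < xt n (N n + 1)"
        using k(1) by (auto intro!: strict_mono_onD[OF xt(3)])
      then show ?thesis using k(2) xt(1,2) by simp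
    qed
    show "\<forall>\<^sub>F n in sequentially. even_spacing m xt a b c n"
      using ev
    proof eventually_elim
      case (elim n)
      show ?case
      proof (intro allI impI)
        fix k assume k: "k \<le> sample_size m n"
        have "\<bar>xt n (k + 1) - xt n k - (b - a) / real (N n)\<bar> \<le> (MAX k\<in>{0..N n}. \<bar>xt n (k + 1) - xt n k - (b - a) / real (N n)\<bar>)"
          by (rule Max_ge) (use k in \<open>auto simp: N_def\<close>)
        also have "\<dots> \<le> c * (1 / (real (N n))\<^sup>2)"
            using elim unfolding real_norm_def by (simp only: abs_le_iff abs_of_nonneg zero_le_divide_1_iff zero_le_power2)
        finally show "\<bar>xt n (Suc k) - xt n k - (b - a) / sample_size m n\<bar> \<le> c / (sample_size m n)\<^sup>2"
          by (simp add: N_def)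
      qed
    qed
  qed (use c xt(1) sums in \<open>auto simp: N_def\<close>)
qed

text \<open>The error depends on \<open>h\<close> only through its bound and Lipschitz constant;
  this makes it uniform in the point \<open>t\<close> and in the level that later enters
  \<open>h\<close>.\<close>

abbreviation riemann_approx :: "(nat \<Rightarrow> nat \<Rightarrow> nat) \<Rightarrow> (nat \<Rightarrow> nat \<Rightarrow> nat \<Rightarrow> real) \<Rightarrow> (nat \<Rightarrow> real) \<Rightarrow>
    real \<Rightarrow> real \<Rightarrow> real \<Rightarrow> real \<Rightarrow> real \<Rightarrow> nat \<Rightarrow> bool" where
  "riemann_approx m x bw a b d R C n \<equiv> \<forall>t\<in>{a + d..b - d}. \<forall>h L B. (\<forall>u v. \<bar>h u - h v\<bar> \<le> L * \<bar>u - v\<bar>) \<longrightarrow> (\<forall>u. \<bar>h u\<bar> \<le> B) \<longrightarrow> (\<forall>u. R < \<bar>u\<bar> \<longrightarrow> h u = 0) \<longrightarrow>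
     \<bar>(\<Sum>p\<in>obs m n. h ((pt x n p - t) / bw n)) - real (sample_size m n) * bw n / (b - a) * integral {-R..R} h\<bar> \<le> C * (B + L)"

text \<open>After rescaling, the step is \<open>\<Gamma> = (b - a) / (N * \<beta>)\<close>, and the
  spacing error \<open>c / N\<^sup>2\<close> of (X), divided by \<beta>, is at most
  \<open>\<kappa> * \<Gamma>\<^sup>2\<close>: exactly the tolerance of
  \<open>riemann_sum_error\<close>. The margin \<open>d\<close> keeps the kernel window inside
  \<open>{a..b}\<close>.\<close>

lemma design_riemann_sum:
  fixes bw :: "nat \<Rightarrow> real"
  assumes X: "cond_X a b m x" and N: "filterlim (sample_size m) at_top sequentially" and ab: "a < b"
    and bw: "\<And>n. 0 < bw n" "bw \<longlonglongrightarrow> 0" and Nbw: "filterlim (\<lambda>n. sample_size m n * bw n) at_top sequentially"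
    and d: "0 < d" and R: "0 < R"
  obtains C where "0 \<le> C" "\<forall>\<^sub>F n in sequentially. riemann_approx m x bw a b d R C n"
proof -
  obtain xt c where xt: "0 \<le> c" "\<And>n. xt n 0 = a" "\<And>n. xt n (Suc (sample_size m n)) = b"
    "\<And>n h. (\<Sum>p\<in>obs m n. h (pt x n p)) = (\<Sum>k=1..sample_size m n. h (xt n k) :: real)"
    and gap: "\<forall>\<^sub>F n in sequentially. even_spacing m xt a b c n" by (rule cond_X_enumeration[OF X N]) (rule that, assumption+)
  define \<kappa> where "\<kappa> = c / (b - a)\<^sup>2"
  have \<kappa>0: "0 \<le> \<kappa>" using xt(1) by (simp add: \<kappa>_def)
  have e1: "\<forall>\<^sub>F n in sequentially. bw n < min 1 (d / R)"
    by (rule order_tendstoD(2)[OF bw(2)]) (use d R in auto)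
  have e2: "\<forall>\<^sub>F n in sequentially. max 1 (2 * \<kappa> * (b - a)) \<le> sample_size m n * bw n"
    using Nbw unfolding filterlim_at_top by blast
  show thesis
  proof (rule that[of "(\<kappa> + 4) * (4 * R + 5 * (b - a))"])
    show "0 \<le> (\<kappa> + 4) * (4 * R + 5 * (b - a))" using \<kappa>0 R ab by simp
    show "\<forall>\<^sub>F n in sequentially. riemann_approx m x bw a b d R ((\<kappa> + 4) * (4 * R + 5 * (b - a))) n"
      using gap e1 e2
    proof (eventually_elim, intro ballI allI impI)
      fix n t L B and h :: "real \<Rightarrow> real"
      assume gap: "even_spacing m xt a b c n"
        and e1: "bw n < min 1 (d / R)" and e2: "max 1 (2 * \<kappa> * (b - a)) \<le> sample_size m n * bw n"
        and t: "t \<in> {a + d..b - d}" and h: "\<forall>u v. \<bar>h u - h v\<bar> \<le> L * \<bar>u - v\<bar>" "\<forall>u. \<bar>h u\<bar> \<le> B" "\<forall>u. R < \<bar>u\<bar> \<longrightarrow> h u = 0"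
      define N where "N = real (sample_size m n)"
      define \<beta> where "\<beta> = bw n"
      define \<Gamma> where "\<Gamma> = (b - a) / (N * \<beta>)"
      have \<beta>: "0 < \<beta>" "\<beta> \<le> 1" "R * \<beta> < d" using bw(1) e1 R by (auto simp: \<beta>_def field_simps)
      have NB: "1 \<le> N * \<beta>" "2 * \<kappa> * (b - a) \<le> N * \<beta>" using e2 by (auto simp: N_def \<beta>_def)
      have N0: "0 < N" using NB(1) \<beta>(1) by (metis less_le_trans zero_less_mult_pos2 zero_less_one)
      have \<Gamma>0: "0 < \<Gamma>" using ab \<beta> N0 by (simp add: \<Gamma>_def)
      have \<Gamma>1: "\<Gamma> \<le> b - a" unfolding \<Gamma>_def using divide_left_mono[of 1 "N * \<beta>" "b - a"] NB(1) ab by simp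
      have L0: "0 \<le> L" using h(1)[rule_format, of 0 1] by simp
      have B0: "0 \<le> B" using h(2)[rule_format, of 0] by simp
      have "\<bar>(\<Sum>k=1..sample_size m n. h ((xt n k - t) / \<beta>)) - integral {-R..R} h / \<Gamma>\<bar> \<le> (B * \<kappa> + 4 * L) * (4 * R + 5 * \<Gamma>)"
      proof (rule riemann_sum_error[where x="\<lambda>k. (xt n k - t) / \<beta>"])
        show "0 < \<Gamma>" by (rule \<Gamma>0)
        show "\<kappa> * \<Gamma> \<le> 1/2" using NB ab by (simp add: \<Gamma>_def field_simps)
        show "\<bar>(xt n (Suc k) - t) / \<beta> - (xt n k - t) / \<beta> - \<Gamma>\<bar> \<le> \<kappa> * \<Gamma>\<^sup>2" if "k \<le> sample_size m n" for k
        proof -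
          have "(xt n (Suc k) - t) / \<beta> - (xt n k - t) / \<beta> - \<Gamma> = (xt n (Suc k) - xt n k - (b - a) / N) / \<beta>"
            using \<beta> N0 by (simp add: \<Gamma>_def field_simps)
          also have "\<bar>\<dots>\<bar> = \<bar>xt n (Suc k) - xt n k - (b - a) / N\<bar> / \<beta>" using \<beta> by simp
          also have "\<dots> \<le> c / N\<^sup>2 / \<beta>" using gap that \<beta> by (intro divide_right_mono) (auto simp: N_def)
          also have "\<dots> = \<kappa> * \<Gamma>\<^sup>2 * \<beta>"
          proof -
            define w where "w = b - a"
            have "0 < w" using ab by (simp add: w_def)
            then show ?thesis using \<beta> N0 unfolding \<kappa>_def \<Gamma>_def w_def[symmetric]
              by (simp add: field_simps power2_eq_square)
          qed
          also have "\<dots> \<le> \<kappa> * \<Gamma>\<^sup>2 * 1" using \<beta> \<kappa>0 by (intro mult_left_mono) auto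
          finally show ?thesis by simp
        qed
        have "(a - t) / \<beta> \<le> - d / \<beta>" using t \<beta> by (intro divide_right_mono) auto
        also have "\<dots> < - R" using \<beta> by (simp add: field_simps)
        finally show "(xt n 0 - t) / \<beta> < - R" by (simp add: xt)
        have "R < d / \<beta>" using \<beta> by (simp add: field_simps)
        also have "\<dots> \<le> (b - t) / \<beta>" using t \<beta> by (intro divide_right_mono) auto
        finally show "R < (xt n (Suc (sample_size m n)) - t) / \<beta>" by (simp add: xt)
      qed (use h R \<kappa>0 in auto)
      also have "\<dots> \<le> ((B + L) * (\<kappa> + 4)) * (4 * R + 5 * (b - a))"
        using \<Gamma>1 B0 L0 \<kappa>0 R \<Gamma>0 by (intro mult_mono) (auto simp: algebra_simps)
      finally show "\<bar>(\<Sum>p\<in>obs m n. h ((pt x n p - t) / bw n)) - sample_size m n * bw n / (b - a) * integral {-R..R} h\<bar>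
       \<le> (\<kappa> + 4) * (4 * R + 5 * (b - a)) * (B + L)"
        using xt(4)[where n=n and h="\<lambda>z. h ((z - t) / bw n)"] ab by (simp add: \<Gamma>_def N_def \<beta>_def mult_ac)
    qed
  qed
qed

text \<open>Neighbouring points are eventually at least half of \<open>(b - a) / N\<close> apart,
  and the \<open>+ 1\<close> of the count is absorbed once \<open>N * bw\<close> is at least 1. All
  real \<open>t\<close> are covered, since grid points used later may lie outside
  \<open>{a..b}\<close>.\<close>

lemma design_local_count:
  fixes bw :: "nat \<Rightarrow> real"
  assumes X: "cond_X a b m x" and N: "filterlim (sample_size m) at_top sequentially" and ab: "a < b"
    and bw: "\<And>n. 0 < bw n" and Nbw: "filterlim (\<lambda>n. sample_size m n * bw n) at_top sequentially" and R: "0 < R"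
  obtains C where "0 < C" "\<forall>\<^sub>F n in sequentially. \<forall>t.
     real (card {p \<in> obs m n. \<bar>pt x n p - t\<bar> \<le> R * bw n}) \<le> C * (sample_size m n * bw n)"
proof -
  obtain xt c where xt: "0 \<le> c"
    "\<And>n h. (\<Sum>p\<in>obs m n. h (pt x n p)) = (\<Sum>k=1..sample_size m n. h (xt n k) :: real)"
    and gap: "\<forall>\<^sub>F n in sequentially. even_spacing m xt a b c n" by (rule cond_X_enumeration[OF X N]) (rule that, assumption+)
  have e1: "\<forall>\<^sub>F n in sequentially. max 1 (2 * c / (b - a)) \<le> real (sample_size m n)"
    using filterlim_compose[OF filterlim_real_sequentially N] unfolding filterlim_at_top by blast
  have e2: "\<forall>\<^sub>F n in sequentially. 1 \<le> sample_size m n * bw n"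
    using Nbw unfolding filterlim_at_top by blast
  show thesis
  proof (rule that[of "4 * R / (b - a) + 1"])
    show "0 < 4 * R / (b - a) + 1" using R ab by (simp add: add_pos_pos)
    show "\<forall>\<^sub>F n in sequentially. \<forall>t. real (card {p \<in> obs m n. \<bar>pt x n p - t\<bar> \<le> R * bw n})
        \<le> (4 * R / (b - a) + 1) * (sample_size m n * bw n)"
      using gap e1 e2
    proof (eventually_elim, intro allI)
      fix n t
      assume gap: "even_spacing m xt a b c n"
        and e1: "max 1 (2 * c / (b - a)) \<le> real (sample_size m n)" and e2: "1 \<le> sample_size m n * bw n"
      define N where "N = real (sample_size m n)"
      have N: "1 \<le> N" "2 * c \<le> N * (b - a)" using e1 ab by (auto simp: N_def field_simps)
      have "c / N\<^sup>2 \<le> (b - a) / (2 * N)" using N by (simp add: field_simps power2_eq_square)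
      then have g: "(b - a) / (2 * N) \<le> xt n (Suc k) - xt n k" if "k < Suc (sample_size m n)" for k
        using gap[rule_format, of k] that by (simp add: N_def[symmetric] abs_le_iff)
      have "real (card {p \<in> obs m n. \<bar>pt x n p - t\<bar> \<le> R * bw n}) = (\<Sum>p\<in>obs m n. of_bool (\<bar>pt x n p - t\<bar> \<le> R * bw n))"
        by (simp add: sum_of_bool_eq Int_def)
      also have "\<dots> = (\<Sum>k=1..sample_size m n. of_bool (\<bar>xt n k - t\<bar> \<le> R * bw n))" by (rule xt(2))
      also have "\<dots> = real (card {k \<in> {1..sample_size m n}. \<bar>xt n k - t\<bar> \<le> R * bw n})"
        by (simp add: sum_of_bool_eq Int_def)
      also have "\<dots> \<le> real (card {k. k \<le> Suc (sample_size m n) \<and> xt n k \<in> {t - R * bw n..t + R * bw n}})"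
        by (intro of_nat_mono card_mono) (auto simp: abs_le_iff intro: finite_subset[of _ "{..Suc (sample_size m n)}"])
      also have "\<dots> \<le> (t + R * bw n - (t - R * bw n)) / ((b - a) / (2 * N)) + 1"
        by (rule card_points_in_interval[where x="xt n", OF g]) (use ab N R bw[of n] in auto)
      also have "\<dots> = 4 * R / (b - a) * (N * bw n) + 1" by (simp add: field_simps)
      also have "\<dots> \<le> 4 * R / (b - a) * (N * bw n) + 1 * (N * bw n)" using e2 by (simp add: N_def)
      finally show "real (card {p \<in> obs m n. \<bar>pt x n p - t\<bar> \<le> R * bw n})
        \<le> (4 * R / (b - a) + 1) * (sample_size m n * bw n)" by (simp add: N_def algebra_simps)
    qed
  qed
qed

section \<open>Bernstein's inequality and truncated errors\<close>

text \<open>Negative arguments are the delicate case: with \<open>z = - y\<close> it suffices that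
  \<open>1 - z + z\<^sup>2\<close> times the quadratic lower bound of \<open>exp z\<close> is at
  least 1.\<close>

lemma exp_le_quadratic:
  fixes y :: real
  assumes "\<bar>y\<bar> \<le> 1"
  shows "exp y \<le> 1 + y + y\<^sup>2"
proof (cases "0 \<le> y")
  case True
  then show ?thesis using exp_bound[of y] assms by simp
next
  case False
  define z where "z = - y"
  have z: "0 \<le> z" "z \<le> 1" using False assms by (auto simp: z_def)
  have "1 \<le> (1 - z + z\<^sup>2) * (1 + z + z\<^sup>2 / 2)"
  proof -
    have "(1 - z + z\<^sup>2) * (1 + z + z\<^sup>2 / 2) = 1 + z\<^sup>2 / 2 + z ^ 3 / 2 + z ^ 4 / 2"
      by (simp add: field_simps power2_eq_square power3_eq_cube power4_eq_xxxx)
    then show ?thesis using z by simp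
  qed
  also have "\<dots> \<le> (1 - z + z\<^sup>2) * exp z"
    using z by (intro mult_left_mono exp_lower_Taylor_quadratic) auto
  finally have "exp (- z) \<le> 1 - z + z\<^sup>2" by (simp add: exp_minus field_simps)
  then show ?thesis by (simp add: z_def)
qed

context prob_space
begin

text \<open>On taking expectations the linear term of the quadratic bound on \<open>exp\<close>
  disappears; \<open>s * B \<le> 1\<close> keeps the argument in the range of that bound.\<close>

lemma mgf_bounded_centered:
  fixes X :: "'a \<Rightarrow> real"
  assumes [measurable]: "X \<in> borel_measurable M" and bd: "\<And>\<omega>. \<omega> \<in> space M \<Longrightarrow> \<bar>X \<omega>\<bar> \<le> B"
    and mean: "expectation X = 0" and s: "0 \<le> s" "s * B \<le> 1"
  shows "expectation (\<lambda>\<omega>. exp (s * X \<omega>)) \<le> exp (s\<^sup>2 * expectation (\<lambda>\<omega>. (X \<omega>)\<^sup>2))"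
proof -
  have sX: "\<bar>s * X \<omega>\<bar> \<le> 1" if "\<omega> \<in> space M" for \<omega>
  proof -
    have "\<bar>s * X \<omega>\<bar> = s * \<bar>X \<omega>\<bar>" using s(1) by (simp add: abs_mult)
    also have "\<dots> \<le> s * B" using s bd[OF that] by (intro mult_left_mono)
    finally show ?thesis using s by simp
  qed
  have iX: "integrable M X" by (rule integrable_const_bound[where B=B]) (auto simp: bd)
  have iX2: "integrable M (\<lambda>\<omega>. (X \<omega>)\<^sup>2)"
    by (rule integrable_const_bound[where B="B\<^sup>2"]) (auto simp: abs_le_square_iff[symmetric] bd[THEN order_trans])
  have "expectation (\<lambda>\<omega>. exp (s * X \<omega>)) \<le> expectation (\<lambda>\<omega>. 1 + s * X \<omega> + s\<^sup>2 * (X \<omega>)\<^sup>2)"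
  proof (rule integral_mono)
    show "integrable M (\<lambda>\<omega>. exp (s * X \<omega>))"
      by (rule integrable_const_bound[where B="exp 1"]) (use sX in \<open>auto simp: abs_le_iff\<close>)
    show "integrable M (\<lambda>\<omega>. 1 + s * X \<omega> + s\<^sup>2 * (X \<omega>)\<^sup>2)" using iX iX2 by simp
    show "exp (s * X \<omega>) \<le> 1 + s * X \<omega> + s\<^sup>2 * (X \<omega>)\<^sup>2" if "\<omega> \<in> space M" for \<omega>
      using exp_le_quadratic[OF sX[OF that]] by (simp add: power_mult_distrib)
  qed
  also have "\<dots> = 1 + s\<^sup>2 * expectation (\<lambda>\<omega>. (X \<omega>)\<^sup>2)"
    using iX iX2 mean by (simp add: prob_space)
  also have "\<dots> \<le> exp (s\<^sup>2 * expectation (\<lambda>\<omega>. (X \<omega>)\<^sup>2))" by (rule exp_ge_add_one_self)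
  finally show ?thesis .
qed

text \<open>Chernoff's method with the exponent \<open>s\<close> left free: a good choice depends on
  the scale of the variance and is made only in \<open>indicator_sum_tail\<close>.\<close>

lemma bernstein_upper_tail:
  assumes fin: "finite I" and indep: "indep_vars (\<lambda>_. borel) X I"
    and bd: "\<And>i \<omega>. i \<in> I \<Longrightarrow> \<omega> \<in> space M \<Longrightarrow> \<bar>X i \<omega>\<bar> \<le> B"
    and mean: "\<And>i. i \<in> I \<Longrightarrow> expectation (X i) = 0"
    and V: "(\<Sum>i\<in>I. expectation (\<lambda>\<omega>. (X i \<omega>)\<^sup>2)) \<le> V"
    and s: "0 \<le> s" "s * B \<le> 1"
  shows "prob {\<omega>\<in>space M. \<eta> < (\<Sum>i\<in>I. X i \<omega>)} \<le> exp (s\<^sup>2 * V - s * \<eta>)"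
proof -
  have [measurable]: "X i \<in> borel_measurable M" if "i \<in> I" for i
    using indep that by (auto simp: indep_vars_def)
  have int: "integrable M (\<lambda>\<omega>. exp (s * X i \<omega>))" if i: "i \<in> I" for i
  proof (rule integrable_const_bound[where B="exp (s * B)"])
    show "AE \<omega> in M. norm (exp (s * X i \<omega>)) \<le> exp (s * B)"
      using bd[OF i] s by (auto intro!: AE_I2 mult_left_mono simp: abs_le_iff)
  qed (use i in measurable)
  have indep': "indep_vars (\<lambda>_. borel) (\<lambda>i \<omega>. exp (s * X i \<omega>)) I"
    by (rule indep_vars_compose2[OF indep]) measurable
  have int': "integrable M (\<lambda>\<omega>. \<Prod>i\<in>I. exp (s * X i \<omega>))"
    by (rule indep_vars_integrable[OF fin indep' int])
  have "prob {\<omega>\<in>space M. \<eta> < (\<Sum>i\<in>I. X i \<omega>)} = expectation (indicator {\<omega>\<in>space M. \<eta> < (\<Sum>i\<in>I. X i \<omega>)})"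
    by simp
  also have "\<dots> \<le> expectation (\<lambda>\<omega>. exp (- s * \<eta>) * (\<Prod>i\<in>I. exp (s * X i \<omega>)))"
  proof (rule integral_mono)
    show "integrable M (indicator {\<omega>\<in>space M. \<eta> < (\<Sum>i\<in>I. X i \<omega>)} :: 'a \<Rightarrow> real)"
      by (auto simp: emeasure_eq_measure)
    show "integrable M (\<lambda>\<omega>. exp (- s * \<eta>) * (\<Prod>i\<in>I. exp (s * X i \<omega>)))" using int' by simp
    fix \<omega> assume "\<omega> \<in> space M"
    have "exp (- s * \<eta>) * (\<Prod>i\<in>I. exp (s * X i \<omega>)) = exp (s * ((\<Sum>i\<in>I. X i \<omega>) - \<eta>))"
      using fin by (simp add: exp_sum sum_distrib_left exp_diff exp_minus field_simps)
    then show "indicator {\<omega>\<in>space M. \<eta> < (\<Sum>i\<in>I. X i \<omega>)} \<omega> \<le> exp (- s * \<eta>) * (\<Prod>i\<in>I. exp (s * X i \<omega>))"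
      using s by (auto simp: indicator_def)
  qed
  also have "\<dots> = exp (- s * \<eta>) * (\<Prod>i\<in>I. expectation (\<lambda>\<omega>. exp (s * X i \<omega>)))"
    using indep_vars_lebesgue_integral[OF fin indep' int] by simp
  also have "\<dots> \<le> exp (- s * \<eta>) * (\<Prod>i\<in>I. exp (s\<^sup>2 * expectation (\<lambda>\<omega>. (X i \<omega>)\<^sup>2)))"
    by (intro mult_left_mono prod_mono conjI mgf_bounded_centered[where B=B]) (auto simp: bd mean s)
  also have "\<dots> = exp (- s * \<eta>) * exp (s\<^sup>2 * (\<Sum>i\<in>I. expectation (\<lambda>\<omega>. (X i \<omega>)\<^sup>2)))"
    using fin by (simp add: exp_sum sum_distrib_left)
  also have "\<dots> \<le> exp (- s * \<eta>) * exp (s\<^sup>2 * V)"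
    using V by (intro mult_left_mono) (auto intro: mult_left_mono)
  also have "\<dots> = exp (s\<^sup>2 * V - s * \<eta>)" by (simp add: mult_exp_exp)
  finally show ?thesis .
qed

lemma bernstein_tail:
  assumes fin: "finite I" and indep: "indep_vars (\<lambda>_. borel) X I"
    and bd: "\<And>i \<omega>. i \<in> I \<Longrightarrow> \<omega> \<in> space M \<Longrightarrow> \<bar>X i \<omega>\<bar> \<le> B"
    and mean: "\<And>i. i \<in> I \<Longrightarrow> expectation (X i) = 0"
    and V: "(\<Sum>i\<in>I. expectation (\<lambda>\<omega>. (X i \<omega>)\<^sup>2)) \<le> V"
    and s: "0 \<le> s" "s * B \<le> 1"
  shows "prob {\<omega>\<in>space M. \<eta> < \<bar>\<Sum>i\<in>I. X i \<omega>\<bar>} \<le> 2 * exp (s\<^sup>2 * V - s * \<eta>)"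
proof -
  have [measurable]: "X i \<in> borel_measurable M" if "i \<in> I" for i
    using indep that by (auto simp: indep_vars_def)
  have "indep_vars (\<lambda>_. borel) (\<lambda>i \<omega>. - X i \<omega>) I"
    by (rule indep_vars_compose2[OF indep]) measurable
  then have neg: "prob {\<omega>\<in>space M. \<eta> < (\<Sum>i\<in>I. - X i \<omega>)} \<le> exp (s\<^sup>2 * V - s * \<eta>)"
    by (rule bernstein_upper_tail[OF fin]) (use bd mean V s in auto)
  have "prob {\<omega>\<in>space M. \<eta> < \<bar>\<Sum>i\<in>I. X i \<omega>\<bar>} \<le>
      prob ({\<omega>\<in>space M. \<eta> < (\<Sum>i\<in>I. X i \<omega>)} \<union> {\<omega>\<in>space M. \<eta> < (\<Sum>i\<in>I. - X i \<omega>)})"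
    by (rule finite_measure_mono) (auto simp: abs_if sum_negf split: if_splits)
  also have "\<dots> \<le> prob {\<omega>\<in>space M. \<eta> < (\<Sum>i\<in>I. X i \<omega>)} + prob {\<omega>\<in>space M. \<eta> < (\<Sum>i\<in>I. - X i \<omega>)}"
    by (rule measure_Un_le) auto
  also have "\<dots> \<le> 2 * exp (s\<^sup>2 * V - s * \<eta>)"
    using bernstein_upper_tail[OF fin indep bd mean V s, of \<eta>] neg by simp
  finally show ?thesis .
qed

text \<open>If the sum exceeds \<eta>, one of the \<open>r\<close> independent classes exceeds
  \<open>\<eta> / r\<close>. Each class is charged the whole variance \<open>V\<close>, so the price
  is the division of \<eta> by \<open>r\<close> and the factor \<open>r\<close> in front.\<close>

lemma bernstein_tail_coloured:
  fixes c :: "'i \<Rightarrow> nat"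
  assumes fin: "finite I" and r: "0 < r" "\<And>i. i \<in> I \<Longrightarrow> c i < r"
    and indep: "\<And>k. k < r \<Longrightarrow> indep_vars (\<lambda>_. borel) X {i\<in>I. c i = k}"
    and bd: "\<And>i \<omega>. i \<in> I \<Longrightarrow> \<omega> \<in> space M \<Longrightarrow> \<bar>X i \<omega>\<bar> \<le> B"
    and mean: "\<And>i. i \<in> I \<Longrightarrow> expectation (X i) = 0"
    and V: "(\<Sum>i\<in>I. expectation (\<lambda>\<omega>. (X i \<omega>)\<^sup>2)) \<le> V"
    and s: "0 \<le> s" "s * B \<le> 1"
  shows "prob {\<omega>\<in>space M. \<eta> < \<bar>\<Sum>i\<in>I. X i \<omega>\<bar>} \<le> 2 * real r * exp (s\<^sup>2 * V - s * \<eta> / r)"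
proof -
  define J where "J k = {i\<in>I. c i = k}" for k
  have [measurable]: "X i \<in> borel_measurable M" if "i \<in> I" for i
    using indep[OF r(2)[OF that]] that by (auto simp: indep_vars_def)
  have finJ: "finite (J k)" for k using fin by (auto simp: J_def)
  have [measurable]: "{\<omega>\<in>space M. \<eta> / r < \<bar>\<Sum>i\<in>J k. X i \<omega>\<bar>} \<in> events" for k
  proof -
    have "(\<lambda>\<omega>. \<Sum>i\<in>J k. X i \<omega>) \<in> borel_measurable M"
      by (rule borel_measurable_sum) (auto simp: J_def)
    then show ?thesis by measurable
  qed
  have tail: "prob {\<omega>\<in>space M. \<eta> / r < \<bar>\<Sum>i\<in>J k. X i \<omega>\<bar>} \<le> 2 * exp (s\<^sup>2 * V - s * \<eta> / r)" if "k < r" for k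
  proof -
    have "(\<Sum>i\<in>J k. expectation (\<lambda>\<omega>. (X i \<omega>)\<^sup>2)) \<le> (\<Sum>i\<in>I. expectation (\<lambda>\<omega>. (X i \<omega>)\<^sup>2))"
      by (rule sum_mono2[OF fin]) (auto simp: J_def)
    then have "prob {\<omega>\<in>space M. \<eta> / r < \<bar>\<Sum>i\<in>J k. X i \<omega>\<bar>} \<le> 2 * exp (s\<^sup>2 * V - s * (\<eta> / r))"
      using indep[OF that] V by (intro bernstein_tail[where B=B] finJ) (auto simp: J_def bd mean s)
    then show ?thesis by simp
  qed
  have "prob {\<omega>\<in>space M. \<eta> < \<bar>\<Sum>i\<in>I. X i \<omega>\<bar>} \<le> prob (\<Union>k<r. {\<omega>\<in>space M. \<eta> / r < \<bar>\<Sum>i\<in>J k. X i \<omega>\<bar>})"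
  proof (rule finite_measure_mono)
    show "{\<omega>\<in>space M. \<eta> < \<bar>\<Sum>i\<in>I. X i \<omega>\<bar>} \<subseteq> (\<Union>k<r. {\<omega>\<in>space M. \<eta> / r < \<bar>\<Sum>i\<in>J k. X i \<omega>\<bar>})"
    proof (rule subsetI, rule ccontr)
      fix \<omega> assume w: "\<omega> \<in> {\<omega>\<in>space M. \<eta> < \<bar>\<Sum>i\<in>I. X i \<omega>\<bar>}"
        "\<omega> \<notin> (\<Union>k<r. {\<omega>\<in>space M. \<eta> / r < \<bar>\<Sum>i\<in>J k. X i \<omega>\<bar>})"
      have "(\<Sum>i\<in>I. X i \<omega>) = (\<Sum>k<r. \<Sum>i\<in>J k. X i \<omega>)"
        unfolding J_def by (rule sum.group[symmetric]) (use fin r in auto)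
      then have "\<bar>\<Sum>i\<in>I. X i \<omega>\<bar> \<le> (\<Sum>k<r. \<bar>\<Sum>i\<in>J k. X i \<omega>\<bar>)" by simp
      also have "\<dots> \<le> (\<Sum>k<r. \<eta> / r)" by (rule sum_mono) (use w in \<open>auto simp: not_less\<close>)
      also have "\<dots> = \<eta>" using r by simp
      finally show False using w by simp
    qed
  qed auto
  also have "\<dots> \<le> (\<Sum>k<r. prob {\<omega>\<in>space M. \<eta> / r < \<bar>\<Sum>i\<in>J k. X i \<omega>\<bar>})"
    by (rule finite_measure_subadditive_finite) auto
  also have "\<dots> \<le> (\<Sum>k<r. 2 * exp (s\<^sup>2 * V - s * \<eta> / r))" by (rule sum_mono) (use tail in auto)
  also have "\<dots> = 2 * real r * exp (s\<^sup>2 * V - s * \<eta> / r)" by simp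
  finally show ?thesis by simp
qed

lemma bernstein_tail_indicators:
  fixes c :: "'i \<Rightarrow> nat" and Z :: "'i \<Rightarrow> 'a \<Rightarrow> real"
  assumes fin: "finite I" and r: "0 < r" "\<And>i. i \<in> I \<Longrightarrow> c i < r"
    and indep: "\<And>k. k < r \<Longrightarrow> indep_vars (\<lambda>_. borel) Z {i\<in>I. c i = k}"
    and A: "\<And>i. i \<in> I \<Longrightarrow> A i \<in> sets borel"
    and w: "\<And>i. i \<in> I \<Longrightarrow> \<bar>w i\<bar> \<le> B"
    and V: "(\<Sum>i\<in>I. (w i)\<^sup>2 * prob (Z i -` A i \<inter> space M)) \<le> V"
    and s: "0 \<le> s" "s * B \<le> 1"
  shows "prob {\<omega>\<in>space M. \<eta> < \<bar>\<Sum>i\<in>I. w i * (indicator (A i) (Z i \<omega>) - prob (Z i -` A i \<inter> space M))\<bar>}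
    \<le> 2 * real r * exp (s\<^sup>2 * V - s * \<eta> / r)"
proof (rule bernstein_tail_coloured[where c=c and B=B])
  define P where "P i = prob (Z i -` A i \<inter> space M)" for i
  have rv: "Z i \<in> borel_measurable M" if "i \<in> I" for i
    using indep[OF r(2)[OF that]] that by (auto simp: indep_vars_def)
  have ev: "Z i -` A i \<inter> space M \<in> events" if "i \<in> I" for i
    using rv[OF that] A[OF that] by (rule measurable_sets)
  have P: "0 \<le> P i" "P i \<le> 1" for i by (auto simp: P_def)
  have ex: "expectation (\<lambda>\<omega>. indicat_real (A i) (Z i \<omega>)) = P i" if "i \<in> I" for i
  proof -
    have "expectation (\<lambda>\<omega>. indicat_real (A i) (Z i \<omega>)) = expectation (indicat_real (Z i -` A i \<inter> space M))"
      by (rule Bochner_Integration.integral_cong) (auto simp: indicator_def)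
    then show ?thesis using ev[OF that] by (simp add: P_def)
  qed
  have int: "integrable M (\<lambda>\<omega>. indicator (A i) (Z i \<omega>) :: real)" if "i \<in> I" for i
  proof -
    have "integrable M (indicator (Z i -` A i \<inter> space M) :: 'a \<Rightarrow> real)"
      using ev[OF that] by (simp add: emeasure_eq_measure)
    then show ?thesis by (rule Bochner_Integration.integrable_cong[THEN iffD1, rotated -1]) (auto simp: indicator_def)
  qed
  show "expectation (\<lambda>\<omega>. w i * (indicator (A i) (Z i \<omega>) - prob (Z i -` A i \<inter> space M))) = 0" if "i \<in> I" for i
    using ex[OF that] int[OF that] by (simp add: prob_space P_def)
  show "\<bar>w i * (indicator (A i) (Z i \<omega>) - prob (Z i -` A i \<inter> space M))\<bar> \<le> B" if "i \<in> I" for i \<omega>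
  proof -
    have "\<bar>indicator (A i) (Z i \<omega>) - P i\<bar> \<le> 1" using P[of i] by (auto simp: indicator_def)
    then have "\<bar>w i\<bar> * \<bar>indicator (A i) (Z i \<omega>) - P i\<bar> \<le> B * 1"
      using w[OF that] by (intro mult_mono) auto
    then show ?thesis by (simp add: P_def abs_mult)
  qed
  show "(\<Sum>i\<in>I. expectation (\<lambda>\<omega>. (w i * (indicator (A i) (Z i \<omega>) - prob (Z i -` A i \<inter> space M)))\<^sup>2)) \<le> V"
  proof (rule order_trans[OF sum_mono V])
    fix i assume i: "i \<in> I"
    \<comment> \<open>The variance of an indicator is at most its probability. Rare events thus give
      small variances, which is what later makes increments smaller than the process itself.\<close>
    have "(w i * (indicator (A i) (Z i \<omega>) - P i))\<^sup>2
        = (w i)\<^sup>2 * ((1 - 2 * P i) * indicator (A i) (Z i \<omega>) + (P i)\<^sup>2)" for \<omega>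
      by (auto simp: indicator_def power2_eq_square algebra_simps)
    then have "expectation (\<lambda>\<omega>. (w i * (indicator (A i) (Z i \<omega>) - P i))\<^sup>2) = (w i)\<^sup>2 * ((1 - 2 * P i) * P i + (P i)\<^sup>2)"
      using ex[OF i] int[OF i] by (simp add: prob_space)
    also have "\<dots> = (w i)\<^sup>2 * P i - (w i * P i)\<^sup>2" by (simp add: power2_eq_square algebra_simps)
    also have "\<dots> \<le> (w i)\<^sup>2 * P i" by simp
    finally show "expectation (\<lambda>\<omega>. (w i * (indicator (A i) (Z i \<omega>) - prob (Z i -` A i \<inter> space M)))\<^sup>2)
       \<le> (w i)\<^sup>2 * prob (Z i -` A i \<inter> space M)" by (simp add: P_def)
  qed
  show "indep_vars (\<lambda>_. borel) (\<lambda>i \<omega>. w i * (indicator (A i) (Z i \<omega>) - prob (Z i -` A i \<inter> space M))) {i\<in>I. c i = k}"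
    if "k < r" for k
  proof (rule indep_vars_compose2[OF indep[OF that]])
    fix i assume "i \<in> {i\<in>I. c i = k}"
    then have [measurable]: "A i \<in> sets borel" using A by auto
    show "(\<lambda>z. w i * (indicator (A i) z - prob (Z i -` A i \<inter> space M))) \<in> borel_measurable borel" by measurable
  qed
qed (use assms in auto)

end

section \<open>Errors depending on finitely many innovations\<close>

definition err_trunc :: "((int \<Rightarrow> real) \<Rightarrow> real) \<Rightarrow> (int \<Rightarrow> int \<Rightarrow> 'a \<Rightarrow> real) \<Rightarrow> nat \<Rightarrow> (int \<Rightarrow> real) \<Rightarrow> int \<Rightarrow> int \<Rightarrow> 'a \<Rightarrow> real" where
  "err_trunc G \<epsilon> k c i j \<omega> = G (coupled k (\<lambda>l. \<epsilon> i (j + l) \<omega>) c)"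

locale iid_errors = prob_space M for M :: "'a measure" +
  fixes \<epsilon> :: "int \<Rightarrow> int \<Rightarrow> 'a \<Rightarrow> real" and G :: "(int \<Rightarrow> real) \<Rightarrow> real"
  assumes iid: "iid_array M \<epsilon>" and G[measurable]: "G \<in> borel_measurable (PiM UNIV (\<lambda>_. borel))"
begin

abbreviation "\<nu> \<equiv> distr M borel (\<epsilon> 0 0)"

lemma \<epsilon>_indep: "indep_vars (\<lambda>_. borel) (\<lambda>(i, j). \<epsilon> i j) UNIV"
  using iid by (simp add: iid_array_def)

lemma \<epsilon>_rv[measurable]: "\<epsilon> i j \<in> borel_measurable M"
proof -
  have "(\<lambda>(i, j). \<epsilon> i j) (i, j) \<in> borel_measurable M"
    using \<epsilon>_indep unfolding indep_vars_def by blast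
  then show ?thesis by simp
qed

lemma seq_rv[measurable]: "(\<lambda>\<omega> l. \<epsilon> i (j + l) \<omega>) \<in> measurable M (PiM UNIV (\<lambda>_. borel))"
  by (rule measurable_PiM_single') auto

lemma prob_space_\<nu>: "prob_space \<nu>" by (rule prob_space_distr) simp

text \<open>Recentring leaves the law of a row of i.i.d. innovations unchanged. Through
  \<open>distr_functional\<close> this is the stationarity of all functionals of a row, of the
  errors and of their truncations alike.\<close>

lemma seq_distr: "distr M (PiM UNIV (\<lambda>_. borel)) (\<lambda>\<omega> l. \<epsilon> i (j + l) \<omega>) = PiM UNIV (\<lambda>_. \<nu>)"
proof -
  have "indep_vars (\<lambda>l. PiM {(i, j + l)} (\<lambda>_. borel)) (\<lambda>l \<omega>. restrict (\<lambda>p. (\<lambda>(i, j). \<epsilon> i j) p \<omega>) {(i, j + l)}) (UNIV :: int set)"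
    by (rule indep_vars_restrict[OF \<epsilon>_indep]) (auto simp: disjoint_family_on_def)
  then have "indep_vars (\<lambda>_. borel) (\<lambda>l \<omega>. (restrict (\<lambda>p. (\<lambda>(i, j). \<epsilon> i j) p \<omega>) {(i, j + l)}) (i, j + l)) (UNIV :: int set)"
    by (rule indep_vars_compose2[where Y="\<lambda>l z. z (i, j + l)"]) (auto intro!: measurable_component_singleton)
  then have "indep_vars (\<lambda>_. borel) (\<lambda>l \<omega>. \<epsilon> i (j + l) \<omega>) (UNIV :: int set)" by simp
  then have "distr M (PiM UNIV (\<lambda>_. borel)) (\<lambda>\<omega>. \<lambda>l\<in>UNIV. \<epsilon> i (j + l) \<omega>) = PiM UNIV (\<lambda>l. distr M borel (\<epsilon> i (j + l)))"
    by (subst (asm) indep_vars_iff_distr_eq_PiM) auto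
  moreover have "distr M borel (\<epsilon> i' j') = \<nu>" for i' j' using iid unfolding iid_array_def by blast
  then have "PiM UNIV (\<lambda>l. distr M borel (\<epsilon> i (j + l))) = PiM UNIV (\<lambda>_ :: int. \<nu>)" by (intro PiM_cong) auto
  ultimately show ?thesis by (simp add: restrict_UNIV)
qed

lemma coupled_fst_measurable: "(\<lambda>u. coupled k u c) \<in> measurable (PiM UNIV (\<lambda>_. borel)) (PiM UNIV (\<lambda>_. borel))"
  unfolding coupled_def by (rule measurable_PiM_single') auto

lemma err_rv[measurable]: "err G \<epsilon> i j \<in> borel_measurable M"
  unfolding err_def[abs_def] by measurable

lemma err_trunc_rv[measurable]: "err_trunc G \<epsilon> k c i j \<in> borel_measurable M"
  unfolding err_trunc_def[abs_def]
  by (rule measurable_compose[OF measurable_compose[OF seq_rv coupled_fst_measurable] G])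

lemma distr_functional:
  assumes [measurable]: "H \<in> borel_measurable (PiM UNIV (\<lambda>_. borel))"
  shows "distr M borel (\<lambda>\<omega>. H (\<lambda>l. \<epsilon> i (j + l) \<omega>)) = distr (PiM UNIV (\<lambda>_. \<nu>)) borel H"
  unfolding seq_distr[of i j, symmetric] by (subst distr_distr) (auto simp: comp_def)

lemma err_distr: "distr M borel (err G \<epsilon> i j) = distr M borel (err G \<epsilon> 0 0)"
  unfolding err_def[abs_def] distr_functional[OF G] ..

lemma err_trunc_distr: "distr M borel (err_trunc G \<epsilon> k c i j) = distr M borel (err_trunc G \<epsilon> k c 0 0)"
  unfolding err_trunc_def[abs_def]
  using distr_functional[OF measurable_compose[OF coupled_fst_measurable[of k c] G], where i=i and j=j]
    distr_functional[OF measurable_compose[OF coupled_fst_measurable[of k c] G], where i=0 and j=0] by simp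

lemma err_diff_distr: "distr M borel (\<lambda>\<omega>. err G \<epsilon> i j \<omega> - err_trunc G \<epsilon> k c i j \<omega>)
   = distr (PiM UNIV (\<lambda>_. \<nu>)) borel (\<lambda>u. G u - G (coupled k u c))"
  unfolding err_trunc_def[abs_def] err_def[abs_def]
  using distr_functional[of "\<lambda>u. G u - G (coupled k u c)"] measurable_compose[OF coupled_fst_measurable G] by simp

text \<open>Each truncated error is a function of the innovations in a window of radius
  \<open>k\<close>; windows in different rows, or with centres more than \<open>2 * k\<close> apart,
  are disjoint.\<close>

lemma err_trunc_indep:
  fixes i j :: "'i \<Rightarrow> int"
  assumes "\<And>p p'. p \<in> L \<Longrightarrow> p' \<in> L \<Longrightarrow> p \<noteq> p' \<Longrightarrow> i p \<noteq> i p' \<or> 2 * int k < \<bar>j p - j p'\<bar>"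
  shows "indep_vars (\<lambda>_. borel) (\<lambda>p. err_trunc G \<epsilon> k c (i p) (j p)) L"
proof -
  define K where "K p = {i p} \<times> {j p - int k..j p + int k}" for p
  have "indep_vars (\<lambda>p. PiM (K p) (\<lambda>_. borel)) (\<lambda>p \<omega>. restrict (\<lambda>q. (\<lambda>(i, j). \<epsilon> i j) q \<omega>) (K p)) L"
  proof (rule indep_vars_restrict[OF \<epsilon>_indep])
    show "disjoint_family_on K L"
      unfolding disjoint_family_on_def
    proof (intro ballI impI)
      fix p p' assume pp: "p \<in> L" "p' \<in> L" "p \<noteq> p'"
      show "K p \<inter> K p' = {}" using assms[OF pp] by (auto simp: K_def)
    qed
  qed auto
  moreover have "(\<lambda>z. G (coupled k (\<lambda>l. z (i p, j p + l)) c)) \<in> borel_measurable (PiM (K p) (\<lambda>_. borel))" for p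
  proof -
    have "(\<lambda>z. coupled k (\<lambda>l. z (i p, j p + l)) c) \<in> measurable (PiM (K p) (\<lambda>_. borel)) (PiM UNIV (\<lambda>_. borel))"
    proof -
      have "(\<lambda>z. if \<bar>l\<bar> \<le> int k then z (i p, j p + l) else c l) \<in> borel_measurable (PiM (K p) (\<lambda>_. borel))" for l
        by (cases "\<bar>l\<bar> \<le> int k") (auto intro!: measurable_component_singleton simp: K_def)
      then show ?thesis unfolding coupled_def by (intro measurable_PiM_single') auto
    qed
    from measurable_compose[OF this G] show ?thesis .
  qed
  ultimately have "indep_vars (\<lambda>_. borel) (\<lambda>p \<omega>. (\<lambda>z. G (coupled k (\<lambda>l. z (i p, j p + l)) c)) (restrict (\<lambda>q. (\<lambda>(i, j). \<epsilon> i j) q \<omega>) (K p))) L"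
    by (rule indep_vars_compose2[where Y="\<lambda>p z. G (coupled k (\<lambda>l. z (i p, j p + l)) c)"])
  also have "(\<lambda>p \<omega>. (\<lambda>z. G (coupled k (\<lambda>l. z (i p, j p + l)) c)) (restrict (\<lambda>q. (\<lambda>(i, j). \<epsilon> i j) q \<omega>) (K p)))
     = (\<lambda>p. err_trunc G \<epsilon> k c (i p) (j p))"
    by (auto simp: fun_eq_iff err_trunc_def coupled_def K_def intro!: arg_cong[of _ _ G])
  finally show ?thesis .
qed

text \<open>By Fubini, the independent copy in the coupling can be frozen at a suitable deterministic
  sequence without increasing the \<open>L\<^sup>q\<close> distance; this keeps the \<open>k\<close>-dependent approximation on the
  original probability space.\<close>

lemma frozen_coupling:
  assumes "cond_D \<nu> G"
  obtains q \<rho> C c where "0 < q" "0 < \<rho>" "\<rho> < 1" "0 < C"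
    "\<forall>\<^sub>F k in sequentially. integrable (PiM UNIV (\<lambda>_. \<nu>)) (\<lambda>u. \<bar>G u - G (coupled k u (c k))\<bar> powr q) \<and>
       (\<integral>u. \<bar>G u - G (coupled k u (c k))\<bar> powr q \<partial>PiM UNIV (\<lambda>_. \<nu>)) \<le> C * (\<rho> ^ k) powr q"
proof -
  define P where "P = PiM (UNIV :: int set) (\<lambda>_. \<nu>)"
  interpret P: prob_space P unfolding P_def by (rule prob_space_PiM) (rule prob_space_\<nu>)
  interpret PP: pair_sigma_finite P P ..
  define \<Delta> where "\<Delta> k z = G (fst z) - G (coupled k (fst z) (snd z))" for k z
  have \<Delta>: "(\<lambda>(u, u'). G u - G (coupled k u u')) = \<Delta> k" for k by (auto simp: \<Delta>_def)
  from assms obtain q \<rho> where q: "0 < q" and \<rho>: "0 < \<rho>" "\<rho> < 1"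
    and int: "\<forall>\<^sub>F k in sequentially. integrable (P \<Otimes>\<^sub>M P) (\<lambda>z. \<bar>\<Delta> k z\<bar> powr q)"
    and O: "(\<lambda>k. Lq_norm (P \<Otimes>\<^sub>M P) q (\<Delta> k)) \<in> O(\<lambda>k. \<rho> ^ k)"
    unfolding cond_D_def Let_def P_def[symmetric] \<Delta> by auto
  from O obtain C where C: "0 < C" "\<forall>\<^sub>F k in sequentially. norm (Lq_norm (P \<Otimes>\<^sub>M P) q (\<Delta> k)) \<le> C * norm (\<rho> ^ k)"
    by (elim landau_o.bigE)
  have ex: "\<forall>\<^sub>F k in sequentially. \<exists>c. integrable P (\<lambda>u. \<bar>G u - G (coupled k u c)\<bar> powr q) \<and>
       (\<integral>u. \<bar>G u - G (coupled k u c)\<bar> powr q \<partial>P) \<le> C powr q * (\<rho> ^ k) powr q"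
    using int C(2)
  proof eventually_elim
    case (elim k)
    define I where "I = (\<integral>z. \<bar>\<Delta> k z\<bar> powr q \<partial>(P \<Otimes>\<^sub>M P))"
    have I0: "0 \<le> I" unfolding I_def by (rule integral_nonneg_AE) simp
    have "I powr (1/q) \<le> C * \<rho> ^ k" using elim(2) \<rho> unfolding Lq_norm_def I_def by simp
    then have "(I powr (1/q)) powr q \<le> (C * \<rho> ^ k) powr q" using q by (intro powr_mono2) auto
    then have I: "I \<le> C powr q * (\<rho> ^ k) powr q" using q I0 C \<rho> by (simp add: powr_powr powr_mult)
    define f where "f = (\<lambda>(u', u). \<bar>\<Delta> k (u, u')\<bar> powr q)"
    have fi: "integrable (P \<Otimes>\<^sub>M P) f"
      using PP.integrable_product_swap[OF elim(1)] by (simp add: f_def)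
    have fI: "(\<integral>u'. \<integral>u. f (u', u) \<partial>P \<partial>P) = I"
      using PP.integral_fst'[OF fi] PP.integral_product_swap[of "\<lambda>z. \<bar>\<Delta> k z\<bar> powr q"] elim(1)
      by (simp add: f_def I_def borel_measurable_integrable)
    \<comment> \<open>An integrable function cannot exceed its mean almost everywhere. As almost all
      sections are integrable, some \<open>c\<close> has an integrable section with integral at most
      the mean.\<close>
    have "\<exists>c. integrable P (\<lambda>u. f (c, u)) \<and> (\<integral>u. f (c, u) \<partial>P) \<le> I"
    proof (rule ccontr)
      assume "\<nexists>c. integrable P (\<lambda>u. f (c, u)) \<and> (\<integral>u. f (c, u) \<partial>P) \<le> I"
      then have "AE c in P. I < (\<integral>u. f (c, u) \<partial>P)"
        using PP.AE_integrable_fst'[OF fi] by (auto simp: not_le)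
      then have "I < (\<integral>c. \<integral>u. f (c, u) \<partial>P \<partial>P)"
        by (rule P.expectation_greater[OF PP.integrable_fst'[OF fi]])
      with fI show False by simp
    qed
    then show ?case using I by (auto simp: f_def \<Delta>_def intro: order_trans)
  qed
  define c where "c k = (SOME c. integrable P (\<lambda>u. \<bar>G u - G (coupled k u c)\<bar> powr q) \<and>
       (\<integral>u. \<bar>G u - G (coupled k u c)\<bar> powr q \<partial>P) \<le> C powr q * (\<rho> ^ k) powr q)" for k
  have "\<forall>\<^sub>F k in sequentially. integrable P (\<lambda>u. \<bar>G u - G (coupled k u (c k))\<bar> powr q) \<and>
       (\<integral>u. \<bar>G u - G (coupled k u (c k))\<bar> powr q \<partial>P) \<le> C powr q * (\<rho> ^ k) powr q"
  proof (use ex in eventually_elim)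
    case (elim k)
    from someI_ex[OF this] show ?case unfolding c_def[symmetric] .
  qed
  with q \<rho> C show thesis by (intro that[of q \<rho> "C powr q" c]) (auto simp: P_def)
qed

text \<open>Markov's inequality for the \<open>q\<close>-th power, after transport to the canonical
  product space on which the coupling bound is stated.\<close>

lemma err_trunc_tail:
  assumes "0 < q" "0 < \<tau>"
    and int: "integrable (PiM UNIV (\<lambda>_. \<nu>)) (\<lambda>u. \<bar>G u - G (coupled k u c)\<bar> powr q)"
    and le: "(\<integral>u. \<bar>G u - G (coupled k u c)\<bar> powr q \<partial>PiM UNIV (\<lambda>_. \<nu>)) \<le> E"
  shows "prob {\<omega>\<in>space M. \<tau> < \<bar>err G \<epsilon> i j \<omega> - err_trunc G \<epsilon> k c i j \<omega>\<bar>} \<le> E / \<tau> powr q"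
proof -
  define D where "D \<omega> = err G \<epsilon> i j \<omega> - err_trunc G \<epsilon> k c i j \<omega>" for \<omega>
  have [measurable]: "D \<in> borel_measurable M" unfolding D_def[abs_def] by measurable
  have [measurable]: "(\<lambda>u. G u - G (coupled k u c)) \<in> borel_measurable (PiM UNIV (\<lambda>_. \<nu>))"
  proof -
    have "(\<lambda>u. G u - G (coupled k u c)) \<in> borel_measurable (PiM UNIV (\<lambda>_. borel))"
      by (intro borel_measurable_diff G measurable_compose[OF coupled_fst_measurable G])
    moreover have "sets (PiM UNIV (\<lambda>_. \<nu>)) = sets (PiM (UNIV :: int set) (\<lambda>_. borel))"
      by (rule sets_PiM_cong) auto
    ultimately show ?thesis using measurable_cong_sets by blast
  qed
  have D: "distr M borel D = distr (PiM UNIV (\<lambda>_. \<nu>)) borel (\<lambda>u. G u - G (coupled k u c))"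
    unfolding D_def[abs_def] by (rule err_diff_distr)
  have "integrable (distr M borel D) (\<lambda>x. \<bar>x\<bar> powr q)"
    unfolding D using int by (subst integrable_distr_eq) auto
  then have i: "integrable M (\<lambda>\<omega>. \<bar>D \<omega>\<bar> powr q)" by (subst (asm) integrable_distr_eq) auto
  have "expectation (\<lambda>\<omega>. \<bar>D \<omega>\<bar> powr q) = (\<integral>x. \<bar>x\<bar> powr q \<partial>distr M borel D)"
    by (subst integral_distr) auto
  also have "\<dots> \<le> E" unfolding D using le by (subst integral_distr) auto
  finally have E: "expectation (\<lambda>\<omega>. \<bar>D \<omega>\<bar> powr q) \<le> E" .
  have "prob {\<omega>\<in>space M. \<tau> < \<bar>D \<omega>\<bar>} \<le> prob {\<omega>\<in>space M. \<tau> powr q \<le> \<bar>D \<omega>\<bar> powr q}"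
    using assms by (intro finite_measure_mono) (auto intro: powr_mono2)
  also have "\<dots> \<le> expectation (\<lambda>\<omega>. \<bar>D \<omega>\<bar> powr q) / \<tau> powr q"
    using i assms by (intro integral_Markov_inequality_measure[where A="{}"]) auto
  also have "\<dots> \<le> E / \<tau> powr q" using E by (intro divide_right_mono) auto
  finally show ?thesis by (simp add: D_def)
qed

end

section \<open>The model and its truncation\<close>

locale lad_setting = iid_errors M \<epsilon> G
  for M :: "'a measure" and \<epsilon> G +
  fixes m :: "nat \<Rightarrow> nat \<Rightarrow> nat" and x :: "nat \<Rightarrow> nat \<Rightarrow> nat \<Rightarrow> real" and a b d :: real
    and \<mu> s f K :: "real \<Rightarrow> real" and bw :: "nat \<Rightarrow> real" and R B\<^sub>K q \<rho> C\<^sub>D :: real and c :: "nat \<Rightarrow> int \<Rightarrow> real"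
  assumes density: "\<And>u. (cdf (distr M borel (err G \<epsilon> 0 0)) has_real_derivative f u) (at u)"
    and median: "cdf (distr M borel (err G \<epsilon> 0 0)) 0 = 1 / 2"
    and ab: "a < b" and d: "0 < d"
    and N_lim: "filterlim (sample_size m) at_top sequentially"
    and X: "cond_X a b m x" and S: "cond_S a b \<mu> s f"
    and bw_pos: "\<And>n. 0 < bw n" and bw_lim: "bw \<longlonglongrightarrow> 0"
    and bw_rate: "(\<lambda>n. ln (real (sample_size m n)) ^ 3 / (real (sample_size m n) * bw n)) \<longlonglongrightarrow> 0"
    and K_nonneg: "\<And>u. 0 \<le> K u" and K_sym: "\<And>u. K (- u) = K u" and K_le: "\<And>u. K u \<le> B\<^sub>K"
    and K_lip: "\<And>u v. \<bar>K u - K v\<bar> \<le> B\<^sub>K * \<bar>u - v\<bar>" and K_supp: "\<And>u. R < \<bar>u\<bar> \<Longrightarrow> K u = 0"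
    and K_int: "integral {-R..R} K = 1" "integral {-R..R} (\<lambda>u. K u * u\<^sup>2) = 2 * psi_K K"
    and R: "0 < R" and B\<^sub>K: "0 < B\<^sub>K"
    and q: "0 < q" and \<rho>: "0 < \<rho>" "\<rho> < 1" and C\<^sub>D: "0 < C\<^sub>D"
    and coupling: "\<forall>\<^sub>F k in sequentially.
       integrable (PiM UNIV (\<lambda>_. distr M borel (\<epsilon> 0 0))) (\<lambda>u. \<bar>G u - G (coupled k u (c k))\<bar> powr q) \<and>
       (\<integral>u. \<bar>G u - G (coupled k u (c k))\<bar> powr q \<partial>PiM UNIV (\<lambda>_. distr M borel (\<epsilon> 0 0))) \<le> C\<^sub>D * (\<rho> ^ k) powr q"
begin

definition N :: "nat \<Rightarrow> real" where "N n = real (sample_size m n)"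
definition l :: "nat \<Rightarrow> real" where "l n = ln (N n)"
definition NB :: "nat \<Rightarrow> real" where "NB n = N n * bw n"

text \<open>With this rate \<open>y\<^sub>n\<close>, the two rates of the theorem are \<open>b\<^sub>n\<^sup>2 + y\<^sub>n\<^sup>2\<close> and
  \<open>b\<^sub>n\<^sup>4 + b\<^sub>n y\<^sub>n\<^sup>2 + y\<^sub>n\<^sup>3\<close>.\<close>

definition y :: "nat \<Rightarrow> real" where "y n = l n powr (3/4) / NB n powr (1/4)"

definition F :: "real \<Rightarrow> real" where "F = cdf (distr M borel (err G \<epsilon> 0 0))"

text \<open>The factor makes \<open>(\<rho> ^ lag n) powr q\<close> at most
  \<open>N n powr (- (q + 3))\<close>: the share \<open>q\<close> of the exponent is spent on the
  threshold \<open>1 / N n\<close> in Markov's inequality, and 3 remains for the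
  probability.\<close>

definition lag :: "nat \<Rightarrow> nat" where "lag n = nat \<lceil>(q + 3) / (q * ln (1 / \<rho>)) * l n\<rceil>"

definition e :: "nat \<times> nat \<Rightarrow> 'a \<Rightarrow> real" where "e p = err G \<epsilon> (int (fst p)) (int (snd p))"

definition et :: "nat \<Rightarrow> nat \<times> nat \<Rightarrow> 'a \<Rightarrow> real" where
  "et n p = err_trunc G \<epsilon> (lag n) (c (lag n)) (int (fst p)) (int (snd p))"

definition Ft :: "nat \<Rightarrow> real \<Rightarrow> real" where
  "Ft n = cdf (distr M borel (err_trunc G \<epsilon> (lag n) (c (lag n)) 0 0))"

text \<open>At a design point \<open>z\<close>, an observation is at most \<theta> exactly when its
  error is at most \<open>lev \<theta> z\<close>.\<close>

definition lev :: "real \<Rightarrow> real \<Rightarrow> real" where "lev \<theta> z = (\<theta> - \<mu> z) / s z"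

definition w :: "nat \<Rightarrow> real \<Rightarrow> nat \<times> nat \<Rightarrow> real" where "w n t p = K ((pt x n p - t) / bw n)"

text \<open>At \<open>\<theta> = \<mu> t\<close> this is the negative of \<open>Q_process\<close>;
  at other levels it is the centred part of the function whose sign locates the minimizer.\<close>

definition emp :: "nat \<Rightarrow> real \<Rightarrow> real \<Rightarrow> 'a \<Rightarrow> real" where
  "emp n t \<theta> \<omega> = (\<Sum>p\<in>obs m n. w n t p * (of_bool (e p \<omega> \<le> lev \<theta> (pt x n p)) - F (lev \<theta> (pt x n p))))"

definition empt :: "nat \<Rightarrow> real \<Rightarrow> real \<Rightarrow> 'a \<Rightarrow> real" where
  "empt n t \<theta> \<omega> = (\<Sum>p\<in>obs m n. w n t p * (of_bool (et n p \<omega> \<le> lev \<theta> (pt x n p)) - Ft n (lev \<theta> (pt x n p))))"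

lemma e_rv[measurable]: "e p \<in> borel_measurable M" by (simp add: e_def)
lemma et_rv[measurable]: "et n p \<in> borel_measurable M" by (simp add: et_def)

lemma cdf_rv: "X \<in> borel_measurable M \<Longrightarrow> cdf (distr M borel X) u = prob {\<omega>\<in>space M. X \<omega> \<le> u}"
  by (simp add: cdf_def measure_distr vimage_def Int_def conj_commute)

lemma F_eq: "F u = prob {\<omega>\<in>space M. e p \<omega> \<le> u}"
  unfolding F_def e_def using err_distr[of "int (fst p)" "int (snd p)"] cdf_rv[OF err_rv] by metis

lemma Ft_eq: "Ft n u = prob {\<omega>\<in>space M. et n p \<omega> \<le> u}"
  unfolding Ft_def et_def
  using err_trunc_distr[of "lag n" "c (lag n)" "int (fst p)" "int (snd p)"] cdf_rv[OF err_trunc_rv] by metis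

lemma F_bounds: "0 \<le> F u" "F u \<le> 1" unfolding F_eq[of _ "(0, 0)"] by auto
lemma Ft_bounds: "0 \<le> Ft n u" "Ft n u \<le> 1" unfolding Ft_eq[of _ _ "(0, 0)"] by auto

lemma F_deriv: "(F has_real_derivative f u) (at u)" unfolding F_def by (rule density)

lemma f_bounded: obtains B where "0 < B" "\<And>u. \<bar>f u\<bar> \<le> B"
proof -
  from S have "bounded_derivs 4 UNIV f" by (simp add: cond_S_def)
  then obtain D :: "nat \<Rightarrow> real \<Rightarrow> real" where "\<forall>x\<in>UNIV. D 0 x = f x" "\<forall>k\<le>4. bounded (D k ` UNIV)"
    unfolding bounded_derivs_def by blast
  then have "D 0 = f" "bounded (range (D 0))" by (auto simp: fun_eq_iff)
  then have "bounded (range f)" by simp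
  then show thesis using that unfolding bounded_pos by auto
qed

lemma F_lipschitz: obtains B where "0 < B" "\<And>u v. \<bar>F u - F v\<bar> \<le> B * \<bar>u - v\<bar>"
proof -
  from f_bounded obtain B where B: "0 < B" "\<And>u. \<bar>f u\<bar> \<le> B" by blast
  show thesis
    using field_differentiable_bound[of UNIV F f B] F_deriv B by (intro that[of B]) auto
qed

lemma s_bounds:
  obtains s\<^sub>0 S\<^sub>0 where "0 < s\<^sub>0" "0 < S\<^sub>0" "\<And>z. z \<in> {a..b} \<Longrightarrow> s\<^sub>0 \<le> s z" "\<And>z. z \<in> {a..b} \<Longrightarrow> s z \<le> S\<^sub>0"
proof -
  have bs: "bounded_derivs 4 {a..b} s" and inf: "(INF x\<in>{a..b}. s x) > 0" using S by (auto simp: cond_S_def)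
  obtain B where B: "0 \<le> B" "\<And>x. x \<in> {a..b} \<Longrightarrow> \<bar>s x\<bar> \<le> B"
    by (rule bounded_derivs_lipschitz[OF bs]) auto
  have bdd: "bdd_below (s ` {a..b})" by (intro bdd_belowI2[of _ "-B"]) (meson B abs_le_D2 minus_le_iff)
  show thesis
  proof (rule that[of "INF x\<in>{a..b}. s x" "B + 1"])
    show "(INF x\<in>{a..b}. s x) \<le> s z" if "z \<in> {a..b}" for z using bdd that by (intro cINF_lower)
    show "s z \<le> B + 1" if "z \<in> {a..b}" for z using B(2)[OF that] by auto
  qed (use inf B in auto)
qed

lemma \<mu>_bounded: obtains B where "0 \<le> B" "\<And>z. z \<in> {a..b} \<Longrightarrow> \<bar>\<mu> z\<bar> \<le> B"
proof -
  have "bounded_derivs 4 {a..b} \<mu>" using S by (auto simp: cond_S_def)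
  from bounded_derivs_lipschitz[OF this] show thesis using that by (metis one_le_numeral)
qed

lemma pt_in: "p \<in> obs m n \<Longrightarrow> pt x n p \<in> {a..b}"
  by (rule cond_X_enumeration[OF X N_lim]) auto

section \<open>Asymptotics of the rates\<close>

lemma N_at_top: "filterlim N at_top sequentially"
  unfolding N_def using filterlim_compose[OF filterlim_real_sequentially N_lim] by simp

lemma l_at_top: "filterlim l at_top sequentially"
  unfolding l_def by (rule filterlim_compose[OF ln_at_top N_at_top])

lemma l_ge: "\<forall>\<^sub>F n in sequentially. z \<le> l n"
  using l_at_top unfolding filterlim_at_top by blast

lemma N_ge: "\<forall>\<^sub>F n in sequentially. z \<le> N n"
  using N_at_top unfolding filterlim_at_top by blast

lemma rate_tendsto: "(\<lambda>n. l n ^ 3 / NB n) \<longlonglongrightarrow> 0"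
  using bw_rate by (simp add: l_def NB_def N_def)

text \<open>The bandwidth condition makes \<open>NB n\<close> eventually larger than
  \<open>l n ^ 3\<close>, hence than \<open>l n\<close>.\<close>

lemma NB_at_top: "filterlim NB at_top sequentially"
proof (rule filterlim_at_top_mono[OF l_at_top])
  have "\<forall>\<^sub>F n in sequentially. l n ^ 3 / NB n < 1" by (rule order_tendstoD(2)[OF rate_tendsto]) simp
  then show "\<forall>\<^sub>F n in sequentially. l n \<le> NB n"
    using l_ge[of 1] N_ge[of 1]
  proof eventually_elim
    case (elim n)
    have "0 < NB n" using elim bw_pos[of n] by (simp add: NB_def)
    then have "l n ^ 3 < NB n" using elim by (simp add: field_simps)
    moreover have "l n ^ 1 \<le> l n ^ 3" by (rule power_increasing) (use elim in auto)
    ultimately show ?case by simp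
  qed
qed

lemma NB_ge: "\<forall>\<^sub>F n in sequentially. z \<le> NB n"
  using NB_at_top unfolding filterlim_at_top by blast

lemma y_power4: assumes "0 < l n" "0 < NB n" shows "y n ^ 4 = l n ^ 3 / NB n"
  using assms by (simp add: y_def power_divide powr_power)

lemma y_tendsto: "y \<longlonglongrightarrow> 0"
proof -
  have "(\<lambda>n. root 4 (l n ^ 3 / NB n)) \<longlonglongrightarrow> 0"
    using tendsto_real_root[OF rate_tendsto, of 4] by simp
  moreover have "\<forall>\<^sub>F n in sequentially. root 4 (l n ^ 3 / NB n) = y n"
    using NB_ge[of 1] l_ge[of 1]
  proof eventually_elim
    case (elim n)
    have "0 \<le> y n" by (simp add: y_def)
    then show ?case using y_power4[of n] elim by (simp add: real_root_power_cancel flip: y_power4)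
  qed
  ultimately show ?thesis by (rule Lim_transform_eventually)
qed

text \<open>The last two conditions absorb errors: bounded terms are at most a multiple of
  \<open>NB n * y n ^ 3\<close>, and the mesh \<open>1 / N n\<close> of the levels is below
  \<open>(y n)\<^sup>2\<close>. Both rest on \<open>NB n * y n ^ 4 = l n ^ 3 \<ge> 1\<close> with
  \<open>y n \<le> 1\<close>.\<close>

abbreviation regular :: "nat \<Rightarrow> bool" where
  "regular n \<equiv> 1 \<le> l n \<and> 1 \<le> NB n \<and> 1 \<le> N n \<and> bw n \<le> 1 \<and> 0 < y n \<and> y n \<le> 1 \<and>
    NB n * y n ^ 4 = l n ^ 3 \<and> 1 \<le> NB n * y n ^ 3 \<and> 1 / N n \<le> (y n)\<^sup>2"

lemma rates: "\<forall>\<^sub>F n in sequentially. regular n"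
proof -
  have y1: "\<forall>\<^sub>F n in sequentially. y n < 1" by (rule order_tendstoD(2)[OF y_tendsto]) simp
  have b1: "\<forall>\<^sub>F n in sequentially. bw n < 1" by (rule order_tendstoD(2)[OF bw_lim]) simp
  show ?thesis
    using l_ge[of 1] NB_ge[of 1] N_ge[of 1] y1 b1
  proof eventually_elim
    case (elim n)
    have y0: "0 < y n" using elim by (simp add: y_def)
    have 4: "NB n * y n ^ 4 = l n ^ 3" using y_power4[of n] elim by simp
    have "1 \<le> l n ^ 3" using elim by (simp add: one_le_power)
    also have "\<dots> = NB n * y n ^ 3 * y n" unfolding 4[symmetric] by (simp add: eval_nat_numeral)
    also have "\<dots> \<le> NB n * y n ^ 3 * 1" using elim y0 by (intro mult_left_mono) auto
    finally have 3: "1 \<le> NB n * y n ^ 3" by simp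
    have "NB n * y n ^ 3 \<le> N n * y n ^ 2"
    proof -
      have "bw n * y n \<le> 1 * 1" using elim y0 bw_pos[of n] by (intro mult_mono) auto
      then have "N n * y n ^ 2 * (bw n * y n) \<le> N n * y n ^ 2 * 1"
        using elim by (intro mult_left_mono) auto
      then show ?thesis by (simp add: NB_def eval_nat_numeral mult_ac)
    qed
    with 3 elim have "1 / N n \<le> (y n)\<^sup>2" by (simp add: field_simps)
    with 3 4 y0 elim show ?case by auto
  qed
qed

lemma lag_at_top: "filterlim lag at_top sequentially"
proof -
  have pos: "0 < (q + 3) / (q * ln (1 / \<rho>))" using q \<rho> by (intro divide_pos_pos mult_pos_pos) (auto simp: ln_div)
  have lim: "filterlim (\<lambda>n. (q + 3) / (q * ln (1 / \<rho>)) * l n) at_top sequentially"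
    by (rule filterlim_tendsto_pos_mult_at_top[OF tendsto_const pos l_at_top])
  show ?thesis
    unfolding filterlim_at_top
  proof
    fix Z :: nat
    have "\<forall>\<^sub>F n in sequentially. real Z \<le> (q + 3) / (q * ln (1 / \<rho>)) * l n"
      using lim unfolding filterlim_at_top by blast
    then show "\<forall>\<^sub>F n in sequentially. Z \<le> lag n"
    proof eventually_elim
      case (elim n)
      then have "real Z \<le> real (lag n)" unfolding lag_def by linarith
      then show ?case by simp
    qed
  qed
qed

section \<open>The cost of truncating the errors\<close>

lemma trunc_tail: "\<forall>\<^sub>F n in sequentially. \<forall>p. prob {\<omega>\<in>space M. 1 / N n < \<bar>e p \<omega> - et n p \<omega>\<bar>} \<le> C\<^sub>D / N n ^ 3"
proof -
  have "\<forall>\<^sub>F n in sequentially.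
       integrable (PiM UNIV (\<lambda>_. distr M borel (\<epsilon> 0 0))) (\<lambda>u. \<bar>G u - G (coupled (lag n) u (c (lag n)))\<bar> powr q) \<and>
       (\<integral>u. \<bar>G u - G (coupled (lag n) u (c (lag n)))\<bar> powr q \<partial>PiM UNIV (\<lambda>_. distr M borel (\<epsilon> 0 0))) \<le> C\<^sub>D * (\<rho> ^ lag n) powr q"
    by (rule eventually_compose_filterlim[OF coupling lag_at_top])
  then show ?thesis
    using N_ge[of 1]
  proof (eventually_elim, intro allI)
    fix n p
    assume cp: "integrable (PiM UNIV (\<lambda>_. distr M borel (\<epsilon> 0 0))) (\<lambda>u. \<bar>G u - G (coupled (lag n) u (c (lag n)))\<bar> powr q) \<and>
       (\<integral>u. \<bar>G u - G (coupled (lag n) u (c (lag n)))\<bar> powr q \<partial>PiM UNIV (\<lambda>_. distr M borel (\<epsilon> 0 0))) \<le> C\<^sub>D * (\<rho> ^ lag n) powr q"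
      and N1: "1 \<le> N n"
    have l0: "0 \<le> l n" using N1 by (simp add: l_def)
    have r: "0 < ln (1 / \<rho>)" using \<rho> by (simp add: ln_div)
    have "(q + 3) / (q * ln (1 / \<rho>)) * l n \<le> real (lag n)" unfolding lag_def by linarith
    then have "(q + 3) * l n \<le> real (lag n) * (q * ln (1 / \<rho>))" using r q by (simp add: field_simps)
    also have "\<dots> = - (q * (real (lag n) * ln \<rho>))" using \<rho> by (simp add: ln_div)
    finally have le: "q * (real (lag n) * ln \<rho>) \<le> - ((q + 3) * l n)" by simp
    have "(\<rho> ^ lag n) powr q = exp (q * (real (lag n) * ln \<rho>))"
      using \<rho> by (simp add: powr_def ln_realpow)
    also have "\<dots> \<le> exp (- ((q + 3) * l n))" using le by simp
    also have "\<dots> = N n powr (- (q + 3))" using N1 by (simp add: powr_def l_def algebra_simps)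
    finally have le2: "(\<rho> ^ lag n) powr q \<le> N n powr (- (q + 3))" .
    have "prob {\<omega>\<in>space M. 1 / N n < \<bar>e p \<omega> - et n p \<omega>\<bar>} \<le> C\<^sub>D * (\<rho> ^ lag n) powr q / (1 / N n) powr q"
      unfolding e_def et_def by (rule err_trunc_tail) (use cp q N1 in auto)
    also have "\<dots> \<le> C\<^sub>D * N n powr (- (q + 3)) / (1 / N n) powr q"
      using le2 C\<^sub>D by (intro divide_right_mono mult_left_mono) auto
    also have "\<dots> = C\<^sub>D * (N n powr (- (q + 3)) * N n powr q)"
      using N1 by (simp add: powr_divide)
    also have "N n powr (- (q + 3)) * N n powr q = 1 / N n ^ 3"
    proof -
      have "N n powr (- (q + 3)) * N n powr q = N n powr (- 3)" by (simp only: powr_add[symmetric]) simp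
      also have "\<dots> = 1 / N n powr 3" by (rule powr_minus_divide)
      finally show ?thesis using N1 by simp
    qed
    finally show "prob {\<omega>\<in>space M. 1 / N n < \<bar>e p \<omega> - et n p \<omega>\<bar>} \<le> C\<^sub>D / N n ^ 3" by simp
  qed
qed

text \<open>Off an event of probability \<open>O(1 / N n)\<close> the two errors differ by at most
  \<open>1 / N n\<close>, so up to that probability \<open>Ft n u\<close> lies between the values of
  \<open>F\<close> at \<open>u - 1 / N n\<close> and \<open>u + 1 / N n\<close>. Only
  \<open>F\<close> has to be Lipschitz; no smoothness of \<open>Ft n\<close> is available.\<close>

lemma Ft_close: obtains C where "0 < C" "\<forall>\<^sub>F n in sequentially. \<forall>u. \<bar>Ft n u - F u\<bar> \<le> C / N n"
proof -
  obtain B where B: "0 < B" "\<And>u v. \<bar>F u - F v\<bar> \<le> B * \<bar>u - v\<bar>" by (rule F_lipschitz) (rule that, assumption+)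
  show thesis
  proof (rule that[of "B + C\<^sub>D"])
    show "0 < B + C\<^sub>D" using B C\<^sub>D by simp
    show "\<forall>\<^sub>F n in sequentially. \<forall>u. \<bar>Ft n u - F u\<bar> \<le> (B + C\<^sub>D) / N n"
      using trunc_tail N_ge[of 1]
    proof (eventually_elim, intro allI)
      fix n u
      assume tail: "\<forall>p. prob {\<omega>\<in>space M. 1 / N n < \<bar>e p \<omega> - et n p \<omega>\<bar>} \<le> C\<^sub>D / N n ^ 3" and N1: "1 \<le> N n"
      define p :: "nat \<times> nat" where "p = (0, 0)"
      define T where "T = {\<omega>\<in>space M. 1 / N n < \<bar>e p \<omega> - et n p \<omega>\<bar>}"
      have T: "T \<in> events" unfolding T_def by measurable
      have "prob T \<le> C\<^sub>D / N n ^ 3" using spec[OF tail, of p] by (simp only: T_def)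
      also have "\<dots> \<le> C\<^sub>D / N n" using N1 C\<^sub>D self_le_power[of "N n" 3] by (intro divide_left_mono) auto
      finally have pT: "prob T \<le> C\<^sub>D / N n" .
      have dF: "\<bar>F (u + 1 / N n) - F u\<bar> \<le> B / N n" "\<bar>F (u - 1 / N n) - F u\<bar> \<le> B / N n"
        using B(2)[of "u + 1 / N n" u] B(2)[of "u - 1 / N n" u] N1 by auto
      have "Ft n u \<le> prob ({\<omega>\<in>space M. e p \<omega> \<le> u + 1 / N n} \<union> T)"
        unfolding Ft_eq[of n u p] by (rule finite_measure_mono) (use T in \<open>auto simp: T_def\<close>)
      also have "\<dots> \<le> F (u + 1 / N n) + prob T"
        unfolding F_eq[of _ p] by (rule measure_Un_le) (use T in auto)
      finally have 1: "Ft n u \<le> F (u + 1 / N n) + prob T" .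
      have "F (u - 1 / N n) \<le> prob ({\<omega>\<in>space M. et n p \<omega> \<le> u} \<union> T)"
        unfolding F_eq[of _ p] by (rule finite_measure_mono) (use T in \<open>auto simp: T_def\<close>)
      also have "\<dots> \<le> Ft n u + prob T"
        unfolding Ft_eq[of _ _ p] by (rule measure_Un_le) (use T in auto)
      finally have 2: "F (u - 1 / N n) \<le> Ft n u + prob T" .
      show "\<bar>Ft n u - F u\<bar> \<le> (B + C\<^sub>D) / N n"
        using 1 2 dF pT unfolding add_divide_distrib by linarith
    qed
  qed
qed

lemma card_obs_N: "real (card (obs m n)) = N n" by (simp add: card_obs N_def)

lemma w_nonneg: "0 \<le> w n t p" and w_le: "w n t p \<le> B\<^sub>K"
  by (auto simp: w_def K_nonneg K_le)

lemma w_lipschitz: "\<bar>w n t p - w n t' p\<bar> \<le> B\<^sub>K * \<bar>t - t'\<bar> / bw n"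
proof -
  have "\<bar>w n t p - w n t' p\<bar> \<le> B\<^sub>K * \<bar>(pt x n p - t) / bw n - (pt x n p - t') / bw n\<bar>"
    unfolding w_def by (rule K_lip)
  also have "(pt x n p - t) / bw n - (pt x n p - t') / bw n = (t' - t) / bw n"
    by (simp add: diff_divide_distrib)
  also have "\<bar>\<dots>\<bar> = \<bar>t - t'\<bar> / bw n" using bw_pos[of n] by (simp add: abs_minus_commute)
  finally show ?thesis by simp
qed

abbreviation sandwich :: "real \<Rightarrow> real \<Rightarrow> nat \<Rightarrow> bool" where
  "sandwich S\<^sub>0 C n \<equiv> \<forall>\<omega>. (\<forall>p\<in>obs m n. \<bar>e p \<omega> - et n p \<omega>\<bar> \<le> 1 / N n) \<longrightarrow> (\<forall>t \<theta>.
     emp n t \<theta> \<omega> \<le> empt n (bw n * \<lfloor>t * N n / bw n\<rfloor> / N n) (\<lceil>\<theta> * N n + S\<^sub>0\<rceil> / N n) \<omega> + C \<and>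
     empt n (bw n * \<lfloor>t * N n / bw n\<rfloor> / N n) (\<lfloor>\<theta> * N n - S\<^sub>0\<rfloor> / N n) \<omega> - C \<le> emp n t \<theta> \<omega>)"

text \<open>Monotonicity in the level lets a grid of mesh \<open>1/N\<close> control all levels at once, and absorbs the
  replacement of the errors by their truncated versions.\<close>

lemma emp_sandwich:
  obtains S\<^sub>0 C where "0 < S\<^sub>0" "0 < C" "\<forall>\<^sub>F n in sequentially. sandwich S\<^sub>0 C n"
proof -
  obtain s\<^sub>0 S\<^sub>0 where s: "0 < s\<^sub>0" "0 < S\<^sub>0" "\<And>z. z \<in> {a..b} \<Longrightarrow> s\<^sub>0 \<le> s z" "\<And>z. z \<in> {a..b} \<Longrightarrow> s z \<le> S\<^sub>0"
    by (rule s_bounds) (rule that, assumption+)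
  obtain B where B: "0 < B" "\<And>u v. \<bar>F u - F v\<bar> \<le> B * \<bar>u - v\<bar>" by (rule F_lipschitz) (rule that, assumption+)
  obtain C1 where C1: "0 < C1" "\<forall>\<^sub>F n in sequentially. \<forall>u. \<bar>Ft n u - F u\<bar> \<le> C1 / N n" by (rule Ft_close) (rule that, assumption+)
  \<comment> \<open>\<open>C1\<close> accounts for \<open>Ft n\<close> against \<open>F\<close>, the
    second summand for moving the level by at most \<open>(S\<^sub>0 + 1) / N n\<close>. Either
    costs \<open>O(1 / N n)\<close> in each of \<open>N n\<close> summands, hence a constant in
    total.\<close>
  define C2 where "C2 = C1 + B * ((S\<^sub>0 + 1) / s\<^sub>0)"
  have C2: "0 < C2" using C1(1) B(1) s(1,2) by (simp add: C2_def add_pos_pos)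
  show thesis
  proof (rule that[of S\<^sub>0 "B\<^sub>K * C2 + B\<^sub>K"])
    show "0 < S\<^sub>0" by (rule s(2))
    show "0 < B\<^sub>K * C2 + B\<^sub>K" using B\<^sub>K C2 by (intro add_pos_pos mult_pos_pos)
    show "\<forall>\<^sub>F n in sequentially. sandwich S\<^sub>0 (B\<^sub>K * C2 + B\<^sub>K) n"
      using C1(2) N_ge[of 1]
    proof (eventually_elim, intro allI impI)
      fix n \<omega> t \<theta>
      assume Ft: "\<forall>u. \<bar>Ft n u - F u\<bar> \<le> C1 / N n" and N1: "1 \<le> N n"
        and close: "\<forall>p\<in>obs m n. \<bar>e p \<omega> - et n p \<omega>\<bar> \<le> 1 / N n"
      \<comment> \<open>The mesh \<open>bw n / N n\<close> of the points matches the Lipschitz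
        constant \<open>B\<^sub>K / bw n\<close> of the weights: each weight changes by at most
        \<open>B\<^sub>K / N n\<close>, the sum by at most \<open>B\<^sub>K\<close>. The shift by
        \<open>S\<^sub>0\<close> before rounding moves every standardized level by at least
        \<open>1 / N n\<close>, the distance allowed between the two errors.\<close>
      define tg \<theta>u \<theta>d where "tg = bw n * \<lfloor>t * N n / bw n\<rfloor> / N n"
        and "\<theta>u = \<lceil>\<theta> * N n + S\<^sub>0\<rceil> / N n" and "\<theta>d = \<lfloor>\<theta> * N n - S\<^sub>0\<rfloor> / N n"
      have tg: "\<bar>t - tg\<bar> \<le> bw n / N n"
      proof -
        have "t - tg = bw n / N n * (t * N n / bw n - \<lfloor>t * N n / bw n\<rfloor>)"
          using bw_pos[of n] N1 by (simp add: tg_def field_simps)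
        also have "\<bar>\<dots>\<bar> = bw n / N n * \<bar>t * N n / bw n - \<lfloor>t * N n / bw n\<rfloor>\<bar>"
          using bw_pos[of n] N1 by (simp add: abs_mult)
        also have "\<dots> \<le> bw n / N n * 1" using bw_pos[of n] N1 by (intro mult_left_mono) (linarith, simp)
        finally show ?thesis by simp
      qed
      have \<theta>u: "\<theta> + S\<^sub>0 / N n \<le> \<theta>u" "\<theta>u \<le> \<theta> + (S\<^sub>0 + 1) / N n"
      proof -
        have "(\<theta> * N n + S\<^sub>0) / N n \<le> \<theta>u" "\<theta>u \<le> (\<theta> * N n + S\<^sub>0 + 1) / N n"
          unfolding \<theta>u_def using N1 by (intro divide_right_mono; linarith)+
        then show "\<theta> + S\<^sub>0 / N n \<le> \<theta>u" "\<theta>u \<le> \<theta> + (S\<^sub>0 + 1) / N n"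
          using N1 by (simp_all add: add_divide_distrib)
      qed
      have \<theta>d: "\<theta>d \<le> \<theta> - S\<^sub>0 / N n" "\<theta> - (S\<^sub>0 + 1) / N n \<le> \<theta>d"
      proof -
        have "\<theta>d \<le> (\<theta> * N n - S\<^sub>0) / N n" "(\<theta> * N n - S\<^sub>0 - 1) / N n \<le> \<theta>d"
          unfolding \<theta>d_def using N1 by (intro divide_right_mono; linarith)+
        then show "\<theta>d \<le> \<theta> - S\<^sub>0 / N n" "\<theta> - (S\<^sub>0 + 1) / N n \<le> \<theta>d"
          using N1 by (simp_all add: add_divide_distrib diff_divide_distrib)
      qed
      have N0: "0 \<le> S\<^sub>0 / N n" "0 \<le> (S\<^sub>0 + 1) / N n" using s(2) N1 by auto
      have shift: "empt n t \<theta>' \<omega> - empt n tg \<theta>' \<omega> \<in> {-B\<^sub>K..B\<^sub>K}" for \<theta>'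
      proof -
        define D where "D p = of_bool (et n p \<omega> \<le> lev \<theta>' (pt x n p)) - Ft n (lev \<theta>' (pt x n p))" for p
        have D: "\<bar>D p\<bar> \<le> 1" for p using Ft_bounds[of n "lev \<theta>' (pt x n p)"] by (auto simp: D_def)
        have "\<bar>empt n t \<theta>' \<omega> - empt n tg \<theta>' \<omega>\<bar> = \<bar>\<Sum>p\<in>obs m n. (w n t p - w n tg p) * D p\<bar>"
          by (simp add: empt_def D_def sum_subtractf left_diff_distrib)
        also have "\<dots> \<le> (\<Sum>p\<in>obs m n. B\<^sub>K / N n)"
        proof (rule order_trans[OF sum_abs sum_mono])
          fix p
          have "\<bar>w n t p - w n tg p\<bar> \<le> B\<^sub>K * \<bar>t - tg\<bar> / bw n" by (rule w_lipschitz)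
          also have "\<dots> \<le> B\<^sub>K * (bw n / N n) / bw n"
            using tg B\<^sub>K bw_pos[of n] by (intro divide_right_mono mult_left_mono) auto
          also have "\<dots> = B\<^sub>K / N n" using bw_pos[of n] by simp
          finally have "\<bar>w n t p - w n tg p\<bar> * \<bar>D p\<bar> \<le> B\<^sub>K / N n * 1"
            using D[of p] B\<^sub>K N1 by (intro mult_mono) auto
          then show "\<bar>(w n t p - w n tg p) * D p\<bar> \<le> B\<^sub>K / N n" by (simp add: abs_mult)
        qed
        also have "\<dots> = B\<^sub>K" using N1 by (simp add: card_obs_N)
        finally show ?thesis by auto
      qed
      have Fdiff: "\<bar>F (lev \<theta>' z) - F (lev \<theta> z)\<bar> \<le> B * ((S\<^sub>0 + 1) / s\<^sub>0) / N n"
        if "z \<in> {a..b}" "\<bar>\<theta>' - \<theta>\<bar> \<le> (S\<^sub>0 + 1) / N n" for z \<theta>'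
      proof -
        have sz: "s\<^sub>0 \<le> s z" using s that by auto
        have "\<bar>F (lev \<theta>' z) - F (lev \<theta> z)\<bar> \<le> B * \<bar>lev \<theta>' z - lev \<theta> z\<bar>" by (rule B)
        also have "lev \<theta>' z - lev \<theta> z = (\<theta>' - \<theta>) / s z" by (simp add: lev_def diff_divide_distrib)
        also have "\<bar>\<dots>\<bar> = \<bar>\<theta>' - \<theta>\<bar> / s z" using sz s(1) by simp
        also have "\<dots> \<le> ((S\<^sub>0 + 1) / N n) / s\<^sub>0" using that(2) sz s(1) by (intro frac_le) auto
        finally show ?thesis using B(1) by (simp add: mult_left_mono mult.commute[of "N n"])
      qed
      have cnt: "(\<Sum>p\<in>obs m n. w n t p * (C2 / N n)) \<le> B\<^sub>K * C2"
      proof -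
        have "(\<Sum>p\<in>obs m n. w n t p * (C2 / N n)) \<le> (\<Sum>p\<in>obs m n. B\<^sub>K * (C2 / N n))"
          using C2 N1 by (intro sum_mono mult_right_mono w_le) auto
        also have "\<dots> = B\<^sub>K * C2" using N1 by (simp add: card_obs_N)
        finally show ?thesis .
      qed
      have up: "emp n t \<theta> \<omega> \<le> empt n t \<theta>u \<omega> + B\<^sub>K * C2"
      proof -
        have "emp n t \<theta> \<omega> \<le> (\<Sum>p\<in>obs m n. w n t p * (of_bool (et n p \<omega> \<le> lev \<theta>u (pt x n p)) - Ft n (lev \<theta>u (pt x n p))) + w n t p * (C2 / N n))"
          unfolding emp_def
        proof (rule sum_mono)
          fix p assume p: "p \<in> obs m n"
          define z where "z = pt x n p"
          have z: "z \<in> {a..b}" using pt_in[OF p] by (simp add: z_def)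
          have sz: "0 < s z" "s z \<le> S\<^sub>0" using s(1) s(3)[OF z] s(4)[OF z] by auto
          have "lev \<theta> z + 1 / N n \<le> lev \<theta>u z"
          proof -
            have "lev \<theta> z + 1 / N n = (\<theta> + s z / N n - \<mu> z) / s z" using sz by (simp add: lev_def field_simps)
            also have "\<dots> \<le> (\<theta>u - \<mu> z) / s z"
              using sz \<theta>u(1) N1 divide_right_mono[OF sz(2), of "N n"] by (intro divide_right_mono) auto
            finally show ?thesis by (simp add: lev_def)
          qed
          then have ind: "of_bool (e p \<omega> \<le> lev \<theta> z) \<le> (of_bool (et n p \<omega> \<le> lev \<theta>u z) :: real)"
            using close p by (force simp: abs_le_iff)
          have "\<bar>\<theta>u - \<theta>\<bar> \<le> (S\<^sub>0 + 1) / N n" using \<theta>u N0 by linarith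
          from Fdiff[OF z this] have "Ft n (lev \<theta>u z) \<le> F (lev \<theta> z) + C2 / N n"
            using Ft[rule_format, of "lev \<theta>u z"] unfolding C2_def add_divide_distrib by linarith
          then have "of_bool (e p \<omega> \<le> lev \<theta> z) - F (lev \<theta> z) \<le> of_bool (et n p \<omega> \<le> lev \<theta>u z) - Ft n (lev \<theta>u z) + C2 / N n"
            using ind by linarith
          from mult_left_mono[OF this w_nonneg[of n t p]]
          show "w n t p * (of_bool (e p \<omega> \<le> lev \<theta> (pt x n p)) - F (lev \<theta> (pt x n p)))
            \<le> w n t p * (of_bool (et n p \<omega> \<le> lev \<theta>u (pt x n p)) - Ft n (lev \<theta>u (pt x n p))) + w n t p * (C2 / N n)"
            by (simp only: z_def distrib_left)
        qed
        then show ?thesis using cnt by (simp only: sum.distrib empt_def)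
      qed
      have down: "empt n t \<theta>d \<omega> \<le> emp n t \<theta> \<omega> + B\<^sub>K * C2"
      proof -
        have "empt n t \<theta>d \<omega> \<le> (\<Sum>p\<in>obs m n. w n t p * (of_bool (e p \<omega> \<le> lev \<theta> (pt x n p)) - F (lev \<theta> (pt x n p))) + w n t p * (C2 / N n))"
          unfolding empt_def
        proof (rule sum_mono)
          fix p assume p: "p \<in> obs m n"
          define z where "z = pt x n p"
          have z: "z \<in> {a..b}" using pt_in[OF p] by (simp add: z_def)
          have sz: "0 < s z" "s z \<le> S\<^sub>0" using s(1) s(3)[OF z] s(4)[OF z] by auto
          have "lev \<theta>d z \<le> lev \<theta> z - 1 / N n"
          proof -
            have "(\<theta>d - \<mu> z) / s z \<le> (\<theta> - s z / N n - \<mu> z) / s z"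
              using sz \<theta>d(1) N1 divide_right_mono[OF sz(2), of "N n"] by (intro divide_right_mono) auto
            also have "\<dots> = lev \<theta> z - 1 / N n" using sz by (simp add: lev_def field_simps)
            finally show ?thesis by (simp add: lev_def)
          qed
          then have ind: "of_bool (et n p \<omega> \<le> lev \<theta>d z) \<le> (of_bool (e p \<omega> \<le> lev \<theta> z) :: real)"
            using close p by (force simp: abs_le_iff)
          have "\<bar>\<theta>d - \<theta>\<bar> \<le> (S\<^sub>0 + 1) / N n" using \<theta>d N0 by linarith
          from Fdiff[OF z this] have "F (lev \<theta> z) \<le> Ft n (lev \<theta>d z) + C2 / N n"
            using Ft[rule_format, of "lev \<theta>d z"] unfolding C2_def add_divide_distrib by linarith
          then have "of_bool (et n p \<omega> \<le> lev \<theta>d z) - Ft n (lev \<theta>d z) \<le> of_bool (e p \<omega> \<le> lev \<theta> z) - F (lev \<theta> z) + C2 / N n"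
            using ind by linarith
          from mult_left_mono[OF this w_nonneg[of n t p]]
          show "w n t p * (of_bool (et n p \<omega> \<le> lev \<theta>d (pt x n p)) - Ft n (lev \<theta>d (pt x n p)))
            \<le> w n t p * (of_bool (e p \<omega> \<le> lev \<theta> (pt x n p)) - F (lev \<theta> (pt x n p))) + w n t p * (C2 / N n)"
            by (simp only: z_def distrib_left)
        qed
        then show ?thesis using cnt by (simp only: sum.distrib emp_def)
      qed
      from up down shift[of \<theta>u] shift[of \<theta>d]
      show "emp n t \<theta> \<omega> \<le> empt n (bw n * \<lfloor>t * N n / bw n\<rfloor> / N n) (\<lceil>\<theta> * N n + S\<^sub>0\<rceil> / N n) \<omega> + (B\<^sub>K * C2 + B\<^sub>K) \<and>
     empt n (bw n * \<lfloor>t * N n / bw n\<rfloor> / N n) (\<lfloor>\<theta> * N n - S\<^sub>0\<rfloor> / N n) \<omega> - (B\<^sub>K * C2 + B\<^sub>K) \<le> emp n t \<theta> \<omega>"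
        unfolding tg_def \<theta>u_def \<theta>d_def by auto
    qed
  qed
qed

end

section \<open>Tail bounds at fixed levels\<close>

context lad_setting
begin

text \<open>Within a row, distinct positions in one residue class modulo
  \<open>2 * lag n + 1\<close> differ by more than \<open>2 * lag n\<close>.\<close>

lemma et_indep:
  assumes "\<And>p. p \<in> L \<Longrightarrow> snd p mod (2 * lag n + 1) = k"
  shows "indep_vars (\<lambda>_. borel) (et n) L"
  unfolding et_def[abs_def]
proof (rule err_trunc_indep)
  fix p p' assume p: "p \<in> L" "p' \<in> L" "p \<noteq> p'"
  define r where "r = int (2 * lag n + 1)"
  have "int (snd p) mod r = int (snd p') mod r"
    using assms[OF p(1)] assms[OF p(2)] by (simp only: r_def zmod_int[symmetric])
  then have "r dvd int (snd p) - int (snd p')" by (simp add: mod_eq_dvd_iff)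
  then have "snd p \<noteq> snd p' \<Longrightarrow> r \<le> \<bar>int (snd p) - int (snd p')\<bar>"
    using zdvd_imp_le[of r "\<bar>int (snd p) - int (snd p')\<bar>"] by auto
  then show "int (fst p) \<noteq> int (fst p') \<or> 2 * int (lag n) < \<bar>int (snd p) - int (snd p')\<bar>"
    using p(3) by (auto simp: r_def prod_eq_iff)
qed

text \<open>\<open>g\<close> is the scale of the standard deviation relative to the square root of
  \<open>NB n\<close>: 1 for single levels, \<open>bw n + y n\<close> for increments. The exponent 6
  leaves room for grids with up to the order of \<open>N n ^ 4\<close> members.\<close>

abbreviation sum_tail :: "real \<Rightarrow> real \<Rightarrow> nat \<Rightarrow> bool" where
  "sum_tail CV C n \<equiv> \<forall>g A u. (\<forall>p. A p \<in> sets borel) \<longrightarrow> (\<forall>p. \<bar>u p\<bar> \<le> B\<^sub>K) \<longrightarrow> y n \<le> g \<longrightarrow>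
     (\<Sum>p\<in>obs m n. (u p)\<^sup>2 * prob (et n p -` A p \<inter> space M)) \<le> CV * NB n * g\<^sup>2 \<longrightarrow>
     prob {\<omega>\<in>space M. C * NB n * g * (y n)\<^sup>2 < \<bar>\<Sum>p\<in>obs m n. u p * (indicator (A p) (et n p \<omega>) - prob (et n p -` A p \<inter> space M))\<bar>}
       \<le> 1 / N n ^ 6"

text \<open>With \<open>\<sigma> = (y n)\<^sup>2 / (l n * g)\<close> the definition of
  \<open>y\<close> turns the variance term of the exponent into \<open>CV * l n\<close>, while the
  linear term, divided by the number \<open>r\<close> of classes, is at least
  \<open>(CV + 8) * l n\<close>. What is left is \<open>exp (- 8 * l n) = 1 / N n ^ 8\<close>, of
  which the prefactor \<open>2 * r\<close> consumes at most two powers.\<close>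

lemma indicator_sum_tail:
  assumes "0 \<le> CV"
  obtains C where "0 < C" "\<forall>\<^sub>F n in sequentially. sum_tail CV C n"
proof -
  \<comment> \<open>There are \<open>2 * lag n + 1\<close> classes, and \<open>lag n\<close> exceeds
    its real-valued formula by at most 1; so \<open>\<kappa> * l n\<close> bounds their number as
    soon as \<open>l n \<ge> 1\<close>.\<close>
  define \<kappa> where "\<kappa> = 2 * ((q + 3) / (q * ln (1 / \<rho>))) + 3"
  have \<kappa>: "0 < \<kappa>"
  proof -
    have "0 < (q + 3) / (q * ln (1 / \<rho>))" using q \<rho> by (intro divide_pos_pos mult_pos_pos) (auto simp: ln_div)
    then show ?thesis unfolding \<kappa>_def by linarith
  qed
  have eB: "\<forall>\<^sub>F n in sequentially. y n < 1 / B\<^sub>K"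
    by (rule order_tendstoD(2)[OF y_tendsto]) (use B\<^sub>K in simp)
  show thesis
  proof (rule that[of "\<kappa> * (CV + 8)"])
    show "0 < \<kappa> * (CV + 8)" using \<kappa> assms by (intro mult_pos_pos) auto
    show "\<forall>\<^sub>F n in sequentially. sum_tail CV (\<kappa> * (CV + 8)) n"
      using rates eB N_ge[of "2 * \<kappa>"]
    proof (eventually_elim, intro allI impI)
      fix n g and A :: "nat \<times> nat \<Rightarrow> real set" and u :: "nat \<times> nat \<Rightarrow> real"
      assume rt: "regular n"
        and eB: "y n < 1 / B\<^sub>K" and N\<kappa>: "2 * \<kappa> \<le> N n"
        and A: "\<forall>p. A p \<in> sets borel" and u: "\<forall>p. \<bar>u p\<bar> \<le> B\<^sub>K" and g: "y n \<le> g"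
        and V: "(\<Sum>p\<in>obs m n. (u p)\<^sup>2 * prob (et n p -` A p \<inter> space M)) \<le> CV * NB n * g\<^sup>2"
      define \<eta> where "\<eta> = \<kappa> * (CV + 8) * NB n * g * (y n)\<^sup>2"
      define \<sigma> where "\<sigma> = (y n)\<^sup>2 / (l n * g)"
      define r where "r = 2 * lag n + 1"
      have y0: "0 < y n" and l1: "1 \<le> l n" and y4: "NB n * y n ^ 4 = l n ^ 3" and N1: "1 \<le> N n" using rt by auto
      have g0: "0 < g" using y0 g by simp
      have rl: "real r \<le> \<kappa> * l n"
      proof -
        have "0 \<le> (q + 3) / (q * ln (1 / \<rho>)) * l n" using q \<rho> l1 by (intro mult_nonneg_nonneg divide_nonneg_nonneg) (auto simp: ln_div)
        then have "real (lag n) \<le> (q + 3) / (q * ln (1 / \<rho>)) * l n + 1" unfolding lag_def by linarith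
        then have "real r \<le> 2 * ((q + 3) / (q * ln (1 / \<rho>)) * l n) + 3" by (simp add: r_def)
        also have "\<dots> \<le> \<kappa> * l n" using l1 by (simp only: \<kappa>_def distrib_right mult.assoc)
        finally show ?thesis .
      qed
      have "prob {\<omega>\<in>space M. \<eta> < \<bar>\<Sum>p\<in>obs m n. u p * (indicator (A p) (et n p \<omega>) - prob (et n p -` A p \<inter> space M))\<bar>}
         \<le> 2 * real r * exp (\<sigma>\<^sup>2 * (CV * NB n * g\<^sup>2) - \<sigma> * \<eta> / r)"
      proof (rule bernstein_tail_indicators[where c="\<lambda>p. snd p mod r" and B="B\<^sub>K"])
        show "indep_vars (\<lambda>_. borel) (et n) {p \<in> obs m n. snd p mod r = k}" for k
          by (rule et_indep) (simp add: r_def)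
        \<comment> \<open>Here \<open>y n \<le> g\<close> is used: it keeps \<sigma> within the
          range of Bernstein's inequality, so variances cannot be exploited below the scale
          \<open>y n\<close>.\<close>
        show "\<sigma> * B\<^sub>K \<le> 1"
        proof -
          have "(y n)\<^sup>2 * B\<^sub>K = y n * (y n * B\<^sub>K)" by (simp add: power2_eq_square)
          also have "\<dots> \<le> y n * 1" using eB B\<^sub>K y0 by (intro mult_left_mono) (auto simp: field_simps)
          also have "\<dots> \<le> 1 * g" using g by simp
          also have "\<dots> \<le> l n * g" using l1 g0 by (intro mult_right_mono) auto
          finally show ?thesis using l1 g0 by (simp add: \<sigma>_def)
        qed
        show "0 \<le> \<sigma>" using l1 g0 by (simp add: \<sigma>_def)
      qed (use A u V in \<open>auto simp: r_def\<close>)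
      also have "\<sigma>\<^sup>2 * (CV * NB n * g\<^sup>2) = CV * (NB n * y n ^ 4) / (l n)\<^sup>2"
        using g0 l1 by (simp add: \<sigma>_def field_simps power2_eq_square eval_nat_numeral)
      also have "\<dots> = CV * l n" unfolding y4 using l1 by (simp add: eval_nat_numeral)
      also have "\<sigma> * \<eta> = \<kappa> * (CV + 8) * (NB n * y n ^ 4) / l n"
        using g0 l1 by (simp add: \<sigma>_def \<eta>_def field_simps power2_eq_square eval_nat_numeral)
      also have "\<dots> = \<kappa> * (CV + 8) * (l n)\<^sup>2" unfolding y4 using l1 by (simp add: eval_nat_numeral)
      also have "2 * real r * exp (CV * l n - \<kappa> * (CV + 8) * (l n)\<^sup>2 / real r) \<le> N n * N n * exp (- 8 * l n)"
      proof (rule mult_mono)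
        have "l n \<le> N n" using N1 ln_bound[of "N n"] by (simp add: l_def)
        then have "\<kappa> * l n \<le> \<kappa> * N n" using \<kappa> by simp
        then have "2 * real r \<le> 2 * \<kappa> * N n" using rl by simp
        also have "\<dots> \<le> N n * N n" using N\<kappa> N1 by (intro mult_right_mono) auto
        finally show "2 * real r \<le> N n * N n" .
        have "(CV + 8) * l n * real r \<le> (CV + 8) * l n * (\<kappa> * l n)"
          using rl assms l1 by (intro mult_left_mono) auto
        then have "(CV + 8) * l n \<le> \<kappa> * (CV + 8) * (l n)\<^sup>2 / real r"
          by (simp add: r_def field_simps power2_eq_square)
        then have "CV * l n - \<kappa> * (CV + 8) * (l n)\<^sup>2 / real r \<le> CV * l n - (CV + 8) * l n" by simp
        also have "\<dots> = - 8 * l n" by (simp add: algebra_simps)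
        finally show "exp (CV * l n - \<kappa> * (CV + 8) * (l n)\<^sup>2 / real r) \<le> exp (- 8 * l n)" by simp
      qed (use N1 in auto)
      also have "exp (- 8 * l n) = 1 / N n ^ 8"
        using N1 by (simp add: l_def exp_minus inverse_eq_divide exp_of_nat_mult[of 8 "ln (N n)", simplified])
      also have "N n * N n * (1 / N n ^ 8) = 1 / N n ^ 6" using N1 by (simp add: eval_nat_numeral)
      finally show "prob {\<omega>\<in>space M. \<kappa> * (CV + 8) * NB n * g * (y n)\<^sup>2 < \<bar>\<Sum>p\<in>obs m n. u p * (indicator (A p) (et n p \<omega>) - prob (et n p -` A p \<inter> space M))\<bar>}
       \<le> 1 / N n ^ 6" by (simp add: \<eta>_def)
    qed
  qed
qed

abbreviation weight_bound :: "real \<Rightarrow> nat \<Rightarrow> bool" where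
  "weight_bound C n \<equiv> \<forall>t P P\<^sub>0. (\<forall>p\<in>obs m n. 0 \<le> P p \<and> P p \<le> P\<^sub>0) \<longrightarrow> 0 \<le> P\<^sub>0 \<longrightarrow>
     (\<Sum>p\<in>obs m n. (w n t p)\<^sup>2 * P p) \<le> C * NB n * P\<^sub>0"

text \<open>Only observations within \<open>R * bw n\<close> of \<open>t\<close> carry weight, and
  there are \<open>O(NB n)\<close> of them.\<close>

lemma weighted_prob_sum_le:
  obtains C where "0 < C" "\<forall>\<^sub>F n in sequentially. weight_bound C n"
proof -
  have NBt: "filterlim (\<lambda>n. sample_size m n * bw n) at_top sequentially"
    using NB_at_top by (simp add: NB_def[abs_def] N_def)
  obtain C where C: "0 < C" "\<forall>\<^sub>F n in sequentially. \<forall>t.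
     real (card {p \<in> obs m n. \<bar>pt x n p - t\<bar> \<le> R * bw n}) \<le> C * (sample_size m n * bw n)"
    by (rule design_local_count[OF X N_lim ab bw_pos NBt R])
  show thesis
  proof (rule that[of "B\<^sub>K\<^sup>2 * C"])
    show "0 < B\<^sub>K\<^sup>2 * C" using B\<^sub>K C(1) by simp
    show "\<forall>\<^sub>F n in sequentially. weight_bound (B\<^sub>K\<^sup>2 * C) n"
      using C(2)
    proof (eventually_elim, intro allI impI)
      fix n t P P\<^sub>0
      assume cnt: "\<forall>t. real (card {p \<in> obs m n. \<bar>pt x n p - t\<bar> \<le> R * bw n}) \<le> C * (sample_size m n * bw n)"
        and P: "\<forall>p\<in>obs m n. 0 \<le> P p \<and> P p \<le> (P\<^sub>0 :: real)" "0 \<le> P\<^sub>0"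
      define J where "J = {p \<in> obs m n. \<bar>pt x n p - t\<bar> \<le> R * bw n}"
      have "(\<Sum>p\<in>obs m n. (w n t p)\<^sup>2 * P p) = (\<Sum>p\<in>J. (w n t p)\<^sup>2 * P p)"
      proof (rule sum.mono_neutral_right)
        show "\<forall>p\<in>obs m n - J. (w n t p)\<^sup>2 * P p = 0"
        proof
          fix p assume "p \<in> obs m n - J"
          then have "R * bw n < \<bar>pt x n p - t\<bar>" by (auto simp: J_def)
          then have "R < \<bar>(pt x n p - t) / bw n\<bar>" using bw_pos[of n] by (simp add: field_simps)
          then show "(w n t p)\<^sup>2 * P p = 0" by (simp add: w_def K_supp)
        qed
      qed (auto simp: J_def)
      also have "\<dots> \<le> (\<Sum>p\<in>J. B\<^sub>K\<^sup>2 * P\<^sub>0)"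
        using P by (intro sum_mono mult_mono power_mono w_le w_nonneg) (auto simp: J_def)
      also have "\<dots> = B\<^sub>K\<^sup>2 * P\<^sub>0 * real (card J)" by simp
      also have "\<dots> \<le> B\<^sub>K\<^sup>2 * P\<^sub>0 * (C * (sample_size m n * bw n))"
        using P cnt by (intro mult_left_mono) (auto simp: J_def)
      finally show "(\<Sum>p\<in>obs m n. (w n t p)\<^sup>2 * P p) \<le> B\<^sub>K\<^sup>2 * C * NB n * P\<^sub>0"
        by (simp add: NB_def N_def mult_ac)
    qed
  qed
qed

text \<open>The case \<open>g = 1\<close> of the tail bound: the indicators are those of half-lines,
  whose probabilities are bounded only by 1.\<close>

lemma empt_tail:
  obtains C where "0 < C" "\<forall>\<^sub>F n in sequentially. \<forall>t \<theta>.
     prob {\<omega>\<in>space M. C * NB n * (y n)\<^sup>2 < \<bar>empt n t \<theta> \<omega>\<bar>} \<le> 1 / N n ^ 6"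
proof -
  obtain CV where CV: "0 < CV" "\<forall>\<^sub>F n in sequentially. weight_bound CV n" by (rule weighted_prob_sum_le)
  obtain C where C: "0 < C" "\<forall>\<^sub>F n in sequentially. sum_tail CV C n" by (rule indicator_sum_tail[OF less_imp_le[OF CV(1)]])
  show thesis
  proof (rule that[OF C(1)])
    show "\<forall>\<^sub>F n in sequentially. \<forall>t \<theta>. prob {\<omega>\<in>space M. C * NB n * (y n)\<^sup>2 < \<bar>empt n t \<theta> \<omega>\<bar>} \<le> 1 / N n ^ 6"
      using CV(2) C(2) rates
    proof (eventually_elim, intro allI)
      fix n t \<theta>
      assume 1: "weight_bound CV n"
        and 2: "sum_tail CV C n"
        and 3: "regular n"
      define A where "A p = {..lev \<theta> (pt x n p)}" for p
      have P: "prob (et n p -` A p \<inter> space M) = Ft n (lev \<theta> (pt x n p))" for p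
        unfolding Ft_eq[of _ _ p] A_def by (rule arg_cong[where f=prob]) auto
      have "(\<Sum>p\<in>obs m n. (w n t p)\<^sup>2 * prob (et n p -` A p \<inter> space M)) \<le> CV * NB n * 1"
        by (rule 1[rule_format]) auto
      then have "prob {\<omega>\<in>space M. C * NB n * 1 * (y n)\<^sup>2 < \<bar>\<Sum>p\<in>obs m n. w n t p * (indicator (A p) (et n p \<omega>) - prob (et n p -` A p \<inter> space M))\<bar>}
             \<le> 1 / N n ^ 6"
        using 3 by (intro 2[rule_format]) (auto simp: A_def w_nonneg w_le)
      then show "prob {\<omega>\<in>space M. C * NB n * (y n)\<^sup>2 < \<bar>empt n t \<theta> \<omega>\<bar>} \<le> 1 / N n ^ 6"
        unfolding P by (simp add: empt_def A_def indicator_def of_bool_def)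
    qed
  qed
qed

abbreviation increment_tail :: "real \<Rightarrow> real \<Rightarrow> nat \<Rightarrow> bool" where
  "increment_tail c5 C n \<equiv> \<forall>t \<theta> \<theta>'. \<bar>\<theta>' - \<theta>\<bar> \<le> c5 * ((bw n)\<^sup>2 + (y n)\<^sup>2) \<longrightarrow>
     prob {\<omega>\<in>space M. C * NB n * (bw n + y n) * (y n)\<^sup>2 < \<bar>empt n t \<theta>' \<omega> - empt n t \<theta> \<omega>\<bar>} \<le> 1 / N n ^ 6"

text \<open>An increment in the level is a sum of indicators of intervals. Their probabilities under
  \<open>F\<close> are of order \<open>(bw n)\<^sup>2 + (y n)\<^sup>2\<close>, and the discrepancy
  \<open>O(1 / N n)\<close> between \<open>Ft n\<close> and \<open>F\<close> is no larger; so
  \<open>g = bw n + y n\<close> is an admissible scale.\<close>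

lemma empt_increment_tail:
  assumes "0 \<le> c5"
  obtains C where "0 < C" "\<forall>\<^sub>F n in sequentially. increment_tail c5 C n"
proof -
  obtain s\<^sub>0 S\<^sub>0 where s: "0 < s\<^sub>0" "0 < S\<^sub>0" "\<And>z. z \<in> {a..b} \<Longrightarrow> s\<^sub>0 \<le> s z" "\<And>z. z \<in> {a..b} \<Longrightarrow> s z \<le> S\<^sub>0"
    by (rule s_bounds) (rule that, assumption+)
  obtain B where B: "0 < B" "\<And>u v. \<bar>F u - F v\<bar> \<le> B * \<bar>u - v\<bar>" by (rule F_lipschitz) (rule that, assumption+)
  obtain C1 where C1: "0 < C1" "\<forall>\<^sub>F n in sequentially. \<forall>u. \<bar>Ft n u - F u\<bar> \<le> C1 / N n" by (rule Ft_close) (rule that, assumption+)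
  obtain C0 where C0: "0 < C0" "\<forall>\<^sub>F n in sequentially. weight_bound C0 n" by (rule weighted_prob_sum_le)
  define C2 where "C2 = B * c5 / s\<^sub>0 + 2 * C1"
  have C2: "0 < C2" using B C1 s assms by (simp add: C2_def add_nonneg_pos)
  obtain C where C: "0 < C" "\<forall>\<^sub>F n in sequentially. sum_tail (C0 * C2) C n" by (rule indicator_sum_tail[of "C0 * C2"]) (use C0 C2 in auto)
  show thesis
  proof (rule that[OF C(1)])
    show "\<forall>\<^sub>F n in sequentially. increment_tail c5 C n"
      using C0(2) C(2) rates C1(2)
    proof (eventually_elim)
      fix n
      assume 1: "weight_bound C0 n"
        and 2: "sum_tail (C0 * C2) C n"
        and 3: "regular n"
        and Ft: "\<forall>u. \<bar>Ft n u - F u\<bar> \<le> C1 / N n"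
      have main: "prob {\<omega>\<in>space M. C * NB n * (bw n + y n) * (y n)\<^sup>2 < \<bar>empt n t \<theta>' \<omega> - empt n t \<theta> \<omega>\<bar>} \<le> 1 / N n ^ 6"
        if le: "\<theta> \<le> \<theta>'" and diff: "\<theta>' - \<theta> \<le> c5 * ((bw n)\<^sup>2 + (y n)\<^sup>2)" for t \<theta> \<theta>'
      proof -
        define g where "g = bw n + y n"
        have g: "y n \<le> g" "(bw n)\<^sup>2 + (y n)\<^sup>2 \<le> g\<^sup>2" using bw_pos[of n] 3 by (auto simp: g_def power2_sum)
        define A where "A p = {lev \<theta> (pt x n p)<..lev \<theta>' (pt x n p)}" for p
        have lev_le: "lev \<theta> (pt x n p) \<le> lev \<theta>' (pt x n p)" if "p \<in> obs m n" for p
          using le s(1) s(3)[OF pt_in[OF that]] unfolding lev_def by (intro divide_right_mono) auto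
        have P: "prob (et n p -` A p \<inter> space M) = Ft n (lev \<theta>' (pt x n p)) - Ft n (lev \<theta> (pt x n p))"
          if p: "p \<in> obs m n" for p
        proof -
          have "prob {\<omega> \<in> space M. et n p \<omega> \<le> lev \<theta>' (pt x n p)} - prob {\<omega> \<in> space M. et n p \<omega> \<le> lev \<theta> (pt x n p)}
            = prob ({\<omega> \<in> space M. et n p \<omega> \<le> lev \<theta>' (pt x n p)} - {\<omega> \<in> space M. et n p \<omega> \<le> lev \<theta> (pt x n p)})"
            using lev_le[OF p] by (subst finite_measure_Diff) auto
          also have "\<dots> = prob (et n p -` A p \<inter> space M)"
            by (rule arg_cong[where f=prob]) (auto simp: A_def)
          finally show ?thesis unfolding Ft_eq[of _ _ p] by simp
        qed
        have Ple: "prob (et n p -` A p \<inter> space M) \<le> C2 * g\<^sup>2" if p: "p \<in> obs m n" for p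
        proof -
          define z where "z = pt x n p"
          have z: "s\<^sub>0 \<le> s z" using pt_in[OF p] s by (auto simp: z_def)
          have "Ft n (lev \<theta>' z) - Ft n (lev \<theta> z) \<le> \<bar>F (lev \<theta>' z) - F (lev \<theta> z)\<bar> + 2 * C1 / N n"
            using Ft[rule_format, of "lev \<theta>' z"] Ft[rule_format, of "lev \<theta> z"] by (simp add: abs_le_iff) linarith
          also have "\<bar>F (lev \<theta>' z) - F (lev \<theta> z)\<bar> \<le> B * \<bar>lev \<theta>' z - lev \<theta> z\<bar>" by (rule B)
          also have "lev \<theta>' z - lev \<theta> z = (\<theta>' - \<theta>) / s z" by (simp add: lev_def diff_divide_distrib)
          also have "\<bar>\<dots>\<bar> = (\<theta>' - \<theta>) / s z" using z s(1) le by simp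
          also have "\<dots> \<le> c5 * ((bw n)\<^sup>2 + (y n)\<^sup>2) / s\<^sub>0" using diff z s(1) le by (intro frac_le) auto
          also have "\<dots> \<le> c5 * g\<^sup>2 / s\<^sub>0" using g(2) assms s(1) by (intro divide_right_mono mult_left_mono) auto
          also have "2 * C1 / N n \<le> 2 * C1 * g\<^sup>2"
          proof -
            have "1 / N n \<le> (y n)\<^sup>2" using 3 by simp
            also have "\<dots> \<le> g\<^sup>2" using g(2) zero_le_power2[of "bw n"] by linarith
            finally have "2 * C1 * (1 / N n) \<le> 2 * C1 * g\<^sup>2" using C1(1) by (intro mult_left_mono) auto
            then show ?thesis by simp
          qed
          finally have "Ft n (lev \<theta>' z) - Ft n (lev \<theta> z) \<le> B * (c5 * g\<^sup>2 / s\<^sub>0) + 2 * C1 * g\<^sup>2"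
            using B(1) by simp
          also have "\<dots> = C2 * g\<^sup>2" by (simp add: C2_def algebra_simps)
          finally show ?thesis unfolding P[OF p] z_def .
        qed
        have "(\<Sum>p\<in>obs m n. (w n t p)\<^sup>2 * prob (et n p -` A p \<inter> space M)) \<le> C0 * NB n * (C2 * g\<^sup>2)"
          by (rule 1[rule_format]) (use Ple C2 in auto)
        then have "prob {\<omega>\<in>space M. C * NB n * g * (y n)\<^sup>2 < \<bar>\<Sum>p\<in>obs m n. w n t p * (indicator (A p) (et n p \<omega>) - prob (et n p -` A p \<inter> space M))\<bar>}
             \<le> 1 / N n ^ 6"
          using g(1) by (intro 2[rule_format]) (auto simp: A_def w_nonneg w_le mult_ac)
        moreover have "(\<Sum>p\<in>obs m n. w n t p * (indicator (A p) (et n p \<omega>) - prob (et n p -` A p \<inter> space M)))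
            = empt n t \<theta>' \<omega> - empt n t \<theta> \<omega>" for \<omega>
          unfolding empt_def sum_subtractf[symmetric]
        proof (rule sum.cong[OF refl])
          fix p assume p: "p \<in> obs m n"
          have "indicator (A p) (et n p \<omega>) = of_bool (et n p \<omega> \<le> lev \<theta>' (pt x n p)) - (of_bool (et n p \<omega> \<le> lev \<theta> (pt x n p)) :: real)"
            using lev_le[OF p] by (auto simp: A_def indicator_def)
          then show "w n t p * (indicator (A p) (et n p \<omega>) - prob (et n p -` A p \<inter> space M)) =
            w n t p * (of_bool (et n p \<omega> \<le> lev \<theta>' (pt x n p)) - Ft n (lev \<theta>' (pt x n p))) -
            w n t p * (of_bool (et n p \<omega> \<le> lev \<theta> (pt x n p)) - Ft n (lev \<theta> (pt x n p)))"
            by (simp add: P[OF p] right_diff_distrib)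
        qed
        ultimately show ?thesis by (simp add: g_def)
      qed
      show "increment_tail c5 C n"
      proof (intro allI impI)
        fix t \<theta> \<theta>' assume "\<bar>\<theta>' - \<theta>\<bar> \<le> c5 * ((bw n)\<^sup>2 + (y n)\<^sup>2)"
        then show "prob {\<omega>\<in>space M. C * NB n * (bw n + y n) * (y n)\<^sup>2 < \<bar>empt n t \<theta>' \<omega> - empt n t \<theta> \<omega>\<bar>} \<le> 1 / N n ^ 6"
          using main[of \<theta> \<theta>' t] main[of \<theta>' \<theta> t] by (cases "\<theta> \<le> \<theta>'") (auto simp: abs_minus_commute)
      qed
    qed
  qed
qed

end

section \<open>Uniform bounds\<close>

lemma floor_ceiling_in_range:
  fixes v :: real
  assumes "\<bar>v\<bar> + 1 \<le> real k"
  shows "\<lfloor>v\<rfloor> \<in> {- int k..int k}" "\<lceil>v\<rceil> \<in> {- int k..int k}"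
proof -
  have "real_of_int (- int k) \<le> real_of_int \<lfloor>v\<rfloor>" "real_of_int \<lfloor>v\<rfloor> \<le> real_of_int (int k)"
    "real_of_int (- int k) \<le> real_of_int \<lceil>v\<rceil>" "real_of_int \<lceil>v\<rceil> \<le> real_of_int (int k)"
    using assms by (simp_all; linarith)+
  then show "\<lfloor>v\<rfloor> \<in> {- int k..int k}" "\<lceil>v\<rceil> \<in> {- int k..int k}"
    unfolding of_int_le_iff by auto
qed

context lad_setting
begin

lemma empt_rv[measurable]: "empt n t \<theta> \<in> borel_measurable M"
  unfolding empt_def[abs_def] by measurable

definition trunc_bad :: "nat \<Rightarrow> 'a set" where
  "trunc_bad n = (\<Union>p\<in>obs m n. {\<omega>\<in>space M. 1 / N n < \<bar>e p \<omega> - et n p \<omega>\<bar>})"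

lemma trunc_bad_event[measurable]: "trunc_bad n \<in> events"
  unfolding trunc_bad_def by (intro sets.finite_UN finite_obs) measurable

lemma trunc_bad_prob: "\<forall>\<^sub>F n in sequentially. prob (trunc_bad n) \<le> C\<^sub>D / N n"
  using trunc_tail N_ge[of 1]
proof eventually_elim
  case (elim n)
  have "prob (trunc_bad n) \<le> (\<Sum>p\<in>obs m n. prob {\<omega>\<in>space M. 1 / N n < \<bar>e p \<omega> - et n p \<omega>\<bar>})"
    unfolding trunc_bad_def by (rule finite_measure_subadditive_finite) auto
  also have "\<dots> \<le> (\<Sum>p\<in>obs m n. C\<^sub>D / N n ^ 3)" by (rule sum_mono) (use elim in blast)
  also have "\<dots> = C\<^sub>D / (N n)\<^sup>2" using elim by (simp add: card_obs_N eval_nat_numeral)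
  also have "\<dots> \<le> C\<^sub>D / N n"
    using elim C\<^sub>D self_le_power[of "N n" 2] by (intro divide_left_mono) auto
  finally show ?case .
qed

lemma prob_finite_UN_le:
  assumes "finite Z" "\<And>z. z \<in> Z \<Longrightarrow> E z \<in> events" "\<And>z. z \<in> Z \<Longrightarrow> prob (E z) \<le> \<pi>"
  shows "prob (\<Union>z\<in>Z. E z) \<le> real (card Z) * \<pi>"
proof -
  have "prob (\<Union>z\<in>Z. E z) \<le> (\<Sum>z\<in>Z. prob (E z))"
    using assms by (intro finite_measure_subadditive_finite) auto
  also have "\<dots> \<le> (\<Sum>z\<in>Z. \<pi>)" by (rule sum_mono) (rule assms)
  finally show ?thesis by simp
qed

definition grid_t :: "nat \<Rightarrow> int \<Rightarrow> real" where "grid_t n z = bw n * of_int z / N n"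
definition grid_\<theta> :: "nat \<Rightarrow> int \<Rightarrow> real" where "grid_\<theta> n z = of_int z / N n"

text \<open>Indices of points are of order \<open>N n / bw n\<close>, and
  \<open>1 / bw n \<le> N n\<close> once \<open>NB n \<ge> 1\<close>; hence the square.\<close>

abbreviation t_range :: "nat \<Rightarrow> nat \<Rightarrow> int set" where
  "t_range T n \<equiv> {- int (T * (sample_size m n)\<^sup>2)..int (T * (sample_size m n)\<^sup>2)}"

abbreviation \<theta>_range :: "nat \<Rightarrow> nat \<Rightarrow> int set" where
  "\<theta>_range L n \<equiv> {- int (L * sample_size m n)..int (L * sample_size m n)}"

abbreviation t_covered :: "nat \<Rightarrow> nat \<Rightarrow> bool" where
  "t_covered T n \<equiv> \<forall>t\<in>{a..b}. \<lfloor>t * N n / bw n\<rfloor> \<in> t_range T n"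

abbreviation \<theta>_covered :: "real \<Rightarrow> real \<Rightarrow> nat \<Rightarrow> nat \<Rightarrow> bool" where
  "\<theta>_covered B S\<^sub>0 L n \<equiv> \<forall>\<theta>. \<bar>\<theta>\<bar> \<le> B \<longrightarrow> \<lceil>\<theta> * N n + S\<^sub>0\<rceil> \<in> \<theta>_range L n \<and> \<lfloor>\<theta> * N n - S\<^sub>0\<rfloor> \<in> \<theta>_range L n"

lemma grid_t_index:
  obtains T where "\<forall>\<^sub>F n in sequentially. t_covered T n"
proof -
  define T where "T = nat \<lceil>\<bar>a\<bar> + \<bar>b\<bar> + 1\<rceil>"
  have T: "\<bar>a\<bar> + \<bar>b\<bar> + 1 \<le> real T" unfolding T_def by linarith
  show thesis
  proof (rule that[of T])
    show "\<forall>\<^sub>F n in sequentially. t_covered T n"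
      using rates
    proof (eventually_elim, intro ballI)
      fix n t
      assume rt: "regular n" and t: "t \<in> {a..b}"
      have b1: "1 / bw n \<le> N n" using rt bw_pos[of n] by (simp add: NB_def field_simps)
      have "\<bar>t * N n / bw n\<bar> = \<bar>t\<bar> * (N n * (1 / bw n))" using rt bw_pos[of n] by (simp add: abs_mult)
      also have "\<dots> \<le> (\<bar>a\<bar> + \<bar>b\<bar>) * (N n * N n)"
        using b1 t rt bw_pos[of n] by (intro mult_mono) auto
      finally have "\<bar>t * N n / bw n\<bar> + 1 \<le> (\<bar>a\<bar> + \<bar>b\<bar>) * (N n * N n) + 1 * (N n * N n)"
        using rt mult_mono[of 1 "N n" 1 "N n"] by simp
      also have "\<dots> = (\<bar>a\<bar> + \<bar>b\<bar> + 1) * (N n * N n)" by (simp add: algebra_simps)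
      also have "\<dots> \<le> real T * (N n * N n)" using T by (intro mult_right_mono) auto
      also have "\<dots> = real (T * (sample_size m n)\<^sup>2)" by (simp add: N_def power2_eq_square)
      finally show "\<lfloor>t * N n / bw n\<rfloor> \<in> t_range T n"
        by (rule floor_ceiling_in_range)
    qed
  qed
qed

lemma grid_\<theta>_index:
  assumes "0 \<le> S\<^sub>0"
  obtains L where "\<forall>\<^sub>F n in sequentially. \<theta>_covered B S\<^sub>0 L n"
proof -
  define L where "L = nat \<lceil>\<bar>B\<bar> + S\<^sub>0 + 1\<rceil>"
  have L: "\<bar>B\<bar> + S\<^sub>0 + 1 \<le> real L" unfolding L_def by linarith
  show thesis
  proof (rule that[of L])
    show "\<forall>\<^sub>F n in sequentially. \<theta>_covered B S\<^sub>0 L n"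
      using N_ge[of 1]
    proof (eventually_elim, intro allI impI conjI)
      fix n \<theta> assume N1: "1 \<le> N n" and \<theta>: "\<bar>\<theta>\<bar> \<le> B"
      have "\<bar>\<theta> * N n\<bar> \<le> \<bar>B\<bar> * N n" using \<theta> N1 by (simp add: abs_mult mult_right_mono)
      then have "\<bar>\<theta> * N n\<bar> + S\<^sub>0 + 1 \<le> \<bar>B\<bar> * N n + (S\<^sub>0 + 1) * N n"
        using mult_left_mono[OF N1, of "S\<^sub>0 + 1"] assms by (simp only: mult_1_right) linarith
      also have "\<dots> = (\<bar>B\<bar> + S\<^sub>0 + 1) * N n" by (simp add: algebra_simps)
      also have "\<dots> \<le> real L * N n" using L N1 by (intro mult_right_mono) auto
      also have "\<dots> = real (L * sample_size m n)" by (simp add: N_def)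
      finally have le: "\<bar>\<theta> * N n\<bar> + S\<^sub>0 + 1 \<le> real (L * sample_size m n)" .
      show "\<lceil>\<theta> * N n + S\<^sub>0\<rceil> \<in> \<theta>_range L n"
        by (rule floor_ceiling_in_range) (use le assms in linarith)
      show "\<lfloor>\<theta> * N n - S\<^sub>0\<rfloor> \<in> \<theta>_range L n"
        by (rule floor_ceiling_in_range) (use le assms in linarith)
    qed
  qed
qed

text \<open>The sandwich reduces all points to about \<open>N n ^ 3\<close> pairs of a grid point
  and a grid level, against tails of size \<open>1 / N n ^ 6\<close>. Its additive constant is
  harmless since \<open>NB n * (y n)\<^sup>2 \<ge> 1\<close>.\<close>

lemma emp_uniform_bound:
  obtains C C' Bad where "0 < C" "\<And>n. Bad n \<in> events" "\<forall>\<^sub>F n in sequentially. prob (Bad n) \<le> C' / N n"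
    "\<forall>\<^sub>F n in sequentially. \<forall>\<omega>\<in>space M - Bad n. \<forall>t\<in>{a..b}. \<bar>emp n t (\<mu> t) \<omega>\<bar> \<le> C * NB n * (y n)\<^sup>2"
proof -
  obtain S\<^sub>0 C1 where C1: "0 < S\<^sub>0" "0 < C1" "\<forall>\<^sub>F n in sequentially. sandwich S\<^sub>0 C1 n"
    by (rule emp_sandwich)
  obtain B where B: "0 \<le> B" "\<And>z. z \<in> {a..b} \<Longrightarrow> \<bar>\<mu> z\<bar> \<le> B" by (rule \<mu>_bounded) (rule that, assumption+)
  obtain T where T: "\<forall>\<^sub>F n in sequentially. t_covered T n" by (rule grid_t_index)
  obtain L where L: "\<forall>\<^sub>F n in sequentially. \<theta>_covered B S\<^sub>0 L n"
    by (rule grid_\<theta>_index[OF less_imp_le[OF C1(1)]])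
  obtain C2 where C2: "0 < C2" "\<forall>\<^sub>F n in sequentially. \<forall>t \<theta>.
     prob {\<omega>\<in>space M. C2 * NB n * (y n)\<^sup>2 < \<bar>empt n t \<theta> \<omega>\<bar>} \<le> 1 / N n ^ 6" by (rule empt_tail)
  define Z where "Z n = t_range T n \<times> \<theta>_range L n" for n
  define E where "E n z = {\<omega>\<in>space M. C2 * NB n * (y n)\<^sup>2 < \<bar>empt n (grid_t n (fst z)) (grid_\<theta> n (snd z)) \<omega>\<bar>}" for n and z :: "int \<times> int"
  have E: "E n z \<in> events" for n z unfolding E_def by measurable
  define Bad where "Bad n = trunc_bad n \<union> (\<Union>z\<in>Z n. E n z)" for n
  show thesis
  proof (rule that[of "C1 + C2" Bad "C\<^sub>D + (2 * T + 1) * (2 * L + 1)"])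
    show "0 < C1 + C2" using C1 C2 by simp
    show "Bad n \<in> events" for n
      unfolding Bad_def by (intro sets.Un trunc_bad_event sets.finite_UN E) (simp add: Z_def)
    show "\<forall>\<^sub>F n in sequentially. prob (Bad n) \<le> (C\<^sub>D + (2 * T + 1) * (2 * L + 1)) / N n"
      using trunc_bad_prob C2(2) N_ge[of 1]
    proof eventually_elim
      case (elim n)
      have "prob (Bad n) \<le> prob (trunc_bad n) + prob (\<Union>z\<in>Z n. E n z)"
        unfolding Bad_def by (intro measure_Un_le trunc_bad_event sets.finite_UN E) (simp add: Z_def)
      also have "prob (\<Union>z\<in>Z n. E n z) \<le> real (card (Z n)) * (1 / N n ^ 6)"
        by (rule prob_finite_UN_le) (use E elim in \<open>auto simp: Z_def E_def\<close>)
      also have "real (card (Z n)) = (2 * T * (N n)\<^sup>2 + 1) * (2 * L * N n + 1)"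
        by (simp add: Z_def N_def card_cartesian_product nat_add_distrib algebra_simps nat_mult_distrib nat_power_eq)
      also have "\<dots> \<le> (2 * T * (N n)\<^sup>2 + (N n)\<^sup>2) * (2 * L * N n + N n)"
        using elim by (intro mult_mono) auto
      also have "\<dots> = (2 * T + 1) * (2 * L + 1) * N n ^ 3" by (simp add: eval_nat_numeral algebra_simps)
      finally have "prob (Bad n) \<le> C\<^sub>D / N n + (2 * T + 1) * (2 * L + 1) * N n ^ 3 * (1 / N n ^ 6)"
        using elim by (simp add: divide_right_mono)
      also have "(2 * T + 1) * (2 * L + 1) * N n ^ 3 * (1 / N n ^ 6) = (2 * T + 1) * (2 * L + 1) / N n ^ 3"
        using elim by (simp add: eval_nat_numeral)
      also have "\<dots> \<le> (2 * T + 1) * (2 * L + 1) / N n"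
        using elim self_le_power[of "N n" 3] by (intro divide_left_mono) auto
      finally show ?case by (simp add: add_divide_distrib)
    qed
    show "\<forall>\<^sub>F n in sequentially. \<forall>\<omega>\<in>space M - Bad n. \<forall>t\<in>{a..b}. \<bar>emp n t (\<mu> t) \<omega>\<bar> \<le> (C1 + C2) * NB n * (y n)\<^sup>2"
      using C1(3) T L rates
    proof (eventually_elim, intro ballI)
      fix n \<omega> t
      assume sw: "sandwich S\<^sub>0 C1 n"
        and T: "t_covered T n"
        and L: "\<theta>_covered B S\<^sub>0 L n"
        and rt: "regular n"
        and \<omega>: "\<omega> \<in> space M - Bad n" and t: "t \<in> {a..b}"
      have close: "\<forall>p\<in>obs m n. \<bar>e p \<omega> - et n p \<omega>\<bar> \<le> 1 / N n"
        using \<omega> by (auto simp: Bad_def trunc_bad_def not_less)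
      define zt zu zd where "zt = \<lfloor>t * N n / bw n\<rfloor>" and "zu = \<lceil>\<mu> t * N n + S\<^sub>0\<rceil>" and "zd = \<lfloor>\<mu> t * N n - S\<^sub>0\<rfloor>"
      have "(zt, zu) \<in> Z n" "(zt, zd) \<in> Z n"
        using T[rule_format, OF t] L[rule_format, OF B(2)[OF t]] by (auto simp: Z_def zt_def zu_def zd_def)
      then have "\<omega> \<notin> E n (zt, zu)" "\<omega> \<notin> E n (zt, zd)" using \<omega> by (auto simp: Bad_def)
      then have "\<bar>empt n (grid_t n zt) (grid_\<theta> n zu) \<omega>\<bar> \<le> C2 * NB n * (y n)\<^sup>2"
        "\<bar>empt n (grid_t n zt) (grid_\<theta> n zd) \<omega>\<bar> \<le> C2 * NB n * (y n)\<^sup>2" using \<omega> by (auto simp: E_def not_less)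
      moreover have "emp n t (\<mu> t) \<omega> \<le> empt n (grid_t n zt) (grid_\<theta> n zu) \<omega> + C1"
        "empt n (grid_t n zt) (grid_\<theta> n zd) \<omega> - C1 \<le> emp n t (\<mu> t) \<omega>"
        using sw[rule_format, OF bspec[OF close], of t "\<mu> t"]
        by (auto simp: grid_t_def grid_\<theta>_def zt_def zu_def zd_def)
      moreover have "C1 \<le> C1 * (NB n * (y n)\<^sup>2)"
      proof -
        have "1 \<le> NB n * y n ^ 3" using rt by simp
        also have "\<dots> \<le> NB n * y n ^ 2" using rt by (intro mult_left_mono power_decreasing) auto
        finally show ?thesis using C1(2) by simp
      qed
      ultimately show "\<bar>emp n t (\<mu> t) \<omega>\<bar> \<le> (C1 + C2) * NB n * (y n)\<^sup>2"
        by (simp add: abs_le_iff algebra_simps)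
    qed
  qed
qed

text \<open>Applied with opposite roundings at the two levels, the sandwich bounds an increment on
  either side by an increment between grid levels. Triples of one grid point and two grid levels are
  of order \<open>N n ^ 4\<close> in number.\<close>

lemma emp_modulus:
  assumes c5: "0 \<le> c5"
  obtains C C' Bad where "0 < C" "\<And>n. Bad n \<in> events" "\<forall>\<^sub>F n in sequentially. prob (Bad n) \<le> C' / N n"
    "\<forall>\<^sub>F n in sequentially. \<forall>\<omega>\<in>space M - Bad n. \<forall>t\<in>{a..b}. \<forall>\<Delta>. \<bar>\<Delta>\<bar> \<le> c5 * ((bw n)\<^sup>2 + (y n)\<^sup>2) \<longrightarrow>
       \<bar>emp n t (\<mu> t + \<Delta>) \<omega> - emp n t (\<mu> t) \<omega>\<bar> \<le> C * NB n * (bw n * (y n)\<^sup>2 + y n ^ 3)"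
proof -
  obtain S\<^sub>0 C1 where C1: "0 < S\<^sub>0" "0 < C1" "\<forall>\<^sub>F n in sequentially. sandwich S\<^sub>0 C1 n"
    by (rule emp_sandwich)
  obtain B where B: "0 \<le> B" "\<And>z. z \<in> {a..b} \<Longrightarrow> \<bar>\<mu> z\<bar> \<le> B" by (rule \<mu>_bounded) (rule that, assumption+)
  obtain T where T: "\<forall>\<^sub>F n in sequentially. t_covered T n" by (rule grid_t_index)
  \<comment> \<open>\<open>\<bar>\<Delta>\<bar>\<close> is at most \<open>2 * c5\<close>, because
    \<open>bw n\<close> and \<open>y n\<close> are eventually at most 1.\<close>
  obtain L where L: "\<forall>\<^sub>F n in sequentially. \<theta>_covered (B + 2 * c5) S\<^sub>0 L n"
    by (rule grid_\<theta>_index[OF less_imp_le[OF C1(1)]])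
  \<comment> \<open>Rounding moves each of the two levels by at most
    \<open>(S\<^sub>0 + 1) / N n\<close>, and \<open>1 / N n\<close> is at most
    \<open>(bw n)\<^sup>2 + (y n)\<^sup>2\<close>.\<close>
  define c6 where "c6 = c5 + 2 * (S\<^sub>0 + 1)"
  have c6: "0 \<le> c6" using c5 C1(1) by (simp add: c6_def)
  obtain C2 where C2: "0 < C2" "\<forall>\<^sub>F n in sequentially. increment_tail c6 C2 n"
    by (rule empt_increment_tail[OF c6])
  define I where "I n = \<theta>_range L n" for n
  \<comment> \<open>Only pairs of nearby levels enter the union, because
    \<open>increment_tail\<close> covers no others.\<close>
  define Z where "Z n = {z \<in> t_range T n \<times> I n \<times> I n.
     \<bar>grid_\<theta> n (snd (snd z)) - grid_\<theta> n (fst (snd z))\<bar> \<le> c6 * ((bw n)\<^sup>2 + (y n)\<^sup>2)}" for n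
  define E where "E n z = {\<omega>\<in>space M. C2 * NB n * (bw n + y n) * (y n)\<^sup>2 <
     \<bar>empt n (grid_t n (fst z)) (grid_\<theta> n (snd (snd z))) \<omega> - empt n (grid_t n (fst z)) (grid_\<theta> n (fst (snd z))) \<omega>\<bar>}"
    for n and z :: "int \<times> int \<times> int"
  have E: "E n z \<in> events" for n z unfolding E_def by measurable
  have finZ: "finite (Z n)" for n by (simp add: Z_def I_def)
  define Bad where "Bad n = trunc_bad n \<union> (\<Union>z\<in>Z n. E n z)" for n
  show thesis
  proof (rule that[of "2 * C1 + C2" Bad "C\<^sub>D + (2 * T + 1) * (2 * L + 1) * (2 * L + 1)"])
    show "0 < 2 * C1 + C2" using C1 C2 by simp
    show "Bad n \<in> events" for n
      unfolding Bad_def by (intro sets.Un trunc_bad_event sets.finite_UN E finZ)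
    show "\<forall>\<^sub>F n in sequentially. prob (Bad n) \<le> (C\<^sub>D + (2 * T + 1) * (2 * L + 1) * (2 * L + 1)) / N n"
      using trunc_bad_prob C2(2) N_ge[of 1]
    proof eventually_elim
      case (elim n)
      have "prob (Bad n) \<le> prob (trunc_bad n) + prob (\<Union>z\<in>Z n. E n z)"
        unfolding Bad_def by (intro measure_Un_le trunc_bad_event sets.finite_UN E finZ)
      also have "prob (\<Union>z\<in>Z n. E n z) \<le> real (card (Z n)) * (1 / N n ^ 6)"
        by (rule prob_finite_UN_le[OF finZ E]) (use elim in \<open>auto simp: Z_def E_def\<close>)
      finally have 1: "prob (Bad n) \<le> C\<^sub>D / N n + real (card (Z n)) * (1 / N n ^ 6)" using elim by simp
      have "card (Z n) \<le> card (t_range T n \<times> I n \<times> I n)"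
        by (rule card_mono) (auto simp: Z_def I_def)
      then have "real (card (Z n)) \<le> real (card (t_range T n \<times> I n \<times> I n))"
        by simp
      also have "\<dots> = (2 * T * (N n)\<^sup>2 + 1) * ((2 * L * N n + 1) * (2 * L * N n + 1))"
        unfolding card_cartesian_product I_def by (simp add: N_def nat_add_distrib nat_mult_distrib nat_power_eq) algebra
      also have "\<dots> \<le> (2 * T * (N n)\<^sup>2 + (N n)\<^sup>2) * ((2 * L * N n + N n) * (2 * L * N n + N n))"
        using elim by (intro mult_mono) auto
      also have "\<dots> = (2 * T + 1) * (2 * L + 1) * (2 * L + 1) * N n ^ 4" by (simp add: eval_nat_numeral algebra_simps)
      finally have "real (card (Z n)) * (1 / N n ^ 6) \<le> (2 * T + 1) * (2 * L + 1) * (2 * L + 1) * N n ^ 4 * (1 / N n ^ 6)"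
        by (rule mult_right_mono) simp
      also have "\<dots> = (2 * T + 1) * (2 * L + 1) * (2 * L + 1) / N n ^ 2"
        using elim by (simp add: eval_nat_numeral)
      also have "\<dots> \<le> (2 * T + 1) * (2 * L + 1) * (2 * L + 1) / N n"
        using elim self_le_power[of "N n" 2] by (intro divide_left_mono) auto
      finally show ?case using 1 by (simp add: add_divide_distrib)
    qed
    show "\<forall>\<^sub>F n in sequentially. \<forall>\<omega>\<in>space M - Bad n. \<forall>t\<in>{a..b}. \<forall>\<Delta>. \<bar>\<Delta>\<bar> \<le> c5 * ((bw n)\<^sup>2 + (y n)\<^sup>2) \<longrightarrow>
       \<bar>emp n t (\<mu> t + \<Delta>) \<omega> - emp n t (\<mu> t) \<omega>\<bar> \<le> (2 * C1 + C2) * NB n * (bw n * (y n)\<^sup>2 + y n ^ 3)"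
      using C1(3) T L rates
    proof (eventually_elim, intro ballI allI impI)
      fix n \<omega> t \<Delta>
      assume sw: "sandwich S\<^sub>0 C1 n"
        and T: "t_covered T n"
        and L: "\<theta>_covered (B + 2 * c5) S\<^sub>0 L n"
        and rt: "regular n"
        and \<omega>: "\<omega> \<in> space M - Bad n" and t: "t \<in> {a..b}" and \<Delta>: "\<bar>\<Delta>\<bar> \<le> c5 * ((bw n)\<^sup>2 + (y n)\<^sup>2)"
      have close: "\<forall>p\<in>obs m n. \<bar>e p \<omega> - et n p \<omega>\<bar> \<le> 1 / N n"
        using \<omega> by (auto simp: Bad_def trunc_bad_def not_less)
      define zt where "zt = \<lfloor>t * N n / bw n\<rfloor>"
      define zu zd where "zu \<theta> = \<lceil>\<theta> * N n + S\<^sub>0\<rceil>" and "zd \<theta> = \<lfloor>\<theta> * N n - S\<^sub>0\<rfloor>" for \<theta>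
      have dn: "0 \<le> (bw n)\<^sup>2 + (y n)\<^sup>2" "(bw n)\<^sup>2 + (y n)\<^sup>2 \<le> 2"
        using rt bw_pos[of n] power_le_one[of "bw n" 2] power_le_one[of "y n" 2] by (simp, linarith)
      have "\<bar>\<Delta>\<bar> \<le> 2 * c5" using \<Delta> mult_left_mono[OF dn(2) c5] by simp
      then have bd: "\<bar>\<mu> t\<bar> \<le> B + 2 * c5" "\<bar>\<mu> t + \<Delta>\<bar> \<le> B + 2 * c5" using B(2)[OF t] c5 by linarith+
      have gu: "\<theta> \<le> grid_\<theta> n (zu \<theta>)" "grid_\<theta> n (zu \<theta>) \<le> \<theta> + (S\<^sub>0 + 1) / N n"
       and gd: "grid_\<theta> n (zd \<theta>) \<le> \<theta>" "\<theta> - (S\<^sub>0 + 1) / N n \<le> grid_\<theta> n (zd \<theta>)" for \<theta>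
      proof -
        have "(\<theta> * N n) / N n \<le> grid_\<theta> n (zu \<theta>)" "grid_\<theta> n (zu \<theta>) \<le> (\<theta> * N n + (S\<^sub>0 + 1)) / N n"
          "grid_\<theta> n (zd \<theta>) \<le> (\<theta> * N n) / N n" "(\<theta> * N n - (S\<^sub>0 + 1)) / N n \<le> grid_\<theta> n (zd \<theta>)"
          unfolding zu_def zd_def grid_\<theta>_def using rt C1(1) by (intro divide_right_mono; linarith)+
        then show "\<theta> \<le> grid_\<theta> n (zu \<theta>)" "grid_\<theta> n (zu \<theta>) \<le> \<theta> + (S\<^sub>0 + 1) / N n"
          "grid_\<theta> n (zd \<theta>) \<le> \<theta>" "\<theta> - (S\<^sub>0 + 1) / N n \<le> grid_\<theta> n (zd \<theta>)"
          using rt by (simp_all add: add_divide_distrib diff_divide_distrib)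
      qed
      have mesh: "(S\<^sub>0 + 1) / N n \<le> (S\<^sub>0 + 1) * ((bw n)\<^sup>2 + (y n)\<^sup>2)"
      proof -
        have "1 / N n \<le> (bw n)\<^sup>2 + (y n)\<^sup>2" using rt zero_le_power2[of "bw n"] by linarith
        then have "(S\<^sub>0 + 1) * (1 / N n) \<le> (S\<^sub>0 + 1) * ((bw n)\<^sup>2 + (y n)\<^sup>2)" using C1(1) by (intro mult_left_mono) auto
        then show ?thesis by simp
      qed
      have c6e: "c6 * ((bw n)\<^sup>2 + (y n)\<^sup>2) = c5 * ((bw n)\<^sup>2 + (y n)\<^sup>2) + 2 * ((S\<^sub>0 + 1) * ((bw n)\<^sup>2 + (y n)\<^sup>2))"
        by (simp add: c6_def algebra_simps)
      have inI: "zu (\<mu> t) \<in> I n" "zd (\<mu> t) \<in> I n" "zu (\<mu> t + \<Delta>) \<in> I n" "zd (\<mu> t + \<Delta>) \<in> I n"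
        using L[rule_format, OF bd(1)] L[rule_format, OF bd(2)] unfolding I_def zu_def zd_def by blast+
      have zt: "zt \<in> t_range T n"
        using T t by (simp add: zt_def)
      have "\<bar>grid_\<theta> n (zu (\<mu> t + \<Delta>)) - grid_\<theta> n (zd (\<mu> t))\<bar> \<le> c6 * ((bw n)\<^sup>2 + (y n)\<^sup>2)"
        "\<bar>grid_\<theta> n (zd (\<mu> t + \<Delta>)) - grid_\<theta> n (zu (\<mu> t))\<bar> \<le> c6 * ((bw n)\<^sup>2 + (y n)\<^sup>2)"
        using gu[of "\<mu> t + \<Delta>"] gd[of "\<mu> t + \<Delta>"] gu[of "\<mu> t"] gd[of "\<mu> t"] mesh c6e \<Delta> by linarith+
      then have "(zt, zd (\<mu> t), zu (\<mu> t + \<Delta>)) \<in> Z n" "(zt, zu (\<mu> t), zd (\<mu> t + \<Delta>)) \<in> Z n"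
        unfolding Z_def using inI zt by auto
      then have "\<omega> \<notin> E n (zt, zd (\<mu> t), zu (\<mu> t + \<Delta>))" "\<omega> \<notin> E n (zt, zu (\<mu> t), zd (\<mu> t + \<Delta>))"
        using \<omega> unfolding Bad_def by blast+
      then have inc: "\<bar>empt n (grid_t n zt) (grid_\<theta> n (zu (\<mu> t + \<Delta>))) \<omega> - empt n (grid_t n zt) (grid_\<theta> n (zd (\<mu> t))) \<omega>\<bar> \<le> C2 * NB n * (bw n + y n) * (y n)\<^sup>2"
        "\<bar>empt n (grid_t n zt) (grid_\<theta> n (zd (\<mu> t + \<Delta>))) \<omega> - empt n (grid_t n zt) (grid_\<theta> n (zu (\<mu> t))) \<omega>\<bar> \<le> C2 * NB n * (bw n + y n) * (y n)\<^sup>2"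
        using \<omega> by (auto simp: E_def not_less)
      have s: "emp n t \<theta> \<omega> \<le> empt n (grid_t n zt) (grid_\<theta> n (zu \<theta>)) \<omega> + C1"
        "empt n (grid_t n zt) (grid_\<theta> n (zd \<theta>)) \<omega> - C1 \<le> emp n t \<theta> \<omega>" for \<theta>
        using sw[rule_format, OF bspec[OF close], of t \<theta>]
        by (auto simp: grid_t_def grid_\<theta>_def zt_def zu_def zd_def)
      have "\<bar>emp n t (\<mu> t + \<Delta>) \<omega> - emp n t (\<mu> t) \<omega>\<bar> \<le> C2 * NB n * (bw n + y n) * (y n)\<^sup>2 + 2 * C1"
        using inc s[of "\<mu> t"] s[of "\<mu> t + \<Delta>"] by linarith
      also have "C2 * NB n * (bw n + y n) * (y n)\<^sup>2 = C2 * (NB n * (bw n * (y n)\<^sup>2 + y n ^ 3))"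
        by (simp add: algebra_simps eval_nat_numeral)
      also have "2 * C1 \<le> 2 * C1 * (NB n * (bw n * (y n)\<^sup>2 + y n ^ 3))"
      proof -
        have "1 \<le> NB n * y n ^ 3" using rt by simp
        also have "\<dots> \<le> NB n * (bw n * (y n)\<^sup>2 + y n ^ 3)" using rt bw_pos[of n] by (intro mult_left_mono) auto
        finally show ?thesis using C1(2) by simp
      qed
      finally show "\<bar>emp n t (\<mu> t + \<Delta>) \<omega> - emp n t (\<mu> t) \<omega>\<bar> \<le> (2 * C1 + C2) * NB n * (bw n * (y n)\<^sup>2 + y n ^ 3)"
        by (simp add: algebra_simps)
    qed
  qed
qed

end

section \<open>Bias\<close>

context lad_setting
begin

lemma lev_lipschitz:
  assumes "0 \<le> B"
  obtains C where "0 \<le> C" "\<And>\<theta> z z'. \<bar>\<theta>\<bar> \<le> B \<Longrightarrow> z \<in> {a..b} \<Longrightarrow> z' \<in> {a..b} \<Longrightarrow> \<bar>lev \<theta> z - lev \<theta> z'\<bar> \<le> C * \<bar>z - z'\<bar>"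
proof -
  obtain s\<^sub>0 S\<^sub>0 where s: "0 < s\<^sub>0" "0 < S\<^sub>0" "\<And>z. z \<in> {a..b} \<Longrightarrow> s\<^sub>0 \<le> s z" "\<And>z. z \<in> {a..b} \<Longrightarrow> s z \<le> S\<^sub>0"
    by (rule s_bounds) (rule that, assumption+)
  have bm: "bounded_derivs 4 {a..b} \<mu>" and bs: "bounded_derivs 4 {a..b} s" using S by (auto simp: cond_S_def)
  obtain Bm where Bm: "0 \<le> Bm" "\<And>x. x \<in> {a..b} \<Longrightarrow> \<bar>\<mu> x\<bar> \<le> Bm"
    "\<And>x y. x \<in> {a..b} \<Longrightarrow> y \<in> {a..b} \<Longrightarrow> \<bar>\<mu> x - \<mu> y\<bar> \<le> Bm * \<bar>x - y\<bar>"
    by (rule bounded_derivs_lipschitz[OF bm]) auto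
  obtain Bs where Bs: "0 \<le> Bs"
    "\<And>x y. x \<in> {a..b} \<Longrightarrow> y \<in> {a..b} \<Longrightarrow> \<bar>s x - s y\<bar> \<le> Bs * \<bar>x - y\<bar>"
    by (rule bounded_derivs_lipschitz[OF bs]) auto
  show thesis
  proof (rule that[of "(B + Bm) * (Bs / s\<^sub>0\<^sup>2) + Bm / s\<^sub>0"])
    show "0 \<le> (B + Bm) * (Bs / s\<^sub>0\<^sup>2) + Bm / s\<^sub>0" using assms Bm Bs s by auto
    fix \<theta> z z' assume \<theta>: "\<bar>\<theta>\<bar> \<le> B" and z: "z \<in> {a..b}" "z' \<in> {a..b}"
    have sz: "s\<^sub>0 \<le> s z" "s\<^sub>0 \<le> s z'" using s z by auto
    then have pos: "0 < s z" "0 < s z'" using s(1) by auto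
    have "lev \<theta> z - lev \<theta> z' = (\<theta> - \<mu> z) * ((s z' - s z) / (s z * s z')) + (\<mu> z' - \<mu> z) / s z'"
      using pos by (simp add: lev_def field_simps)
    also have "\<bar>\<dots>\<bar> \<le> \<bar>\<theta> - \<mu> z\<bar> * (\<bar>s z' - s z\<bar> / (s z * s z')) + \<bar>\<mu> z' - \<mu> z\<bar> / s z'"
      using pos by (intro order_trans[OF abs_triangle_ineq]) (simp add: abs_mult)
    also have "\<dots> \<le> (B + Bm) * (Bs * \<bar>z - z'\<bar> / (s\<^sub>0 * s\<^sub>0)) + Bm * \<bar>z - z'\<bar> / s\<^sub>0"
    proof (intro add_mono mult_mono frac_le)
      show "\<bar>\<theta> - \<mu> z\<bar> \<le> B + Bm" using \<theta> Bm(2)[OF z(1)] by linarith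
      show "\<bar>s z' - s z\<bar> \<le> Bs * \<bar>z - z'\<bar>" using Bs(2)[OF z(2,1)] by (simp add: abs_minus_commute)
      show "\<bar>\<mu> z' - \<mu> z\<bar> \<le> Bm * \<bar>z - z'\<bar>" using Bm(3)[OF z(2,1)] by (simp add: abs_minus_commute)
    qed (use assms Bm Bs s(1) sz pos in auto)
    also have "\<dots> = ((B + Bm) * (Bs / s\<^sub>0\<^sup>2) + Bm / s\<^sub>0) * \<bar>z - z'\<bar>"
      by (simp add: power2_eq_square algebra_simps)
    finally show "\<bar>lev \<theta> z - lev \<theta> z'\<bar> \<le> ((B + Bm) * (Bs / s\<^sub>0\<^sup>2) + Bm / s\<^sub>0) * \<bar>z - z'\<bar>" .
  qed
qed

abbreviation smoothing_error :: "real \<Rightarrow> real \<Rightarrow> real \<Rightarrow> real" where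
  "smoothing_error t \<beta> \<Delta> \<equiv> integral {-R..R} (\<lambda>u. K u * (F (lev (\<mu> t + \<Delta>) (t + \<beta> * u)) - 1/2))
      - f 0 / s t * (\<Delta> - psi_K K * rho_mu \<mu> s f t * \<beta>\<^sup>2)"

lemma smoothed_level:
  obtains C where "0 \<le> C" "\<And>t \<beta> \<Delta>. t \<in> {a + d..b - d} \<Longrightarrow> 0 < \<beta> \<Longrightarrow> R * \<beta> < d \<Longrightarrow>
    \<bar>smoothing_error t \<beta> \<Delta>\<bar> \<le> C * (\<beta> ^ 4 + \<bar>\<Delta>\<bar> * \<beta>\<^sup>2 + \<Delta>\<^sup>2)"
proof -
  have "continuous_on UNIV K"
    by (rule lipschitz_on_continuous_on[of B\<^sub>K]) (use B\<^sub>K K_lip in \<open>auto simp: lipschitz_on_def dist_real_def\<close>)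
  note cont = this
  have F0: "F 0 = 1/2" using median by (simp add: F_def)
  show thesis
  proof (rule smoothed_level_expansion[OF K_nonneg K_sym cont K_int S F_deriv F_bounds F0 d R])
    fix C assume C: "0 \<le> C" "\<And>t \<beta> \<Delta>. t \<in> {a + d..b - d} \<Longrightarrow> 0 < \<beta> \<Longrightarrow> R * \<beta> < d \<Longrightarrow>
      \<bar>integral {-R..R} (\<lambda>u. K u * (F ((\<mu> t + \<Delta> - \<mu> (t + \<beta> * u)) / s (t + \<beta> * u)) - 1/2))
      - f 0 / s t * (\<Delta> - psi_K K * rho_mu \<mu> s f t * \<beta>\<^sup>2)\<bar> \<le> C * (\<beta> ^ 4 + \<bar>\<Delta>\<bar> * \<beta>\<^sup>2 + \<Delta>\<^sup>2)"
    show thesis by (rule that[OF C(1)]) (unfold lev_def, rule C(2))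
  qed
qed

abbreviation bias_error :: "nat \<Rightarrow> real \<Rightarrow> real \<Rightarrow> real" where
  "bias_error n t \<Delta> \<equiv> (\<Sum>p\<in>obs m n. w n t p * (F (lev (\<mu> t + \<Delta>) (pt x n p)) - 1/2))
      - NB n / (b - a) * (f 0 / s t * (\<Delta> - psi_K K * rho_mu \<mu> s f t * (bw n)\<^sup>2))"

abbreviation bias_bound :: "real \<Rightarrow> nat \<Rightarrow> bool" where
  "bias_bound C n \<equiv> \<forall>t\<in>{a + d..b - d}. \<forall>\<Delta>. \<bar>\<Delta>\<bar> \<le> 1 \<longrightarrow>
    \<bar>bias_error n t \<Delta>\<bar> \<le> C * NB n * (bw n ^ 4 + \<bar>\<Delta>\<bar> * (bw n)\<^sup>2 + \<Delta>\<^sup>2) + C"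

text \<open>The sum of weighted probabilities is a Riemann sum of kernel times smoothed level. The
  summand \<open>C\<close> without the factor \<open>NB n\<close> is the Riemann error, which does
  not grow with the sample. \<open>\<bar>\<Delta>\<bar> \<le> 1\<close> confines the levels to a
  bounded range, on which their Lipschitz constant in the point is uniform.\<close>

lemma bias_expansion:
  obtains C where "0 < C" "\<forall>\<^sub>F n in sequentially. bias_bound C n"
proof -
  obtain B where B: "0 < B" "\<And>u v. \<bar>F u - F v\<bar> \<le> B * \<bar>u - v\<bar>" by (rule F_lipschitz) (rule that, assumption+)
  obtain Bm where Bm: "0 \<le> Bm" "\<And>z. z \<in> {a..b} \<Longrightarrow> \<bar>\<mu> z\<bar> \<le> Bm" by (rule \<mu>_bounded) (rule that, assumption+)
  have "0 \<le> Bm + 1" using Bm by simp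
  then obtain CL where CL: "0 \<le> CL" "\<And>\<theta> z z'. \<bar>\<theta>\<bar> \<le> Bm + 1 \<Longrightarrow> z \<in> {a..b} \<Longrightarrow> z' \<in> {a..b} \<Longrightarrow> \<bar>lev \<theta> z - lev \<theta> z'\<bar> \<le> CL * \<bar>z - z'\<bar>"
    by (rule lev_lipschitz) (rule that, assumption+)
  obtain C1 where C1: "0 \<le> C1" "\<And>t \<beta> \<Delta>. t \<in> {a + d..b - d} \<Longrightarrow> 0 < \<beta> \<Longrightarrow> R * \<beta> < d \<Longrightarrow>
    \<bar>smoothing_error t \<beta> \<Delta>\<bar> \<le> C1 * (\<beta> ^ 4 + \<bar>\<Delta>\<bar> * \<beta>\<^sup>2 + \<Delta>\<^sup>2)"
    by (rule smoothed_level) (rule that, assumption+)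
  have NBt: "filterlim (\<lambda>n. sample_size m n * bw n) at_top sequentially"
    using NB_at_top by (simp add: NB_def[abs_def] N_def)
  obtain C2 where C2: "0 \<le> C2" "\<forall>\<^sub>F n in sequentially. riemann_approx m x bw a b d R C2 n"
    by (rule design_riemann_sum[OF X N_lim ab bw_pos bw_lim NBt d R])
  define L where "L = B\<^sub>K * (B * CL) + B\<^sub>K"
  have e: "\<forall>\<^sub>F n in sequentially. bw n < min 1 (d / R)"
    by (rule order_tendstoD(2)[OF bw_lim]) (use d R in auto)
  define C where "C = max (C1 / (b - a)) (C2 * (B\<^sub>K + L)) + 1"
  have C: "0 < C" "C1 / (b - a) \<le> C" "C2 * (B\<^sub>K + L) \<le> C" using C1(1) ab by (auto simp: C_def intro!: add_nonneg_pos simp: le_max_iff_disj)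
  show thesis
  proof (rule that[OF C(1)])
    show "\<forall>\<^sub>F n in sequentially. bias_bound C n"
      using C2(2) e NB_ge[of 0]
    proof (eventually_elim, intro ballI allI impI)
      fix n and t \<Delta> :: real
      assume rs: "riemann_approx m x bw a b d R C2 n"
        and e: "bw n < min 1 (d / R)" and NB0: "0 \<le> NB n" and t: "t \<in> {a + d..b - d}" and \<Delta>: "\<bar>\<Delta>\<bar> \<le> 1"
      have \<beta>: "0 < bw n" "bw n \<le> 1" "R * bw n < d" using bw_pos[of n] e R by (auto simp: field_simps)
      define H where "H u = F (lev (\<mu> t + \<Delta>) (t + bw n * u)) - 1/2" for u
      define h where "h u = K u * H u" for u
      have H1: "\<bar>H u\<bar> \<le> 1" for u using F_bounds[of "lev (\<mu> t + \<Delta>) (t + bw n * u)"] by (auto simp: H_def abs_le_iff)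
      have tab: "t \<in> {a..b}" using t d by auto
      have inab: "t + bw n * u \<in> {a..b}" if "\<bar>u\<bar> \<le> R" for u
      proof -
        have "\<bar>bw n * u\<bar> \<le> bw n * R" using that \<beta> by (simp add: abs_mult)
        then have "\<bar>bw n * u\<bar> \<le> d" using \<beta>(3) by (simp add: mult.commute)
        then show ?thesis using t by (auto simp: abs_le_iff)
      qed
      have Hlip: "\<bar>H u - H v\<bar> \<le> B * CL * \<bar>u - v\<bar>" if "\<bar>u\<bar> \<le> R" "\<bar>v\<bar> \<le> R" for u v
      proof -
        have "\<bar>\<mu> t + \<Delta>\<bar> \<le> Bm + 1" using Bm(2)[OF tab] \<Delta> by linarith
        from CL(2)[OF this inab[OF that(1)] inab[OF that(2)]]
        have "\<bar>lev (\<mu> t + \<Delta>) (t + bw n * u) - lev (\<mu> t + \<Delta>) (t + bw n * v)\<bar> \<le> CL * (bw n * \<bar>u - v\<bar>)"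
          using \<beta>(1) by (simp add: abs_mult flip: right_diff_distrib)
        also have "\<dots> \<le> CL * (1 * \<bar>u - v\<bar>)" using CL(1) \<beta> by (intro mult_left_mono mult_right_mono) auto
        finally have "B * \<bar>lev (\<mu> t + \<Delta>) (t + bw n * u) - lev (\<mu> t + \<Delta>) (t + bw n * v)\<bar> \<le> B * (CL * \<bar>u - v\<bar>)"
          using B(1) by simp
        with B(2)[of "lev (\<mu> t + \<Delta>) (t + bw n * u)" "lev (\<mu> t + \<Delta>) (t + bw n * v)"]
        show ?thesis by (simp add: H_def)
      qed
      have BL: "B\<^sub>K \<le> L" using B CL B\<^sub>K by (simp add: L_def)
      \<comment> \<open>\<open>H\<close> is controlled where \<open>t + bw n * u\<close> lies in
        \<open>{a..b}\<close>, which \<open>\<bar>u\<bar> \<le> R\<close> guarantees. If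
        \<open>v\<close> is outside that range, then \<open>K v = 0\<close>, and the Lipschitz
        property of \<open>K\<close> together with \<open>\<bar>H u\<bar> \<le> 1\<close>
        suffices.\<close>
      have half: "\<bar>h u - h v\<bar> \<le> L * \<bar>u - v\<bar>" if "\<bar>u\<bar> \<le> R" for u v
      proof (cases "\<bar>v\<bar> \<le> R")
        case True
        have "h u - h v = K u * (H u - H v) + (K u - K v) * H v" by (simp add: h_def algebra_simps)
        also have "\<bar>\<dots>\<bar> \<le> K u * \<bar>H u - H v\<bar> + \<bar>K u - K v\<bar> * \<bar>H v\<bar>"
          using K_nonneg[of u] by (intro order_trans[OF abs_triangle_ineq]) (simp add: abs_mult)
        also have "\<dots> \<le> B\<^sub>K * (B * CL * \<bar>u - v\<bar>) + (B\<^sub>K * \<bar>u - v\<bar>) * 1"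
          using Hlip[OF that True] K_le[of u] K_lip[of u v] H1[of v] B\<^sub>K by (intro add_mono mult_mono) auto
        also have "\<dots> = L * \<bar>u - v\<bar>" by (simp add: L_def algebra_simps)
        finally show ?thesis .
      next
        case False
        then have "K v = 0" by (intro K_supp) simp
        then have "\<bar>h u - h v\<bar> = \<bar>K u - K v\<bar> * \<bar>H u\<bar>" by (simp add: h_def abs_mult)
        also have "\<dots> \<le> (B\<^sub>K * \<bar>u - v\<bar>) * 1" using K_lip[of u v] H1[of u] B\<^sub>K by (intro mult_mono) auto
        also have "\<dots> \<le> L * \<bar>u - v\<bar>" using BL by (simp add: mult_right_mono)
        finally show ?thesis .
      qed
      have hlip: "\<bar>h u - h v\<bar> \<le> L * \<bar>u - v\<bar>" for u v
      proof (cases "\<bar>u\<bar> \<le> R \<or> \<bar>v\<bar> \<le> R")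
        case True
        then show ?thesis using half[of u v] half[of v u] by (auto simp: abs_minus_commute)
      next
        case False
        then have "K u = 0" "K v = 0" by (auto intro!: K_supp)
        then show ?thesis using BL B\<^sub>K by (simp add: h_def)
      qed
      have hbd: "\<bar>h u\<bar> \<le> B\<^sub>K" for u
      proof -
        have "K u * \<bar>H u\<bar> \<le> B\<^sub>K * 1" using K_le K_nonneg H1 B\<^sub>K by (intro mult_mono) auto
        then show ?thesis using K_nonneg[of u] by (simp add: h_def abs_mult)
      qed
      have 1: "\<bar>(\<Sum>p\<in>obs m n. h ((pt x n p - t) / bw n)) - sample_size m n * bw n / (b - a) * integral {-R..R} h\<bar> \<le> C2 * (B\<^sub>K + L)"
        by (rule rs[rule_format, OF t]) (use hlip hbd in \<open>auto simp: h_def K_supp\<close>)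
      have 2: "(\<Sum>p\<in>obs m n. h ((pt x n p - t) / bw n)) = (\<Sum>p\<in>obs m n. w n t p * (F (lev (\<mu> t + \<Delta>) (pt x n p)) - 1/2))"
        using \<beta>(1) by (simp add: h_def H_def w_def)
      have 3: "\<bar>NB n / (b - a) * integral {-R..R} h - NB n / (b - a) * (f 0 / s t * (\<Delta> - psi_K K * rho_mu \<mu> s f t * (bw n)\<^sup>2))\<bar>
         \<le> C * NB n * (bw n ^ 4 + \<bar>\<Delta>\<bar> * (bw n)\<^sup>2 + \<Delta>\<^sup>2)"
      proof -
        have "\<bar>NB n / (b - a) * integral {-R..R} h - NB n / (b - a) * (f 0 / s t * (\<Delta> - psi_K K * rho_mu \<mu> s f t * (bw n)\<^sup>2))\<bar>
          = NB n / (b - a) * \<bar>integral {-R..R} h - (f 0 / s t * (\<Delta> - psi_K K * rho_mu \<mu> s f t * (bw n)\<^sup>2))\<bar>"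
          unfolding right_diff_distrib[symmetric] abs_mult using NB0 ab by simp
        also have "\<dots> \<le> NB n / (b - a) * (C1 * (bw n ^ 4 + \<bar>\<Delta>\<bar> * (bw n)\<^sup>2 + \<Delta>\<^sup>2))"
          unfolding h_def[abs_def] H_def using NB0 ab by (intro mult_left_mono C1(2) t \<beta>) auto
        also have "\<dots> = (C1 / (b - a)) * (NB n * (bw n ^ 4 + \<bar>\<Delta>\<bar> * (bw n)\<^sup>2 + \<Delta>\<^sup>2))" by simp
        also have "\<dots> \<le> C * (NB n * (bw n ^ 4 + \<bar>\<Delta>\<bar> * (bw n)\<^sup>2 + \<Delta>\<^sup>2))"
          using C(2) NB0 \<beta>(1) by (intro mult_right_mono mult_nonneg_nonneg add_nonneg_nonneg) auto
        finally show ?thesis by (simp add: mult.assoc)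
      qed
      have triangle: "\<bar>u - z\<bar> \<le> v + c" if "\<bar>u - y\<bar> \<le> e" "\<bar>y - z\<bar> \<le> v" "e \<le> c" for u y z v c e :: real
        using that by linarith
      show "\<bar>bias_error n t \<Delta>\<bar>
        \<le> C * NB n * (bw n ^ 4 + \<bar>\<Delta>\<bar> * (bw n)\<^sup>2 + \<Delta>\<^sup>2) + C"
        using triangle[OF 1[folded N_def, folded NB_def, unfolded 2] 3 C(3)] .
    qed
  qed
qed

text \<open>Instead of bounding the derivatives in \<open>rho_mu\<close> one by one, the expansion
  is read backwards at a fixed bandwidth and zero offset: the integral is at most 1 in absolute
  value and the remainder is a constant, so the bias term is bounded too.\<close>

lemma bias_coefficient_bounded:
  obtains C where "0 \<le> C" "\<And>t. t \<in> {a + d..b - d} \<Longrightarrow> \<bar>psi_K K * rho_mu \<mu> s f t\<bar> \<le> C"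
proof -
  obtain C1 where C1: "0 \<le> C1" "\<And>t \<beta> \<Delta>. t \<in> {a + d..b - d} \<Longrightarrow> 0 < \<beta> \<Longrightarrow> R * \<beta> < d \<Longrightarrow>
    \<bar>smoothing_error t \<beta> \<Delta>\<bar> \<le> C1 * (\<beta> ^ 4 + \<bar>\<Delta>\<bar> * \<beta>\<^sup>2 + \<Delta>\<^sup>2)"
    by (rule smoothed_level) (rule that, assumption+)
  obtain s\<^sub>0 S\<^sub>0 where s: "0 < s\<^sub>0" "0 < S\<^sub>0" "\<And>z. z \<in> {a..b} \<Longrightarrow> s\<^sub>0 \<le> s z" "\<And>z. z \<in> {a..b} \<Longrightarrow> s z \<le> S\<^sub>0"
    by (rule s_bounds) (rule that, assumption+)
  have f0: "0 < f 0" using S by (simp add: cond_S_def)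
  define \<beta> where "\<beta> = d / (2 * R)"
  have \<beta>: "0 < \<beta>" "R * \<beta> < d" using d R by (auto simp: \<beta>_def)
  define A where "A = 1 + C1 * \<beta> ^ 4"
  have A: "0 \<le> A" using C1 by (simp add: A_def)
  show thesis
  proof (rule that[of "A * S\<^sub>0 / f 0 / \<beta>\<^sup>2"])
    show "0 \<le> A * S\<^sub>0 / f 0 / \<beta>\<^sup>2" using A s f0 by simp
    fix t assume t: "t \<in> {a + d..b - d}"
    have st: "0 < s t" "s t \<le> S\<^sub>0" using s t d by (auto intro: less_le_trans[of 0 s\<^sub>0])
    define J where "J = integral {-R..R} (\<lambda>u. K u * (F (lev (\<mu> t + 0) (t + \<beta> * u)) - 1/2))"
    have J: "\<bar>J\<bar> \<le> 1"
    proof (cases "(\<lambda>u. K u * (F (lev (\<mu> t + 0) (t + \<beta> * u)) - 1/2)) integrable_on {-R..R}")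
      case True
      \<comment> \<open>A non-integrable \<open>K\<close> would have integral 0, the default value,
        instead of 1.\<close>
      have Ki: "K integrable_on {-R..R}" using K_int(1) not_integrable_integral[of K "{-R..R}"] by force
      have "norm J \<le> integral {-R..R} K"
        unfolding J_def
      proof (rule integral_norm_bound_integral[OF True Ki])
        fix u assume "u \<in> {-R..R}"
        have "\<bar>F (lev (\<mu> t + 0) (t + \<beta> * u)) - 1/2\<bar> \<le> 1"
          using F_bounds[of "lev (\<mu> t + 0) (t + \<beta> * u)"] unfolding abs_le_iff by linarith
        from mult_left_mono[OF this K_nonneg[of u]]
        show "norm (K u * (F (lev (\<mu> t + 0) (t + \<beta> * u)) - 1/2)) \<le> K u"
          using K_nonneg[of u] by (simp add: abs_mult)
      qed
      then show ?thesis by (simp add: K_int)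
    next
      case False
      then show ?thesis by (simp add: J_def not_integrable_integral)
    qed
    have "\<bar>J - f 0 / s t * (0 - psi_K K * rho_mu \<mu> s f t * \<beta>\<^sup>2)\<bar> \<le> C1 * \<beta> ^ 4"
      using C1(2)[OF t \<beta>, of 0] unfolding J_def by simp
    then have "\<bar>f 0 / s t * (psi_K K * rho_mu \<mu> s f t * \<beta>\<^sup>2)\<bar> \<le> A" using J unfolding A_def by (simp add: abs_le_iff) linarith
    then have "f 0 / s t * (\<bar>psi_K K * rho_mu \<mu> s f t\<bar> * \<beta>\<^sup>2) \<le> A" using f0 st by (simp add: abs_mult)
    then have "\<bar>psi_K K * rho_mu \<mu> s f t\<bar> * \<beta>\<^sup>2 * f 0 \<le> A * s t" using f0 st by (simp add: field_simps)
    also have "\<dots> \<le> A * S\<^sub>0" using A st by (intro mult_left_mono)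
    finally show "\<bar>psi_K K * rho_mu \<mu> s f t\<bar> \<le> A * S\<^sub>0 / f 0 / \<beta>\<^sup>2" using f0 \<beta>(1) by (simp add: field_simps)
  qed
qed

end

section \<open>Conclusion\<close>

text \<open>The products left by the bias remainder are absorbed by means of
  \<open>\<beta> \<le> 1\<close> and \<open>y \<le> 1\<close>. The bound
  \<open>r \<le> (\<beta> + y) * (2 * D)\<close> shows that the second rate is of smaller order than
  the first.\<close>

lemma rate_algebra:
  fixes \<beta> y :: real
  assumes "0 < \<beta>" "\<beta> \<le> 1" "0 < y" "y \<le> 1"
  defines "D \<equiv> \<beta>\<^sup>2 + y\<^sup>2" and "r \<equiv> \<beta> ^ 4 + \<beta> * y\<^sup>2 + y ^ 3"
  shows "\<beta> ^ 4 \<le> r" "D * \<beta>\<^sup>2 \<le> r" "D\<^sup>2 \<le> 2 * r" "\<beta> * y\<^sup>2 + y ^ 3 \<le> r" "y ^ 3 \<le> r" "r \<le> (\<beta> + y) * (2 * D)" "0 < r" "0 \<le> D"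
proof -
  have pos: "0 \<le> \<beta> ^ 4" "0 \<le> \<beta> * y\<^sup>2" "0 < y ^ 3" using assms by auto
  show "\<beta> ^ 4 \<le> r" "\<beta> * y\<^sup>2 + y ^ 3 \<le> r" "y ^ 3 \<le> r" "0 < r" using pos unfolding r_def by linarith+
  show "0 \<le> D" by (simp add: D_def)
  have "\<beta>\<^sup>2 * y\<^sup>2 \<le> \<beta> * y\<^sup>2" using assms by (intro mult_right_mono) (auto simp: power2_eq_square)
  moreover have "D * \<beta>\<^sup>2 = \<beta> ^ 4 + \<beta>\<^sup>2 * y\<^sup>2" by (simp add: D_def algebra_simps power4_eq_xxxx power2_eq_square)
  ultimately show "D * \<beta>\<^sup>2 \<le> r" using pos unfolding r_def by linarith
  have "y ^ 4 \<le> y ^ 3" using assms by (intro power_decreasing) auto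
  then have "\<beta> ^ 4 + 2 * (\<beta>\<^sup>2 * y\<^sup>2) + y ^ 4 \<le> \<beta> ^ 4 + 2 * (\<beta> * y\<^sup>2) + y ^ 3"
    using \<open>\<beta>\<^sup>2 * y\<^sup>2 \<le> \<beta> * y\<^sup>2\<close> by (intro add_mono mult_left_mono) auto
  also have "\<dots> \<le> 2 * r" using pos unfolding r_def by argo
  also have "\<beta> ^ 4 + 2 * (\<beta>\<^sup>2 * y\<^sup>2) + y ^ 4 = D\<^sup>2"
    by (simp add: D_def algebra_simps power4_eq_xxxx power2_eq_square)
  finally show "D\<^sup>2 \<le> 2 * r" .
  have "\<beta> ^ 4 \<le> \<beta> * \<beta>\<^sup>2" using assms power_decreasing[of 3 4 \<beta>] by (simp add: eval_nat_numeral)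
  moreover have "(\<beta> + y) * (2 * D) = 2 * (\<beta> * \<beta>\<^sup>2) + 2 * (\<beta> * y\<^sup>2) + 2 * (y * \<beta>\<^sup>2) + 2 * y ^ 3"
    by (simp add: D_def algebra_simps power3_eq_cube power2_eq_square)
  moreover have "0 \<le> \<beta> * \<beta>\<^sup>2" "0 \<le> y * \<beta>\<^sup>2" using assms by auto
  ultimately show "r \<le> (\<beta> + y) * (2 * D)" using pos unfolding r_def by linarith
qed

context lad_setting
begin

definition dn :: "nat \<Rightarrow> real" where "dn n = (bw n)\<^sup>2 + (y n)\<^sup>2"
definition rn :: "nat \<Rightarrow> real" where "rn n = bw n ^ 4 + bw n * (y n)\<^sup>2 + y n ^ 3"

lemma rn_small: assumes "0 \<le> C" shows "\<forall>\<^sub>F n in sequentially. C * rn n \<le> dn n"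
proof -
  have "(\<lambda>n. 2 * C * (bw n + y n)) \<longlonglongrightarrow> 2 * C * (0 + 0)" by (intro tendsto_intros bw_lim y_tendsto)
  then have "\<forall>\<^sub>F n in sequentially. 2 * C * (bw n + y n) < 1" by (intro order_tendstoD(2)) auto
  then show ?thesis using rates
  proof eventually_elim
    case (elim n)
    have "C * rn n \<le> C * ((bw n + y n) * (2 * dn n))"
      unfolding rn_def dn_def using assms elim bw_pos[of n] by (intro mult_left_mono rate_algebra) auto
    also have "\<dots> = 2 * C * (bw n + y n) * dn n" by simp
    also have "\<dots> \<le> 1 * dn n" using elim by (intro mult_right_mono) (auto simp: dn_def)
    finally show ?case by simp
  qed
qed

lemma dn_small: "\<forall>\<^sub>F n in sequentially. C * dn n \<le> 1"
proof -
  have "(\<lambda>n. C * dn n) \<longlonglongrightarrow> C * (0\<^sup>2 + 0\<^sup>2)" unfolding dn_def by (intro tendsto_intros bw_lim y_tendsto)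
  then have "\<forall>\<^sub>F n in sequentially. C * dn n < 1" by (intro order_tendstoD(2)) auto
  then show ?thesis by (auto elim: eventually_mono)
qed

lemma rates_eq: "\<forall>\<^sub>F n in sequentially.
    bw n ^ 2 + l n powr (3/2) / (N n * bw n) powr (1/2) = dn n \<and>
    bw n ^ 4 + bw n powr (1/2) * l n powr (3/2) / N n powr (1/2) + l n powr (9/4) / (N n * bw n) powr (3/4) = rn n"
  using rates
proof eventually_elim
  case (elim n)
  have pos: "0 < l n" "0 < N n" "0 < bw n" "0 < NB n" using elim bw_pos[of n] by auto
  have 2: "(y n)\<^sup>2 = l n powr (3/2) / (N n * bw n) powr (1/2)"
    and 3: "y n ^ 3 = l n powr (9/4) / (N n * bw n) powr (3/4)"
    using pos by (simp_all add: y_def power_divide powr_power NB_def)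
  have "bw n = bw n powr (1/2) * bw n powr (1/2)" using pos by (simp add: powr_add[symmetric])
  then have "bw n * (y n)\<^sup>2 = bw n powr (1/2) * bw n powr (1/2) * l n powr (3/2) / (N n powr (1/2) * bw n powr (1/2))"
    unfolding 2 using pos by (simp add: powr_mult)
  also have "\<dots> = bw n powr (1/2) * l n powr (3/2) / N n powr (1/2)" using pos by simp
  finally show ?case by (simp add: dn_def rn_def 2 3)
qed

text \<open>Near \<open>\<mu> t\<close>, the function \<open>H\<close> whose sign locates the
  minimizer is affine in the level up to an error \<open>NB n * rn n * Ce\<close>, with slope
  \<open>NB n / (b - a) * (f 0 / s t)\<close> and zero at \<open>\<mu> t + D\<^sub>0\<close>. At
  distance \<open>C * rn n\<close> from this zero the slope beats the error, so the sign is known on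
  both sides. The first rate follows from the second by bounding \<open>D\<^sub>0\<close>.\<close>

lemma lad_uniform:
  fixes Y :: "nat \<Rightarrow> nat \<Rightarrow> nat \<Rightarrow> 'a \<Rightarrow> real" and \<mu>hat :: "nat \<Rightarrow> real \<Rightarrow> 'a \<Rightarrow> real"
  assumes model: "\<And>n i j \<omega>. i \<in> {1..n} \<Longrightarrow> j \<in> {1..m n i} \<Longrightarrow> \<omega> \<in> space M \<Longrightarrow>
                  Y n i j \<omega> = \<mu> (x n i j) + s (x n i j) * err G \<epsilon> (int i) (int j) \<omega>"
    and estimator: "\<And>n t \<omega>. t \<in> {a..b} \<Longrightarrow> \<omega> \<in> space M \<Longrightarrow>
                  is_arg_min (lad_objective m x Y K bw n t \<omega>) (\<lambda>_. True) (\<mu>hat n t \<omega>)"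
  obtains C C' Bad where "0 < C" "\<And>n. Bad n \<in> events" "\<forall>\<^sub>F n in sequentially. prob (Bad n) \<le> C' / N n"
    "\<forall>\<^sub>F n in sequentially. \<forall>\<omega>\<in>space M - Bad n. \<forall>t\<in>{a + d..b - d}.
       \<bar>\<mu>hat n t \<omega> - \<mu> t\<bar> \<le> C * dn n \<and>
       \<bar>\<mu>hat n t \<omega> - \<mu> t - (psi_K K * rho_mu \<mu> s f t * bw n ^ 2
          + (b - a) * s t / f 0 * (Q_process M m x Y \<mu> K bw n t \<omega> / (N n * bw n)))\<bar> \<le> C * rn n"
proof -
  have f0: "0 < f 0" using S by (simp add: cond_S_def)
  obtain s\<^sub>0 S\<^sub>0 where s: "0 < s\<^sub>0" "0 < S\<^sub>0" "\<And>z. z \<in> {a..b} \<Longrightarrow> s\<^sub>0 \<le> s z" "\<And>z. z \<in> {a..b} \<Longrightarrow> s z \<le> S\<^sub>0"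
    by (rule s_bounds) (rule that, assumption+)
  obtain C\<^sub>\<rho> where C\<^sub>\<rho>: "0 \<le> C\<^sub>\<rho>" "\<And>t. t \<in> {a + d..b - d} \<Longrightarrow> \<bar>psi_K K * rho_mu \<mu> s f t\<bar> \<le> C\<^sub>\<rho>"
    by (rule bias_coefficient_bounded) (rule that, assumption+)
  obtain C\<^sub>Q P\<^sub>Q Bad\<^sub>Q where CQ: "0 < C\<^sub>Q" "\<And>n. Bad\<^sub>Q n \<in> events" "\<forall>\<^sub>F n in sequentially. prob (Bad\<^sub>Q n) \<le> P\<^sub>Q / N n"
    "\<forall>\<^sub>F n in sequentially. \<forall>\<omega>\<in>space M - Bad\<^sub>Q n. \<forall>t\<in>{a..b}. \<bar>emp n t (\<mu> t) \<omega>\<bar> \<le> C\<^sub>Q * NB n * (y n)\<^sup>2"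
    by (rule emp_uniform_bound) (rule that, assumption+)
  \<comment> \<open>Bounds \<open>D\<^sub>0\<close> in units of \<open>dn n\<close>: bias
    coefficient plus normalized size of the empirical process. One further unit, as in
    \<open>c6 + 1\<close> below, leaves room for the test levels, since
    \<open>C * rn n \<le> dn n\<close> eventually.\<close>
  define c6 where "c6 = C\<^sub>\<rho> + (b - a) * S\<^sub>0 / f 0 * C\<^sub>Q"
  have c6: "0 \<le> c6" using C\<^sub>\<rho> CQ(1) s ab f0 by (simp add: c6_def)
  have "0 \<le> c6 + 1" using c6 by simp
  then obtain C\<^sub>m P\<^sub>m Bad\<^sub>m where Cm: "0 < C\<^sub>m" "\<And>n. Bad\<^sub>m n \<in> events" "\<forall>\<^sub>F n in sequentially. prob (Bad\<^sub>m n) \<le> P\<^sub>m / N n"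
    "\<forall>\<^sub>F n in sequentially. \<forall>\<omega>\<in>space M - Bad\<^sub>m n. \<forall>t\<in>{a..b}. \<forall>\<Delta>. \<bar>\<Delta>\<bar> \<le> (c6 + 1) * ((bw n)\<^sup>2 + (y n)\<^sup>2) \<longrightarrow>
       \<bar>emp n t (\<mu> t + \<Delta>) \<omega> - emp n t (\<mu> t) \<omega>\<bar> \<le> C\<^sub>m * NB n * (bw n * (y n)\<^sup>2 + y n ^ 3)"
    by (rule emp_modulus) (rule that, assumption+)
  obtain C\<^sub>b where Cb: "0 < C\<^sub>b" "\<forall>\<^sub>F n in sequentially. bias_bound C\<^sub>b n"
    by (rule bias_expansion) (rule that, assumption+)
  \<comment> \<open>Fluctuation of the process; then the bias remainder, one summand each for
    \<open>bw n ^ 4\<close>, \<open>\<bar>\<Delta>\<bar> * (bw n)\<^sup>2\<close> and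
    \<open>\<Delta>\<^sup>2\<close>, the 2 being due to
    \<open>(dn n)\<^sup>2 \<le> 2 * rn n\<close>; finally the bounded Riemann error.\<close>
  define Ce where "Ce = C\<^sub>m + C\<^sub>b * (1 + (c6 + 1) + 2 * (c6 + 1)\<^sup>2) + C\<^sub>b"
  have Ce: "0 < Ce" using Cm(1) Cb(1) c6 by (simp add: Ce_def add_pos_nonneg add_nonneg_pos)
  \<comment> \<open>As \<open>s t \<le> S\<^sub>0\<close>, this choice makes the affine part at
    distance \<open>C * rn n\<close> at least \<open>NB n * rn n * (Ce + 1)\<close>, strictly above
    the error.\<close>
  define C where "C = (b - a) * S\<^sub>0 / f 0 * (Ce + 1)"
  have C: "0 < C" using Ce ab s f0 by (simp add: C_def)
  define Bad where "Bad n = Bad\<^sub>Q n \<union> Bad\<^sub>m n" for n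
  show thesis
  proof (rule that[of "C + c6 + 1" Bad "P\<^sub>Q + P\<^sub>m"])
    show "0 < C + c6 + 1" using C c6 by simp
    show "Bad n \<in> events" for n using CQ(2) Cm(2) by (simp add: Bad_def)
    show "\<forall>\<^sub>F n in sequentially. prob (Bad n) \<le> (P\<^sub>Q + P\<^sub>m) / N n"
      using CQ(3) Cm(3)
    proof eventually_elim
      case (elim n)
      have "prob (Bad n) \<le> prob (Bad\<^sub>Q n) + prob (Bad\<^sub>m n)"
        unfolding Bad_def by (rule measure_Un_le) (use CQ(2) Cm(2) in auto)
      then show ?case using elim by (simp add: add_divide_distrib)
    qed
    show "\<forall>\<^sub>F n in sequentially. \<forall>\<omega>\<in>space M - Bad n. \<forall>t\<in>{a + d..b - d}.
       \<bar>\<mu>hat n t \<omega> - \<mu> t\<bar> \<le> (C + c6 + 1) * dn n \<and>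
       \<bar>\<mu>hat n t \<omega> - \<mu> t - (psi_K K * rho_mu \<mu> s f t * bw n ^ 2
          + (b - a) * s t / f 0 * (Q_process M m x Y \<mu> K bw n t \<omega> / (N n * bw n)))\<bar> \<le> (C + c6 + 1) * rn n"
      using CQ(4) Cm(4) Cb(2) rates rn_small[OF less_imp_le[OF C]] dn_small[of "c6 + 1"]
    proof (eventually_elim, intro ballI)
      fix n \<omega> t
      assume Q: "\<forall>\<omega>\<in>space M - Bad\<^sub>Q n. \<forall>t\<in>{a..b}. \<bar>emp n t (\<mu> t) \<omega>\<bar> \<le> C\<^sub>Q * NB n * (y n)\<^sup>2"
        and md: "\<forall>\<omega>\<in>space M - Bad\<^sub>m n. \<forall>t\<in>{a..b}. \<forall>\<Delta>. \<bar>\<Delta>\<bar> \<le> (c6 + 1) * ((bw n)\<^sup>2 + (y n)\<^sup>2) \<longrightarrow>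
           \<bar>emp n t (\<mu> t + \<Delta>) \<omega> - emp n t (\<mu> t) \<omega>\<bar> \<le> C\<^sub>m * NB n * (bw n * (y n)\<^sup>2 + y n ^ 3)"
        and bias: "bias_bound C\<^sub>b n"
        and rt: "regular n"
        and rs: "C * rn n \<le> dn n" and ds: "(c6 + 1) * dn n \<le> 1"
        and \<omega>: "\<omega> \<in> space M - Bad n" and t: "t \<in> {a + d..b - d}"
      have tab: "t \<in> {a..b}" using t d by auto
      have st: "0 < s t" "s t \<le> S\<^sub>0" using s(1) s(3)[OF tab] s(4)[OF tab] by auto
      have "0 < bw n" "bw n \<le> 1" "0 < y n" "y n \<le> 1" using rt bw_pos[of n] by auto
      note ra = rate_algebra[OF this, folded dn_def rn_def]
      have NB1: "1 \<le> NB n" using rt by simp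
      have Yp: "Y n (fst p) (snd p) \<omega>' \<le> \<theta> \<longleftrightarrow> e p \<omega>' \<le> lev \<theta> (pt x n p)"
        if "p \<in> obs m n" "\<omega>' \<in> space M" for p \<omega>' \<theta>
      proof -
        have "0 < s (pt x n p)" using s(1) s(3)[OF pt_in[OF that(1)]] by simp
        then show ?thesis using model[of "fst p" n "snd p" \<omega>'] that
          by (auto simp: obs_def lev_def e_def pt_def field_simps)
      qed
      define q where "q = emp n t (\<mu> t) \<omega>"
      have Qp: "Q_process M m x Y \<mu> K bw n t \<omega> = - q"
      proof -
        have "Q_process M m x Y \<mu> K bw n t \<omega> = - (\<Sum>p\<in>obs m n.
          (of_bool (Y n (fst p) (snd p) \<omega> \<le> \<mu> t) - (\<integral>\<omega>'. of_bool (Y n (fst p) (snd p) \<omega>' \<le> \<mu> t) \<partial>M)) * K ((x n (fst p) (snd p) - t) / bw n))"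
          unfolding Q_process_def sum_obs[where m=m and n=n] ..
        also have "(\<Sum>p\<in>obs m n.
          (of_bool (Y n (fst p) (snd p) \<omega> \<le> \<mu> t) - (\<integral>\<omega>'. of_bool (Y n (fst p) (snd p) \<omega>' \<le> \<mu> t) \<partial>M)) * K ((x n (fst p) (snd p) - t) / bw n)) = q"
          unfolding q_def emp_def
        proof (rule sum.cong[OF refl])
          fix p assume p: "p \<in> obs m n"
          have "(\<integral>\<omega>'. of_bool (Y n (fst p) (snd p) \<omega>' \<le> \<mu> t) \<partial>M) = (\<integral>\<omega>'. indicat_real {\<omega>\<in>space M. e p \<omega> \<le> lev (\<mu> t) (pt x n p)} \<omega>' \<partial>M)"
            by (rule Bochner_Integration.integral_cong) (auto simp: Yp[OF p])
          also have "\<dots> = F (lev (\<mu> t) (pt x n p))" unfolding F_eq[of _ p] by simp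
          finally show "(of_bool (Y n (fst p) (snd p) \<omega> \<le> \<mu> t) - (\<integral>\<omega>'. of_bool (Y n (fst p) (snd p) \<omega>' \<le> \<mu> t) \<partial>M)) * K ((x n (fst p) (snd p) - t) / bw n)
            = w n t p * (of_bool (e p \<omega> \<le> lev (\<mu> t) (pt x n p)) - F (lev (\<mu> t) (pt x n p)))"
            using Yp[OF p, of \<omega> "\<mu> t"] \<omega> by (simp add: w_def pt_def)
        qed
        finally show ?thesis .
      qed
      \<comment> \<open>The offset at which the expanded expectation cancels the fluctuation
        \<open>q\<close>. Since \<open>Q_process\<close> equals \<open>- q\<close>, this is the
        leading term of the claimed representation.\<close>
      define D\<^sub>0 where "D\<^sub>0 = psi_K K * rho_mu \<mu> s f t * (bw n)\<^sup>2 - (b - a) * s t / f 0 * (q / NB n)"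
      have D0: "\<bar>D\<^sub>0\<bar> \<le> c6 * dn n"
      proof -
        have "\<bar>q\<bar> \<le> C\<^sub>Q * NB n * (y n)\<^sup>2" using Q \<omega> tab by (auto simp: q_def Bad_def)
        then have "\<bar>q / NB n\<bar> \<le> C\<^sub>Q * (y n)\<^sup>2" using NB1 by (simp add: field_simps)
        then have "(b - a) * s t / f 0 * \<bar>q / NB n\<bar> \<le> (b - a) * S\<^sub>0 / f 0 * (C\<^sub>Q * (y n)\<^sup>2)"
          using st ab f0 by (intro mult_mono divide_right_mono mult_left_mono) auto
        moreover have "\<bar>psi_K K * rho_mu \<mu> s f t\<bar> * (bw n)\<^sup>2 \<le> C\<^sub>\<rho> * (bw n)\<^sup>2"
          by (rule mult_right_mono[OF C\<^sub>\<rho>(2)[OF t]]) simp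
        moreover have "\<bar>D\<^sub>0\<bar> \<le> \<bar>psi_K K * rho_mu \<mu> s f t\<bar> * (bw n)\<^sup>2 + (b - a) * s t / f 0 * \<bar>q / NB n\<bar>"
        proof -
          have "\<bar>psi_K K * rho_mu \<mu> s f t * (bw n)\<^sup>2\<bar> = \<bar>psi_K K * rho_mu \<mu> s f t\<bar> * (bw n)\<^sup>2" by (simp add: abs_mult)
          moreover have "\<bar>(b - a) * s t / f 0 * (q / NB n)\<bar> = (b - a) * s t / f 0 * \<bar>q / NB n\<bar>"
            using st ab f0 by (simp add: abs_mult)
          ultimately show ?thesis unfolding D\<^sub>0_def by linarith
        qed
        moreover have "C\<^sub>\<rho> * (bw n)\<^sup>2 + (b - a) * S\<^sub>0 / f 0 * (C\<^sub>Q * (y n)\<^sup>2) \<le> c6 * dn n"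
        proof -
          have "c6 * dn n = C\<^sub>\<rho> * (bw n)\<^sup>2 + (b - a) * S\<^sub>0 / f 0 * (C\<^sub>Q * (y n)\<^sup>2) + (C\<^sub>\<rho> * (y n)\<^sup>2 + (b - a) * S\<^sub>0 / f 0 * (C\<^sub>Q * (bw n)\<^sup>2))"
            by (simp add: c6_def dn_def algebra_simps)
          moreover have "0 \<le> C\<^sub>\<rho> * (y n)\<^sup>2 + (b - a) * S\<^sub>0 / f 0 * (C\<^sub>Q * (bw n)\<^sup>2)"
            using C\<^sub>\<rho>(1) CQ(1) ab s(2) f0 by (intro add_nonneg_nonneg mult_nonneg_nonneg divide_nonneg_nonneg) auto
          ultimately show ?thesis by linarith
        qed
        ultimately show ?thesis by linarith
      qed
      define H where "H \<theta> = (\<Sum>p\<in>obs m n. (of_bool (Y n (fst p) (snd p) \<omega> \<le> \<theta>) - 1/2) * w n t p)" for \<theta>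
      have H_emp: "H \<theta> = emp n t \<theta> \<omega> + (\<Sum>p\<in>obs m n. w n t p * (F (lev \<theta> (pt x n p)) - 1/2))" for \<theta>
        unfolding H_def emp_def sum.distrib[symmetric]
        by (rule sum.cong[OF refl]) (use \<omega> in \<open>simp add: Yp algebra_simps\<close>)
      have Hbound: "\<bar>H (\<mu> t + (D\<^sub>0 + \<sigma>)) - NB n / (b - a) * (f 0 / s t) * \<sigma>\<bar> \<le> NB n * rn n * Ce"
        if \<sigma>: "\<bar>\<sigma>\<bar> \<le> dn n" for \<sigma>
      proof -
        define \<Delta> where "\<Delta> = D\<^sub>0 + \<sigma>"
        have \<Delta>: "\<bar>\<Delta>\<bar> \<le> (c6 + 1) * dn n" using D0 \<sigma> by (simp add: \<Delta>_def algebra_simps)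
        have m1: "\<bar>emp n t (\<mu> t + \<Delta>) \<omega> - q\<bar> \<le> NB n * rn n * C\<^sub>m"
        proof -
          have "\<bar>emp n t (\<mu> t + \<Delta>) \<omega> - q\<bar> \<le> C\<^sub>m * NB n * (bw n * (y n)\<^sup>2 + y n ^ 3)"
            using md \<omega> tab \<Delta> unfolding q_def dn_def by (auto simp: Bad_def)
          also have "\<dots> \<le> C\<^sub>m * NB n * rn n" using ra(4) Cm(1) NB1 by (intro mult_left_mono) auto
          finally show ?thesis by (simp add: mult_ac)
        qed
        have m2: "\<bar>bias_error n t \<Delta>\<bar>
          \<le> NB n * rn n * (C\<^sub>b * (1 + (c6 + 1) + 2 * (c6 + 1)\<^sup>2) + C\<^sub>b)"
        proof -
          have "\<bar>\<Delta>\<bar> \<le> 1" using \<Delta> ds by linarith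
          from bias[rule_format, OF t this]
          have "\<bar>bias_error n t \<Delta>\<bar>
            \<le> C\<^sub>b * NB n * (bw n ^ 4 + \<bar>\<Delta>\<bar> * (bw n)\<^sup>2 + \<Delta>\<^sup>2) + C\<^sub>b" .
          also have "C\<^sub>b * NB n * (bw n ^ 4 + \<bar>\<Delta>\<bar> * (bw n)\<^sup>2 + \<Delta>\<^sup>2) \<le> C\<^sub>b * NB n * (rn n + (c6 + 1) * rn n + (c6 + 1)\<^sup>2 * (2 * rn n))"
          proof (intro mult_left_mono add_mono ra(1))
            have "\<bar>\<Delta>\<bar> * (bw n)\<^sup>2 \<le> (c6 + 1) * dn n * (bw n)\<^sup>2" using \<Delta> by (rule mult_right_mono) simp
            also have "\<dots> \<le> (c6 + 1) * rn n" using ra(2) c6 by (simp add: mult.assoc mult_left_mono)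
            finally show "\<bar>\<Delta>\<bar> * (bw n)\<^sup>2 \<le> (c6 + 1) * rn n" .
            have "\<Delta>\<^sup>2 \<le> ((c6 + 1) * dn n)\<^sup>2" using \<Delta> abs_le_square_iff[of \<Delta> "(c6 + 1) * dn n"] by linarith
            also have "\<dots> \<le> (c6 + 1)\<^sup>2 * (2 * rn n)" using ra(3) by (simp add: power_mult_distrib mult_left_mono)
            finally show "\<Delta>\<^sup>2 \<le> (c6 + 1)\<^sup>2 * (2 * rn n)" .
          qed (use Cb(1) NB1 in auto)
          also have "\<dots> + C\<^sub>b \<le> NB n * rn n * (C\<^sub>b * (1 + (c6 + 1) + 2 * (c6 + 1)\<^sup>2) + C\<^sub>b)"
          proof -
            have "1 \<le> NB n * y n ^ 3" using rt by simp
            also have "\<dots> \<le> NB n * rn n" using ra(5) NB1 by (intro mult_left_mono) auto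
            finally have "C\<^sub>b \<le> NB n * rn n * C\<^sub>b" using Cb(1) by simp
            then show ?thesis by (simp add: algebra_simps)
          qed
          finally show ?thesis by simp
        qed
        have "NB n / (b - a) * (f 0 / s t * (\<Delta> - psi_K K * rho_mu \<mu> s f t * (bw n)\<^sup>2)) = - q + NB n / (b - a) * (f 0 / s t) * \<sigma>"
        proof -
          have "\<Delta> - psi_K K * rho_mu \<mu> s f t * (bw n)\<^sup>2 = \<sigma> - (b - a) * s t / f 0 * (q / NB n)"
            by (simp add: \<Delta>_def D\<^sub>0_def)
          then show ?thesis using NB1 ab st f0 by (simp add: right_diff_distrib)
        qed
        with m1 m2 H_emp[of "\<mu> t + \<Delta>"] have "\<bar>H (\<mu> t + \<Delta>) - NB n / (b - a) * (f 0 / s t) * \<sigma>\<bar>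
            \<le> NB n * rn n * C\<^sub>m + NB n * rn n * (C\<^sub>b * (1 + (c6 + 1) + 2 * (c6 + 1)\<^sup>2) + C\<^sub>b)" by linarith
        also have "\<dots> = NB n * rn n * Ce" by (simp add: Ce_def algebra_simps)
        finally show ?thesis by (simp only: \<Delta>_def)
      qed
      have big: "NB n * rn n * Ce < NB n / (b - a) * (f 0 / s t) * (C * rn n)"
      proof -
        have "NB n * rn n * Ce < NB n * rn n * (Ce + 1)" using NB1 ra(7) by simp
        also have "\<dots> \<le> NB n * rn n * (S\<^sub>0 / s t * (Ce + 1))"
          using NB1 ra(7) st Ce mult_right_mono[of 1 "S\<^sub>0 / s t" "Ce + 1"] by (intro mult_left_mono) auto
        also have "\<dots> = NB n / (b - a) * (f 0 / s t) * (C * rn n)"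
          using ab f0 by (simp add: C_def)
        finally show ?thesis .
      qed
      have Crn: "\<bar>C * rn n\<bar> \<le> dn n" "\<bar>- (C * rn n)\<bar> \<le> dn n" using rs C ra(7) by (simp_all add: abs_mult)
      have am: "is_arg_min (\<lambda>\<theta>. \<Sum>p\<in>obs m n. \<bar>Y n (fst p) (snd p) \<omega> - \<theta>\<bar> * w n t p) (\<lambda>_. True) (\<mu>hat n t \<omega>)"
        using estimator[OF tab, of \<omega> n] \<omega> unfolding lad_objective_def[abs_def] sum_obs[where m=m and n=n] by (simp add: w_def pt_def)
      have "0 < H (\<mu> t + (D\<^sub>0 + C * rn n))" using Hbound[OF Crn(1)] big unfolding abs_le_iff by linarith
      then have up: "\<mu>hat n t \<omega> \<le> \<mu> t + (D\<^sub>0 + C * rn n)"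
        unfolding H_def by (rule weighted_median_le[OF am w_nonneg])
      have "H (\<mu> t + (D\<^sub>0 + - (C * rn n))) < 0"
        using Hbound[OF Crn(2)] big unfolding abs_le_iff mult_minus_right by linarith
      then have down: "\<mu> t + (D\<^sub>0 + - (C * rn n)) \<le> \<mu>hat n t \<omega>"
        unfolding H_def by (rule weighted_median_ge[OF am w_nonneg])
      from up down have main: "\<bar>\<mu>hat n t \<omega> - \<mu> t - D\<^sub>0\<bar> \<le> C * rn n" by (simp add: abs_le_iff)
      have "\<bar>\<mu>hat n t \<omega> - \<mu> t\<bar> \<le> c6 * dn n + dn n" using main D0 rs by linarith
      also have "\<dots> \<le> (C + c6 + 1) * dn n" using C ra(8) by (simp add: algebra_simps)
      finally have 1: "\<bar>\<mu>hat n t \<omega> - \<mu> t\<bar> \<le> (C + c6 + 1) * dn n" .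
      have "psi_K K * rho_mu \<mu> s f t * bw n ^ 2 + (b - a) * s t / f 0 * (Q_process M m x Y \<mu> K bw n t \<omega> / (N n * bw n)) = D\<^sub>0"
        by (simp add: Qp D\<^sub>0_def NB_def)
      moreover have "C * rn n \<le> (C + c6 + 1) * rn n" using c6 ra(7) by (intro mult_right_mono) auto
      ultimately show "\<bar>\<mu>hat n t \<omega> - \<mu> t\<bar> \<le> (C + c6 + 1) * dn n \<and>
       \<bar>\<mu>hat n t \<omega> - \<mu> t - (psi_K K * rho_mu \<mu> s f t * bw n ^ 2
          + (b - a) * s t / f 0 * (Q_process M m x Y \<mu> K bw n t \<omega> / (N n * bw n)))\<bar> \<le> (C + c6 + 1) * rn n"
        using 1 main by simp
    qed
  qed
qed

end

text \<open>One constant \<open>C\<close> serves for every \<eta>: only the exceptional event has to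
  become small, and its probability tends to 0. \<open>Bad n\<close> itself is the measurable cover
  demanded by \<open>bigOp\<close>.\<close>

lemma (in prob_space) bigOpI:
  assumes "0 < C" and N: "filterlim N at_top sequentially" and "\<And>n. Bad n \<in> events"
    and prob: "\<forall>\<^sub>F n in sequentially. prob (Bad n) \<le> C' / N n"
    and le: "\<forall>\<^sub>F n in sequentially. \<forall>\<omega>\<in>space M - Bad n. \<forall>t\<in>T. \<bar>g n t \<omega>\<bar> \<le> C * r n"
  shows "bigOp M (\<lambda>n \<omega>. SUP t\<in>T. ennreal \<bar>g n t \<omega>\<bar>) r"
  unfolding bigOp_def
proof (intro allI impI exI[of _ C] conjI)
  fix \<eta> :: real assume "0 < \<eta>"
  have "(\<lambda>n. C' / N n) \<longlonglongrightarrow> 0" by (rule real_tendsto_divide_at_top[OF tendsto_const N])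
  then have "\<forall>\<^sub>F n in sequentially. C' / N n < \<eta>" using \<open>0 < \<eta>\<close> by (rule order_tendstoD)
  with prob le show "\<forall>\<^sub>F n in sequentially. \<exists>A\<in>events. {\<omega>\<in>space M. (SUP t\<in>T. ennreal \<bar>g n t \<omega>\<bar>) > ennreal (C * r n)} \<subseteq> A \<and> measure M A \<le> \<eta>"
  proof eventually_elim
    case (elim n)
    have "{\<omega>\<in>space M. (SUP t\<in>T. ennreal \<bar>g n t \<omega>\<bar>) > ennreal (C * r n)} \<subseteq> Bad n"
    proof (rule subsetI, rule ccontr)
      fix \<omega> assume \<omega>: "\<omega> \<in> {\<omega>\<in>space M. (SUP t\<in>T. ennreal \<bar>g n t \<omega>\<bar>) > ennreal (C * r n)}" "\<omega> \<notin> Bad n"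
      have "(SUP t\<in>T. ennreal \<bar>g n t \<omega>\<bar>) \<le> ennreal (C * r n)"
        by (rule SUP_least) (use elim \<omega> in \<open>auto intro!: ennreal_leI\<close>)
      with \<omega>(1) show False by (simp add: not_le[symmetric])
    qed
    with assms(3)[of n] elim show ?case by (intro bexI[of _ "Bad n"]) auto
  qed
qed (rule assms(1))

theorem theorem4p1:
  fixes M :: "'a measure"
    and \<epsilon> :: "int \<Rightarrow> int \<Rightarrow> 'a \<Rightarrow> real"
    and G :: "(int \<Rightarrow> real) \<Rightarrow> real"
    and m :: "nat \<Rightarrow> nat \<Rightarrow> nat"
    and x :: "nat \<Rightarrow> nat \<Rightarrow> nat \<Rightarrow> real"
    and a b \<delta> :: real
    and \<mu> s f\<^sub>e K :: "real \<Rightarrow> real"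
    and bw :: "nat \<Rightarrow> real"
    and Y :: "nat \<Rightarrow> nat \<Rightarrow> nat \<Rightarrow> 'a \<Rightarrow> real"
    and \<mu>hat :: "nat \<Rightarrow> real \<Rightarrow> 'a \<Rightarrow> real"
  defines "N \<equiv> sample_size m"
    and "F\<^sub>e \<equiv> cdf (distr M borel (err G \<epsilon> 0 0))"
  assumes "prob_space M"
    and "iid_array M \<epsilon>"
    and "G \<in> borel_measurable (PiM UNIV (\<lambda>_. borel))"
    and density: "\<And>u. (F\<^sub>e has_real_derivative f\<^sub>e u) (at u)"
    and median_e: "F\<^sub>e 0 = 1 / 2"
    and median_abs_e: "F\<^sub>e 1 - F\<^sub>e (-1) = 1 / 2"
    and "a < b"
    and N_lim: "filterlim N at_top sequentially"
    and D: "cond_D (distr M borel (\<epsilon> 0 0)) G"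
    and X: "cond_X a b m x"
    and K: "cond_K K"
    and S: "cond_S a b \<mu> s f\<^sub>e"
    and model: "\<And>n i j \<omega>. i \<in> {1..n} \<Longrightarrow> j \<in> {1..m n i} \<Longrightarrow> \<omega> \<in> space M \<Longrightarrow>
                  Y n i j \<omega> = \<mu> (x n i j) + s (x n i j) * err G \<epsilon> (int i) (int j) \<omega>"
    and estimator: "\<And>n t \<omega>. t \<in> {a..b} \<Longrightarrow> \<omega> \<in> space M \<Longrightarrow>
                  is_arg_min (lad_objective m x Y K bw n t \<omega>) (\<lambda>_. True) (\<mu>hat n t \<omega>)"
    and bw_pos: "\<And>n. bw n > 0"
    and bw_lim: "bw \<longlonglongrightarrow> 0"
    and bw_rate: "(\<lambda>n. ln (real (N n)) ^ 3 / (real (N n) * bw n)) \<longlonglongrightarrow> 0"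
    and "\<delta> > 0"
  shows "bigOp M
           (\<lambda>n \<omega>. SUP t\<in>{a + \<delta>..b - \<delta>}. ennreal \<bar>\<mu>hat n t \<omega> - \<mu> t\<bar>)
           (\<lambda>n. bw n ^ 2 + ln (real (N n)) powr (3/2) / (real (N n) * bw n) powr (1/2))
       \<and> bigOp M
           (\<lambda>n \<omega>. SUP t\<in>{a + \<delta>..b - \<delta>}.
              ennreal \<bar>\<mu>hat n t \<omega> - \<mu> t
                - (psi_K K * rho_mu \<mu> s f\<^sub>e t * bw n ^ 2
                   + (b - a) * s t / f\<^sub>e 0
                     * (Q_process M m x Y \<mu> K bw n t \<omega> / (real (N n) * bw n)))\<bar>)
           (\<lambda>n. bw n ^ 4
                + bw n powr (1/2) * ln (real (N n)) powr (3/2) / real (N n) powr (1/2)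
                + ln (real (N n)) powr (9/4) / (real (N n) * bw n) powr (3/4))"
proof -
  interpret prob_space M by fact
  interpret iid_errors M \<epsilon> G by unfold_locales fact+
  obtain q \<rho> C c where D': "0 < q" "0 < \<rho>" "\<rho> < 1" "0 < C"
    "\<forall>\<^sub>F k in sequentially. integrable (PiM UNIV (\<lambda>_. \<nu>)) (\<lambda>u. \<bar>G u - G (coupled k u (c k))\<bar> powr q) \<and>
       (\<integral>u. \<bar>G u - G (coupled k u (c k))\<bar> powr q \<partial>PiM UNIV (\<lambda>_. \<nu>)) \<le> C * (\<rho> ^ k) powr q"
    by (rule frozen_coupling[OF D])
  obtain R B where K': "0 < R" "0 < B" "\<And>u. 0 \<le> K u" "\<And>u. K (- u) = K u" "\<And>u. K u \<le> B"
    "\<And>u v. \<bar>K u - K v\<bar> \<le> B * \<bar>u - v\<bar>" "\<And>u. R < \<bar>u\<bar> \<Longrightarrow> K u = 0"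
    "integral {-R..R} K = 1" "integral {-R..R} (\<lambda>u. K u * u\<^sup>2) = 2 * psi_K K"
    by (rule kernel_facts[OF K]) (rule that, assumption+)
  interpret lad: lad_setting M \<epsilon> G m x a b \<delta> \<mu> s f\<^sub>e K bw R B q \<rho> C c
    by unfold_locales
      (use density median_e \<open>a < b\<close> \<open>\<delta> > 0\<close> N_lim X S bw_pos bw_lim bw_rate K' D' in \<open>simp_all add: N_def F\<^sub>e_def\<close>)
  obtain A A' Bad where A: "0 < A" "\<And>n. Bad n \<in> events" "\<forall>\<^sub>F n in sequentially. prob (Bad n) \<le> A' / lad.N n"
    "\<forall>\<^sub>F n in sequentially. \<forall>\<omega>\<in>space M - Bad n. \<forall>t\<in>{a + \<delta>..b - \<delta>}.
       \<bar>\<mu>hat n t \<omega> - \<mu> t\<bar> \<le> A * lad.dn n \<and>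
       \<bar>\<mu>hat n t \<omega> - \<mu> t - (psi_K K * rho_mu \<mu> s f\<^sub>e t * bw n ^ 2
          + (b - a) * s t / f\<^sub>e 0 * (Q_process M m x Y \<mu> K bw n t \<omega> / (lad.N n * bw n)))\<bar> \<le> A * lad.rn n"
    by (rule lad.lad_uniform[OF model estimator]) (assumption | rule that)+
  have N: "lad.N n = real (N n)" for n by (simp add: lad.N_def N_def)
  have l: "lad.l n = ln (real (N n))" for n by (simp add: lad.l_def N)
  \<comment> \<open>The rates \<open>dn\<close> and \<open>rn\<close>, built from \<open>y\<close>,
    agree with the explicit ones only for large \<open>n\<close>, when the logarithm is
    positive.\<close>
  note ev = lad.rates_eq[unfolded N l]
  show ?thesis
  proof (intro conjI bigOpI[OF A(1) lad.N_at_top A(2,3)])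
    show "\<forall>\<^sub>F n in sequentially. \<forall>\<omega>\<in>space M - Bad n. \<forall>t\<in>{a + \<delta>..b - \<delta>}. \<bar>\<mu>hat n t \<omega> - \<mu> t\<bar>
       \<le> A * (bw n ^ 2 + ln (real (N n)) powr (3/2) / (real (N n) * bw n) powr (1/2))"
      using A(4) ev by eventually_elim simp
    show "\<forall>\<^sub>F n in sequentially. \<forall>\<omega>\<in>space M - Bad n. \<forall>t\<in>{a + \<delta>..b - \<delta>}.
       \<bar>\<mu>hat n t \<omega> - \<mu> t - (psi_K K * rho_mu \<mu> s f\<^sub>e t * bw n ^ 2
          + (b - a) * s t / f\<^sub>e 0 * (Q_process M m x Y \<mu> K bw n t \<omega> / (real (N n) * bw n)))\<bar>
       \<le> A * (bw n ^ 4 + bw n powr (1/2) * ln (real (N n)) powr (3/2) / real (N n) powr (1/2)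
                + ln (real (N n)) powr (9/4) / (real (N n) * bw n) powr (3/4))"
      using A(4) ev by eventually_elim (simp add: N)
  qed
qed

end
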